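(* Let $I=(i_N,\dots,i_1)$ be a sequence without repetition in $\mathcal I$ such that $\mathrm{Res}_I$ is nonzero on $V(\boldsymbol\lambda)$. Then for every nonempty initial part $J=(i_N,i_{N-1},\dots,i_k)$ of $I$, $\alpha_{\bar J}:=\sum_{j\in\{J\}}\alpha_{\bar j}$ is a root of $\mathfrak g$. Suppose in addition that $\mathfrak g$ is simple and finite dimensional and that $\alpha_{\bar I}$ is the highest root $\tilde\alpha$. Then for every $\zeta\in V(\boldsymbol\lambda)$ the poles of $\mathrm{Res}_I(\zeta)$ that involve the coordinate $t_{\{I\}}$ can only occur where $t_{\{I\}}$ takes a value in $\{\infty,z_1,\dots,z_n\}$, where $\infty$ may be omitted in case $\zeta\in V(\boldsymbol\lambda)^{\mathrm{prim}}$. Moreover, for a suitable choice (depending on $I$) of a generator $e_{\tilde\alpha}$ of the root space $\mathfrak g_{\tilde\alpha}$, one has for all $\zeta\in V(\boldsymbol\lambda)$ $$(e_{\tilde\alpha}\zeta)_{\mathcal I-\{I\}}=\sum_{\nu=1}^n\mathrm{Res}_{(t_{\{I\}}=z_\nu)}\mathrm{Res}_I(\zeta).$$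
   Context: $(c_{k,l})_{k,l=1}^r$ is a generalized Cartan matrix ($c_{k,k}=2$; for $k\ne l$, $c_{k,l}\in\mathbb Z_{\le0}$ with $c_{k,l}=0\iff c_{l,k}=0$). $\mathfrak g$ is the complex Lie algebra with generators $e_k,f_k$ and relations, with $\check\alpha_k:=[e_k,f_k]$: $[e_k,f_l]=0$ ($k\ne l$), $[\check\alpha_k,e_l]=c_{k,l}e_l$, $[\check\alpha_k,f_l]=-c_{k,l}f_l$, $[\check\alpha_k,\check\alpha_l]=0$, and for $k\ne l$ $\mathrm{ad}(e_k)^{1-c_{k,l}}e_l=0$, $\mathrm{ad}(f_k)^{1-c_{k,l}}f_l=0$. $\mathfrak h$ is the span of the $\check\alpha_k$; the simple roots $\alpha_l\in\mathfrak h^*$ satisfy $\alpha_l(\check\alpha_k)=c_{k,l}$. $\mathcal I$ is a countable set with a surjection $\pi:\mathcal I\to\{1,\dots,r\}$ with infinite fibers $\mathcal I_k$; $\bar i=\pi(i)$. For a sequence $I$, $\{I\}$ is the set of its terms. Polydifferentials in the variables $t_i$ ($i\in\mathcal I$, each ranging over the Riemann sphere $\mathbf P$) are like differential forms except that the $dt_i$ commute, with $dt_i^2=0$; infinite sums are allowed. For $I=(i_N,\dots,i_1)$ without repetition, $\zeta_I(z)=\frac{dt_{i_N}\cdots dt_{i_1}}{(t_{i_N}-t_{i_{N-1}})\cdots(t_{i_2}-t_{i_1})(t_{i_1}-z)}$; $\zeta_\emptyset=1$; $\zeta_I=0$ if $I$ has a repetition. For an $n$-tuple $\mathbf S=(S^1,\dots,S^n)$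 of finite sequences in $\{1,\dots,r\}$, $\zeta(\mathbf S)(z_1,\dots,z_n)=\sum\zeta_{I^1}(z_1)\cdots\zeta_{I^n}(z_n)$, the sum being over $n$-tuples of sequences in $\mathcal I$ mapping under $\pi$ to $\mathbf S$. $\boldsymbol\lambda=(\lambda_1,\dots,\lambda_n)$ is an $n$-tuple of dominant weights in $\mathfrak h^*$ ($\lambda_\nu(\check\alpha_k)\ge0$). On the space $\tilde V(\boldsymbol\lambda)$ with basis the $\zeta(\mathbf S)$ define $\tilde f_k^{(\nu)}\zeta(\mathbf S)=\sum_{S^\nu=S''S'}\bigl(\lambda_\nu(\check\alpha_k)-\sum_{s\in S'}c_{k,s}\bigr)\zeta(\dots,S''kS',\dots)$ and $\tilde e_k^{(\nu)}\zeta(\mathbf S)=\zeta(\dots,S',\dots)$ if $S^\nu=kS'$, $0$ otherwise (only the $\nu$-th entry changes). $V(\boldsymbol\lambda)$ is the smallest subspace containing $1$ and stable under all these operators; it is a $\mathfrak g$-module with $e_k,f_k$ acting as $\sum_\nu\tilde e_k^{(\nu)},\sum_\nu\tilde f_k^{(\nu)}$. $V(\boldsymbol\lambda)^{\mathrm{prim}}$ is the subspace killed by all $e_k$. For distinct $i,j$, $\mathrm{Res}_{(t_i\to t_j)}$ is the residue along $(t_i=t_j)$ taken in the variable $t_i$ at the point $t_j$ ($t_j$ and the other variables being parameters), giving a polydifferential on the diagonal $(t_i=t_j)$. For $I=(i_N,\dots,i_1)$ without repetition, $\mathrm{Res}_I:=\mathrm{Res}_{(t_{i_2}\to t_{i_1})}\cdots\mathrm{Res}_{(t_{i_N}\to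 t_{i_{N-1}})}$ (the identity if $N=1$), with values in polydifferentials on the locus $t_{i_1}=\dots=t_{i_N}$, on which $t_{\{I\}}$ denotes the common coordinate. $\mathrm{Res}_{(t_{\{I\}}=p)}$ is the residue at $p$ in the variable $t_{\{I\}}$. For a polydifferential $\zeta$ and $X\subset\mathcal I$, $\zeta_X$ is the sum of the components of $\zeta$ involving only $dt_i$ with $i\in X$. *)

theory Defs
  imports
    "HOL-Complex_Analysis.Complex_Analysis"
    "HOL-Library.Poly_Mapping"
    "HOL-Library.Sublist"
begin

section \<open>Lie algebras given by generators and relations\<close>

text \<open>The complex Lie algebra presented by generators of type 'a and a set of relations is
  the set of Lie terms modulo the smallest congruence that contains the relations and makes the
  terms a complex Lie algebra.  Its elements are represented by terms; equality is
  \<open>lie_eq\<close>.\<close>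

datatype 'a lie_term =
    Gen 'a
  | Zero
  | Plus "'a lie_term" "'a lie_term"
  | Scale complex "'a lie_term"
  | Br "'a lie_term" "'a lie_term"

inductive lie_eq :: "('a lie_term \<times> 'a lie_term) set \<Rightarrow> 'a lie_term \<Rightarrow> 'a lie_term \<Rightarrow> bool"
  for R :: "('a lie_term \<times> 'a lie_term) set" where
  rel: "(x, y) \<in> R \<Longrightarrow> lie_eq R x y"
| refl: "lie_eq R x x"
| sym: "lie_eq R x y \<Longrightarrow> lie_eq R y x"
| trans [trans]: "lie_eq R x y \<Longrightarrow> lie_eq R y z \<Longrightarrow> lie_eq R x z"
| cong_Plus: "lie_eq R x x' \<Longrightarrow> lie_eq R y y' \<Longrightarrow> lie_eq R (Plus x y) (Plus x' y')"
| cong_Scale: "lie_eq R x x' \<Longrightarrow> lie_eq R (Scale a x) (Scale a x')"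
| cong_Br: "lie_eq R x x' \<Longrightarrow> lie_eq R y y' \<Longrightarrow> lie_eq R (Br x y) (Br x' y')"
| add_assoc: "lie_eq R (Plus (Plus x y) z) (Plus x (Plus y z))"
| add_comm: "lie_eq R (Plus x y) (Plus y x)"
| add_zero: "lie_eq R (Plus Zero x) x"
| add_inverse: "lie_eq R (Plus x (Scale (- 1) x)) Zero"
| scale_Plus: "lie_eq R (Scale a (Plus x y)) (Plus (Scale a x) (Scale a y))"
| scale_add: "lie_eq R (Scale (a + b) x) (Plus (Scale a x) (Scale b x))"
| scale_scale: "lie_eq R (Scale a (Scale b x)) (Scale (a * b) x)"
| scale_one: "lie_eq R (Scale 1 x) x"
| Br_Plus_left: "lie_eq R (Br (Plus x y) z) (Plus (Br x z) (Br y z))"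
| Br_Plus_right: "lie_eq R (Br x (Plus y z)) (Plus (Br x y) (Br x z))"
| Br_Scale_left: "lie_eq R (Br (Scale a x) y) (Scale a (Br x y))"
| Br_Scale_right: "lie_eq R (Br x (Scale a y)) (Scale a (Br x y))"
| Br_self: "lie_eq R (Br x x) Zero"
| Jacobi: "lie_eq R (Br x (Br y z)) (Plus (Br (Br x y) z) (Br y (Br x z)))"

definition lie_ideal :: "('a lie_term \<times> 'a lie_term) set \<Rightarrow> 'a lie_term set \<Rightarrow> bool" where
  "lie_ideal R A \<longleftrightarrow>
     Zero \<in> A \<and>
     (\<forall>x y. x \<in> A \<longrightarrow> lie_eq R x y \<longrightarrow> y \<in> A) \<and>
     (\<forall>x y. x \<in> A \<longrightarrow> y \<in> A \<longrightarrow> Plus x y \<in> A) \<and>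
     (\<forall>a x. x \<in> A \<longrightarrow> Scale a x \<in> A) \<and>
     (\<forall>x y. y \<in> A \<longrightarrow> Br x y \<in> A)"

definition lie_simple :: "('a lie_term \<times> 'a lie_term) set \<Rightarrow> bool" where
  "lie_simple R \<longleftrightarrow>
     (\<exists>x y. \<not> lie_eq R (Br x y) Zero) \<and>
     (\<forall>A. lie_ideal R A \<longrightarrow> A = {x. lie_eq R x Zero} \<or> A = UNIV)"

definition lie_finite_dim :: "('a lie_term \<times> 'a lie_term) set \<Rightarrow> bool" where
  "lie_finite_dim R \<longleftrightarrow>
     (\<exists>bs. \<forall>x. \<exists>as. length as = length bs \<and>
        lie_eq R x (foldr Plus (map2 Scale as bs) Zero))"


section \<open>The Kac-Moody algebra and its roots\<close>

definition generalized_cartan_matrix :: "('r \<Rightarrow> 'r \<Rightarrow> int) \<Rightarrow> bool" where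
  "generalized_cartan_matrix C \<longleftrightarrow>
     (\<forall>k. C k k = 2) \<and>
     (\<forall>k l. k \<noteq> l \<longrightarrow> C k l \<le> 0 \<and> (C k l = 0 \<longleftrightarrow> C l k = 0))"

datatype 'r chevalley = E 'r | F 'r

definition coroot :: "'r \<Rightarrow> 'r chevalley lie_term" where
  "coroot k = Br (Gen (E k)) (Gen (F k))"

inductive_set km_relations ::
    "('r \<Rightarrow> 'r \<Rightarrow> int) \<Rightarrow> ('r chevalley lie_term \<times> 'r chevalley lie_term) set"
  for C :: "'r \<Rightarrow> 'r \<Rightarrow> int" where
  "k \<noteq> l \<Longrightarrow> (Br (Gen (E k)) (Gen (F l)), Zero) \<in> km_relations C"
| "(Br (coroot k) (Gen (E l)), Scale (of_int (C k l)) (Gen (E l))) \<in> km_relations C"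
| "(Br (coroot k) (Gen (F l)), Scale (- of_int (C k l)) (Gen (F l))) \<in> km_relations C"
| "(Br (coroot k) (coroot l), Zero) \<in> km_relations C"
| "k \<noteq> l \<Longrightarrow> ((Br (Gen (E k)) ^^ nat (1 - C k l)) (Gen (E l)), Zero) \<in> km_relations C"
| "k \<noteq> l \<Longrightarrow> ((Br (Gen (F k)) ^^ nat (1 - C k l)) (Gen (F l)), Zero) \<in> km_relations C"

text \<open>Roots are taken in the root lattice, the free abelian group on the simple roots; an
  element is given by its coefficients on the simple roots.  If the matrix is degenerate, the
  simple roots are linearly dependent as functionals on the span of the coroots (and the
  imaginary root of an affine matrix vanishes there), so that the weight spaces of that span
  do not separate the roots; the root spaces are therefore the graded pieces for the grading in
  which \<open>E k\<close> has degree the k-th simple root and \<open>F k\<close> its negative.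
  They lie inside the corresponding weight spaces (lemma \<open>root_space_weight\<close> below) and
  are equal to them if the matrix is nondegenerate.\<close>

definition simple_root :: "'r \<Rightarrow> 'r \<Rightarrow> int" where
  "simple_root k = (\<lambda>l. if l = k then 1 else 0)"

inductive homogeneous :: "'r chevalley lie_term \<Rightarrow> ('r \<Rightarrow> int) \<Rightarrow> bool" where
  homogeneous_E: "homogeneous (Gen (E k)) (simple_root k)"
| homogeneous_F: "homogeneous (Gen (F k)) (\<lambda>l. - simple_root k l)"
| homogeneous_Zero: "homogeneous Zero \<beta>"
| homogeneous_Plus: "homogeneous x \<beta> \<Longrightarrow> homogeneous y \<beta> \<Longrightarrow> homogeneous (Plus x y) \<beta>"
| homogeneous_Scale: "homogeneous x \<beta> \<Longrightarrow> homogeneous (Scale a x) \<beta>"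
| homogeneous_Br: "homogeneous x \<beta> \<Longrightarrow> homogeneous y \<gamma> \<Longrightarrow> homogeneous (Br x y) (\<lambda>l. \<beta> l + \<gamma> l)"

definition root_space :: "('r \<Rightarrow> 'r \<Rightarrow> int) \<Rightarrow> ('r \<Rightarrow> int) \<Rightarrow> 'r chevalley lie_term set" where
  "root_space C \<beta> = {x. \<exists>y. homogeneous y \<beta> \<and> lie_eq (km_relations C) x y}"

definition is_root :: "('r \<Rightarrow> 'r \<Rightarrow> int) \<Rightarrow> ('r \<Rightarrow> int) \<Rightarrow> bool" where
  "is_root C \<beta> \<longleftrightarrow>
     \<beta> \<noteq> (\<lambda>_. 0) \<and> (\<exists>x \<in> root_space C \<beta>. \<not> lie_eq (km_relations C) x Zero)"

definition highest_root :: "('r \<Rightarrow> 'r \<Rightarrow> int) \<Rightarrow> ('r \<Rightarrow> int) \<Rightarrow> bool" where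
  "highest_root C \<beta> \<longleftrightarrow> is_root C \<beta> \<and> (\<forall>\<gamma>. is_root C \<gamma> \<longrightarrow> (\<forall>k. \<gamma> k \<le> \<beta> k))"

definition generates_root_space ::
    "('r \<Rightarrow> 'r \<Rightarrow> int) \<Rightarrow> ('r \<Rightarrow> int) \<Rightarrow> 'r chevalley lie_term \<Rightarrow> bool" where
  "generates_root_space C \<beta> x \<longleftrightarrow>
     x \<in> root_space C \<beta> \<and> \<not> lie_eq (km_relations C) x Zero \<and>
     (\<forall>y \<in> root_space C \<beta>. \<exists>a. lie_eq (km_relations C) y (Scale a x))"

definition alpha_seq :: "('i \<Rightarrow> 'r) \<Rightarrow> 'i list \<Rightarrow> 'r \<Rightarrow> int" where
  "alpha_seq \<pi> J = (\<lambda>k. \<Sum>j \<in> set J. simple_root (\<pi> j) k)"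

lemma lie_eq_Scale_0: "lie_eq R (Scale 0 x) Zero"
proof -
  have "lie_eq R (Scale 0 x) (Plus (Scale 1 x) (Scale (- 1) x))"
    using lie_eq.scale_add[of R 1 "- 1" x] by simp
  also have "lie_eq R (Plus (Scale 1 x) (Scale (- 1) x)) (Plus x (Scale (- 1) x))"
    by (intro lie_eq.cong_Plus lie_eq.scale_one lie_eq.refl)
  also have "lie_eq R (Plus x (Scale (- 1) x)) Zero"
    by (rule lie_eq.add_inverse)
  finally show ?thesis .
qed

lemma lie_eq_Scale_Zero: "lie_eq R (Scale a Zero) Zero"
proof -
  have "lie_eq R (Scale a Zero) (Scale a (Scale 0 Zero))"
    by (intro lie_eq.cong_Scale lie_eq.sym[OF lie_eq_Scale_0])
  also have "lie_eq R (Scale a (Scale 0 Zero)) (Scale 0 Zero)"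
    using lie_eq.scale_scale[of R a 0 Zero] by simp
  also have "lie_eq R (Scale 0 Zero) Zero"
    by (rule lie_eq_Scale_0)
  finally show ?thesis .
qed

lemma lie_eq_Br_Zero: "lie_eq R (Br x Zero) Zero"
proof -
  have "lie_eq R (Br x Zero) (Br x (Scale 0 Zero))"
    by (intro lie_eq.cong_Br lie_eq.refl lie_eq.sym[OF lie_eq_Scale_0])
  also have "lie_eq R (Br x (Scale 0 Zero)) (Scale 0 (Br x Zero))"
    by (rule lie_eq.Br_Scale_right)
  also have "lie_eq R (Scale 0 (Br x Zero)) Zero"
    by (rule lie_eq_Scale_0)
  finally show ?thesis .
qed

lemma homogeneous_weight:
  fixes C :: "'r::finite \<Rightarrow> 'r \<Rightarrow> int"
  assumes "homogeneous x \<beta>"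
  shows "lie_eq (km_relations C) (Br (coroot k) x)
           (Scale (of_int (\<Sum>l\<in>UNIV. \<beta> l * C k l)) x)"
  using assms
proof induction
  case (homogeneous_E l)
  have "(\<Sum>m\<in>UNIV. simple_root l m * C k m) = C k l"
    by (simp add: simple_root_def if_distrib[of "\<lambda>a. a * _"] cong: if_cong)
  then show ?case by (simp only:) (intro lie_eq.rel km_relations.intros)
next
  case (homogeneous_F l)
  have "(\<Sum>m\<in>UNIV. - simple_root l m * C k m) = - C k l"
    by (simp add: simple_root_def if_distrib[of "\<lambda>a. a * _"] sum_negf cong: if_cong)
  then show ?case by (simp only: of_int_minus) (intro lie_eq.rel km_relations.intros)
next
  case (homogeneous_Zero \<beta>)
  show ?case
    by (rule lie_eq.trans[OF lie_eq_Br_Zero lie_eq.sym[OF lie_eq_Scale_Zero]])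
next
  case (homogeneous_Plus x \<beta> y)
  show ?case
    by (rule lie_eq.trans[OF lie_eq.Br_Plus_right lie_eq.trans[OF
          lie_eq.cong_Plus[OF homogeneous_Plus.IH] lie_eq.sym[OF lie_eq.scale_Plus]]])
next
  case (homogeneous_Scale x \<beta> a)
  let ?c = "of_int (\<Sum>l\<in>UNIV. \<beta> l * C k l) :: complex"
  have "lie_eq (km_relations C) (Br (coroot k) (Scale a x)) (Scale a (Scale ?c x))"
    by (rule lie_eq.trans[OF lie_eq.Br_Scale_right lie_eq.cong_Scale[OF homogeneous_Scale.IH]])
  also have "lie_eq (km_relations C) (Scale a (Scale ?c x)) (Scale (?c * a) x)"
    using lie_eq.scale_scale[of "km_relations C" a ?c x] by (simp only: mult.commute)
  also have "lie_eq (km_relations C) (Scale (?c * a) x) (Scale ?c (Scale a x))"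
    by (rule lie_eq.sym[OF lie_eq.scale_scale])
  finally show ?case .
next
  case (homogeneous_Br x \<beta> y \<gamma>)
  let ?b = "of_int (\<Sum>l\<in>UNIV. \<beta> l * C k l) :: complex"
  let ?c = "of_int (\<Sum>l\<in>UNIV. \<gamma> l * C k l) :: complex"
  have *: "of_int (\<Sum>l\<in>UNIV. (\<beta> l + \<gamma> l) * C k l) = ?b + ?c"
    by (simp only: distrib_right sum.distrib of_int_add)
  have 1: "lie_eq (km_relations C) (Br (Br (coroot k) x) y) (Scale ?b (Br x y))"
    by (rule lie_eq.trans[OF lie_eq.cong_Br[OF homogeneous_Br.IH(1) lie_eq.refl]
          lie_eq.Br_Scale_left])
  have 2: "lie_eq (km_relations C) (Br x (Br (coroot k) y)) (Scale ?c (Br x y))"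
    by (rule lie_eq.trans[OF lie_eq.cong_Br[OF lie_eq.refl homogeneous_Br.IH(2)]
          lie_eq.Br_Scale_right])
  show ?case
    unfolding * by (rule lie_eq.trans[OF lie_eq.Jacobi lie_eq.trans[OF
          lie_eq.cong_Plus[OF 1 2] lie_eq.sym[OF lie_eq.scale_add]]])
qed

lemma root_space_weight:
  fixes C :: "'r::finite \<Rightarrow> 'r \<Rightarrow> int"
  assumes "x \<in> root_space C \<beta>"
  shows "lie_eq (km_relations C) (Br (coroot k) x)
           (Scale (of_int (\<Sum>l\<in>UNIV. \<beta> l * C k l)) x)"
proof -
  obtain y where y: "homogeneous y \<beta>" "lie_eq (km_relations C) x y"
    using assms by (auto simp: root_space_def)
  show ?thesis
    by (rule lie_eq.trans[OF lie_eq.cong_Br[OF lie_eq.refl y(2)] lie_eq.trans[OF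
          homogeneous_weight[OF y(1)] lie_eq.cong_Scale[OF lie_eq.sym[OF y(2)]]]])
qed


section \<open>The module\<close>

text \<open>A vector is a finite linear combination of basis elements indexed by tuples
  \<open>S\<close> of sequences; its realization as a polydifferential is \<open>polydiff\<close> below.
  A weight \<open>wt \<nu>\<close> is given by its values \<open>wt \<nu> k\<close> on the coroots, which form a
  basis of their span; dominance is nonnegativity of these values, and integrality is not
  required.\<close>

type_synonym ('n, 'r) vect = "('n \<Rightarrow> 'r list) \<Rightarrow>\<^sub>0 complex"

definition scale_vect :: "complex \<Rightarrow> ('n, 'r) vect \<Rightarrow> ('n, 'r) vect" where
  "scale_vect a v = Poly_Mapping.map ((*) a) v"

definition linear_extension ::
    "(('n \<Rightarrow> 'r list) \<Rightarrow> ('n, 'r) vect) \<Rightarrow> ('n, 'r) vect \<Rightarrow> ('n, 'r) vect" where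
  "linear_extension b v =
     (\<Sum>S \<in> Poly_Mapping.keys v. scale_vect (Poly_Mapping.lookup v S) (b S))"

text \<open>Here \<open>p\<close> is the length of \<open>S''\<close> in the decomposition of the
  \<open>\<nu>\<close>-th sequence as \<open>S'' @ S'\<close>.\<close>

definition f_tilde ::
    "('r \<Rightarrow> 'r \<Rightarrow> int) \<Rightarrow> ('n \<Rightarrow> 'r \<Rightarrow> real) \<Rightarrow> 'n \<Rightarrow> 'r \<Rightarrow> ('n, 'r) vect \<Rightarrow> ('n, 'r) vect" where
  "f_tilde C wt \<nu> k = linear_extension (\<lambda>S. \<Sum>p \<le> length (S \<nu>).
     Poly_Mapping.single (S(\<nu> := take p (S \<nu>) @ k # drop p (S \<nu>)))
       (of_real (wt \<nu> k) - of_int (\<Sum>s\<leftarrow>drop p (S \<nu>). C k s)))"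

definition e_tilde :: "'n \<Rightarrow> 'r \<Rightarrow> ('n, 'r) vect \<Rightarrow> ('n, 'r) vect" where
  "e_tilde \<nu> k = linear_extension (\<lambda>S. case S \<nu> of
       [] \<Rightarrow> 0
     | s # S' \<Rightarrow> if s = k then Poly_Mapping.single (S(\<nu> := S')) 1 else 0)"

inductive_set V_module :: "('r \<Rightarrow> 'r \<Rightarrow> int) \<Rightarrow> ('n \<Rightarrow> 'r \<Rightarrow> real) \<Rightarrow> ('n, 'r) vect set"
  for C :: "'r \<Rightarrow> 'r \<Rightarrow> int" and wt :: "'n \<Rightarrow> 'r \<Rightarrow> real" where
  one: "Poly_Mapping.single (\<lambda>_. []) 1 \<in> V_module C wt"
| zero: "0 \<in> V_module C wt"
| add: "v \<in> V_module C wt \<Longrightarrow> w \<in> V_module C wt \<Longrightarrow> v + w \<in> V_module C wt"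
| scale: "v \<in> V_module C wt \<Longrightarrow> scale_vect a v \<in> V_module C wt"
| e: "v \<in> V_module C wt \<Longrightarrow> e_tilde \<nu> k v \<in> V_module C wt"
| f: "v \<in> V_module C wt \<Longrightarrow> f_tilde C wt \<nu> k v \<in> V_module C wt"

text \<open>The action of the Lie algebra, on representing terms.  On \<open>V_module\<close> it only depends
  on the element represented by the term, as that space is a module over the Lie algebra.\<close>

primrec act ::
    "('r \<Rightarrow> 'r \<Rightarrow> int) \<Rightarrow> ('n::finite \<Rightarrow> 'r \<Rightarrow> real) \<Rightarrow> 'r chevalley lie_term \<Rightarrow>
     ('n, 'r) vect \<Rightarrow> ('n, 'r) vect" where
  "act C wt (Gen g) = (\<lambda>v. case g of
       E k \<Rightarrow> (\<Sum>\<nu>\<in>UNIV. e_tilde \<nu> k v)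
     | F k \<Rightarrow> (\<Sum>\<nu>\<in>UNIV. f_tilde C wt \<nu> k v))"
| "act C wt Zero = (\<lambda>v. 0)"
| "act C wt (Plus x y) = (\<lambda>v. act C wt x v + act C wt y v)"
| "act C wt (Scale a x) = (\<lambda>v. scale_vect a (act C wt x v))"
| "act C wt (Br x y) = (\<lambda>v. act C wt x (act C wt y v) - act C wt y (act C wt x v))"

definition V_prim ::
    "('r \<Rightarrow> 'r \<Rightarrow> int) \<Rightarrow> ('n::finite \<Rightarrow> 'r \<Rightarrow> real) \<Rightarrow> ('n, 'r) vect set" where
  "V_prim C wt = {v \<in> V_module C wt. \<forall>k. act C wt (Gen (E k)) v = 0}"


section \<open>Polydifferentials and residues\<close>

text \<open>A polydifferential is given by its components: \<open>\<omega> X t\<close> is the value at \<open>t\<close> of the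
  coefficient of the product of the \<open>dt\<^sub>i\<close> with \<open>i \<in> X\<close>, for a finite set \<open>X\<close>.
  As the \<open>dt\<^sub>i\<close> commute, no signs occur, and as the coefficients are rational functions that
  are regular on \<open>generic_points z\<close>, only their values there matter.\<close>

type_synonym 'i polydifferential = "'i set \<Rightarrow> ('i \<Rightarrow> complex) \<Rightarrow> complex"

definition generic_points :: "('n \<Rightarrow> complex) \<Rightarrow> ('i \<Rightarrow> complex) set" where
  "generic_points z = {t. inj t \<and> range t \<inter> range z = {}}"

definition pd_eq ::
    "('n \<Rightarrow> complex) \<Rightarrow> 'i polydifferential \<Rightarrow> 'i polydifferential \<Rightarrow> bool" where
  "pd_eq z \<omega> \<eta> \<longleftrightarrow> (\<forall>X. finite X \<longrightarrow> (\<forall>t \<in> generic_points z. \<omega> X t = \<eta> X t))"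

text \<open>Lists are in the order of the written sequences: the head of a list is the
  leftmost term \<open>i\<^sub>N\<close> and the last element is \<open>i\<^sub>1\<close>.\<close>

fun zeta_coeff :: "'i list \<Rightarrow> complex \<Rightarrow> ('i \<Rightarrow> complex) \<Rightarrow> complex" where
  "zeta_coeff [] z t = 1"
| "zeta_coeff [i] z t = 1 / (t i - z)"
| "zeta_coeff (i # j # is) z t = 1 / (t i - t j) * zeta_coeff (j # is) z t"

text \<open>The product of the \<open>\<zeta>\<close> of the sequences \<open>II \<nu>\<close> at \<open>z \<nu>\<close>; it vanishes if an index
  occurs more than once, within one sequence or in two different ones.\<close>

definition zeta_tuple ::
    "('n::finite \<Rightarrow> complex) \<Rightarrow> ('n \<Rightarrow> 'i list) \<Rightarrow> 'i polydifferential" where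
  "zeta_tuple z II X t =
     (if (\<forall>\<nu>. distinct (II \<nu>)) \<and> disjoint_family (\<lambda>\<nu>. set (II \<nu>)) \<and> X = (\<Union>\<nu>. set (II \<nu>))
      then \<Prod>\<nu>\<in>UNIV. zeta_coeff (II \<nu>) (z \<nu>) t else 0)"

text \<open>Only the finitely many tuples with all terms in \<open>X\<close> contribute to the component
  with index \<open>X\<close> of the infinite sum.\<close>

definition zeta_sum ::
    "('i \<Rightarrow> 'r) \<Rightarrow> ('n::finite \<Rightarrow> complex) \<Rightarrow> ('n \<Rightarrow> 'r list) \<Rightarrow> 'i polydifferential" where
  "zeta_sum \<pi> z S X t =
     (\<Sum>II | \<forall>\<nu>. map \<pi> (II \<nu>) = S \<nu> \<and> set (II \<nu>) \<subseteq> X. zeta_tuple z II X t)"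

definition polydiff ::
    "('i \<Rightarrow> 'r) \<Rightarrow> ('n::finite \<Rightarrow> complex) \<Rightarrow> ('n, 'r) vect \<Rightarrow> 'i polydifferential" where
  "polydiff \<pi> z v X t =
     (\<Sum>S \<in> Poly_Mapping.keys v. Poly_Mapping.lookup v S * zeta_sum \<pi> z S X t)"

definition pd_restrict :: "'i set \<Rightarrow> 'i polydifferential \<Rightarrow> 'i polydifferential" where
  "pd_restrict A \<omega> = (\<lambda>X t. if X \<subseteq> A then \<omega> X t else 0)"

text \<open>The diagonal \<open>t\<^sub>i = t\<^sub>j\<close> has the coordinates other than \<open>t\<^sub>i\<close>, so the result has no
  components that involve \<open>dt\<^sub>i\<close>.\<close>

definition Res_diag :: "'i \<Rightarrow> 'i \<Rightarrow> 'i polydifferential \<Rightarrow> 'i polydifferential" where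
  "Res_diag i j \<omega> = (\<lambda>X t.
     if i \<in> X then 0 else residue (\<lambda>w. \<omega> (insert i X) (t(i := w))) (t j))"

fun Res_seq :: "'i list \<Rightarrow> 'i polydifferential \<Rightarrow> 'i polydifferential" where
  "Res_seq [] \<omega> = \<omega>"
| "Res_seq [i] \<omega> = \<omega>"
| "Res_seq (i # j # is) \<omega> = Res_seq (j # is) (Res_diag i j \<omega>)"

definition Res_point :: "'i \<Rightarrow> complex \<Rightarrow> 'i polydifferential \<Rightarrow> 'i polydifferential" where
  "Res_point i p \<omega> = (\<lambda>X t.
     if i \<in> X then 0 else residue (\<lambda>w. \<omega> (insert i X) (t(i := w))) p)"

definition pole_at :: "'i \<Rightarrow> complex \<Rightarrow> 'i polydifferential \<Rightarrow> 'i set \<Rightarrow> ('i \<Rightarrow> complex) \<Rightarrow> bool" where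
  "pole_at i p \<omega> X t \<longleftrightarrow> is_pole (\<lambda>u. \<omega> X (t(i := u))) p"

text \<open>With the local coordinate \<open>s = 1 / t\<^sub>i\<close> at infinity one has \<open>dt\<^sub>i = - ds / s\<^sup>2\<close>.\<close>

definition pole_at_infinity ::
    "'i \<Rightarrow> 'i polydifferential \<Rightarrow> 'i set \<Rightarrow> ('i \<Rightarrow> complex) \<Rightarrow> bool" where
  "pole_at_infinity i \<omega> X t \<longleftrightarrow>
     is_pole (\<lambda>s. \<omega> X (t(i := 1 / s)) * (if i \<in> X then - 1 / s\<^sup>2 else 1)) 0"

end

theory Submission
  imports Defs
begin

text \<open>A vector of the module is a finitely supported function on tuples of words, and its
  polydifferential is the sum over tuples of sequences without repetition, the coefficient of a tuple
  being the value of the vector at the labels.  In such a sum the variable \<open>t i\<close> occurs only in the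
  two factors that connect the index \<open>i\<close> with its neighbours.  So the residue at \<open>t i = t j\<close> is
  1 if \<open>i\<close> stands immediately before \<open>j\<close>, -1 if it stands immediately after, and 0 otherwise: it
  replaces the coefficients by their differences for the two orders of adjacent letters.

  Removing the leftmost letter \<open>k\<close> is the operator \<open>e_tilde\<close>, so that the coefficients of a
  vector are values of products of these operators.  The difference for the two orders is therefore the
  value of a commutator, and the iterated residue along a sequence consists of the values of
  the iterated bracket of the corresponding generators \<open>E k\<close>, acting between the letters on its
  left and those on its right (\<open>represents_res_coeff\<close>, \<open>Res_coefficients_eq\<close>).

  Each slot of the tuple is a module over the Lie algebra (\<open>act_at_respects_lie_eq\<close>).  The Serre
  elements commute with the opposite generators.  Hence those in the \<open>F k\<close> vanish on
  every vector, by induction on the length, and those in the \<open>E k\<close> vanish on everything that is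
  generated from the constant by the operators \<open>f_tilde\<close>, which is the module.  If an
  iterated bracket is zero, then so is its action, and the residue vanishes.  This gives the
  first claim, because an initial part of the sequence is an inner part of the bracket.

  If the bracket \<open>x\<close> belongs to the highest root, then its brackets with all \<open>E j\<close> vanish, and
  the coefficients of the iterated residue do not depend on the position of the remaining index in its
  sequence.  The sum over the positions is a shuffle product with a word of length one: it gives
  the factor \<open>1 / (u - z \<nu>)\<close>, where \<open>u\<close> is the remaining coordinate (\<open>sum_insert_zeta_coeff\<close>).
  Thus the iterated residue is the sum over \<open>\<nu>\<close> of \<open>1 / (u - z \<nu>)\<close> times the
  polydifferential of the image of the vector under \<open>x\<close> in the slot \<open>\<nu>\<close>
  (\<open>Res_seq_partial_fractions\<close>).  The poles, the residues and the behaviour at infinity can be read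
  off: the residues add up to the action of \<open>x\<close>, and for a primitive vector their sum is zero.

  Finally the images of \<open>x\<close> under products of the \<open>ad (F k)\<close> span an ideal, which is everything
  if the Lie algebra is simple; all of them but \<open>x\<close> itself have smaller height, so \<open>x\<close> spans
  its root space (\<open>simple_highest_generates\<close>).\<close>


section \<open>Linear algebra in Lie terms\<close>

text \<open>Equalities of Lie terms that only use the vector space axioms are decided by comparing
  coordinates: a term is a linear combination of its generators and brackets.\<close>

primrec atom_coeff :: "'a lie_term \<Rightarrow> 'a lie_term \<Rightarrow> complex" where
  "atom_coeff (Gen g) b = (if b = Gen g then 1 else 0)"
| "atom_coeff Zero b = 0"
| "atom_coeff (Plus x y) b = atom_coeff x b + atom_coeff y b"
| "atom_coeff (Scale a x) b = a * atom_coeff x b"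
| "atom_coeff (Br x y) b = (if b = Br x y then 1 else 0)"

primrec atoms :: "'a lie_term \<Rightarrow> 'a lie_term set" where
  "atoms (Gen g) = {Gen g}"
| "atoms Zero = {}"
| "atoms (Plus x y) = atoms x \<union> atoms y"
| "atoms (Scale a x) = atoms x"
| "atoms (Br x y) = {Br x y}"

lemma finite_atoms: "finite (atoms x)"
  by (induction x) auto

definition combination :: "('a lie_term \<Rightarrow> complex) \<Rightarrow> 'a lie_term list \<Rightarrow> 'a lie_term" where
  "combination c bs = foldr (\<lambda>b. Plus (Scale (c b) b)) bs Zero"

lemma lie_eq_Plus_Zero: "lie_eq R (Plus x Zero) x"
  by (rule lie_eq.trans[OF lie_eq.add_comm lie_eq.add_zero])

lemma lie_eq_interchange:
  "lie_eq R (Plus (Plus a b) (Plus c d)) (Plus (Plus a c) (Plus b d))"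
proof -
  have "lie_eq R (Plus b (Plus c d)) (Plus c (Plus b d))"
    by (rule lie_eq.trans[OF lie_eq.sym[OF lie_eq.add_assoc] lie_eq.trans[OF
          lie_eq.cong_Plus[OF lie_eq.add_comm lie_eq.refl] lie_eq.add_assoc]])
  then show ?thesis
    by (meson lie_eq.add_assoc lie_eq.cong_Plus lie_eq.refl lie_eq.sym lie_eq.trans)
qed

lemma combination_add:
  "lie_eq R (combination (\<lambda>b. c b + d b) bs) (Plus (combination c bs) (combination d bs))"
proof (induction bs)
  case Nil
  show ?case by (simp add: combination_def lie_eq.add_zero lie_eq.sym)
next
  case (Cons b bs)
  have "lie_eq R (combination (\<lambda>b. c b + d b) (b # bs))
      (Plus (Plus (Scale (c b) b) (Scale (d b) b)) (Plus (combination c bs) (combination d bs)))"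
    using lie_eq.cong_Plus[OF lie_eq.scale_add Cons] by (simp add: combination_def)
  also have "lie_eq R \<dots> (Plus (combination c (b # bs)) (combination d (b # bs)))"
    using lie_eq_interchange by (simp add: combination_def)
  finally show ?case .
qed

lemma combination_scale:
  "lie_eq R (combination (\<lambda>b. a * c b) bs) (Scale a (combination c bs))"
proof (induction bs)
  case Nil
  show ?case by (simp add: combination_def lie_eq_Scale_Zero lie_eq.sym)
next
  case (Cons b bs)
  have "lie_eq R (combination (\<lambda>b. a * c b) (b # bs))
      (Plus (Scale a (Scale (c b) b)) (Scale a (combination c bs)))"
    using lie_eq.cong_Plus[OF lie_eq.sym[OF lie_eq.scale_scale] Cons]
    by (simp add: combination_def)
  also have "lie_eq R \<dots> (Scale a (combination c (b # bs)))"
    by (simp add: combination_def lie_eq.scale_Plus lie_eq.sym)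
  finally show ?case .
qed

lemma combination_eq_Zero:
  "(\<And>b. b \<in> set bs \<Longrightarrow> c b = 0) \<Longrightarrow> lie_eq R (combination c bs) Zero"
proof (induction bs)
  case Nil
  show ?case by (simp add: combination_def lie_eq.refl)
next
  case (Cons b bs)
  have "lie_eq R (combination c (b # bs)) (Plus Zero Zero)"
    using Cons by (simp add: combination_def lie_eq.cong_Plus lie_eq_Scale_0)
  then show ?case by (rule lie_eq.trans[OF _ lie_eq.add_zero])
qed

lemma combination_single:
  assumes "distinct bs" "x \<in> set bs"
  shows "lie_eq R (combination (\<lambda>b. if b = x then 1 else 0) bs) x"
  using assms
proof (induction bs)
  case (Cons b bs)
  let ?c = "\<lambda>b. if b = x then 1 else 0 :: complex"
  show ?case
  proof (cases "b = x")
    case True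
    then have "lie_eq R (combination ?c bs) Zero"
      using Cons.prems by (intro combination_eq_Zero) auto
    then have "lie_eq R (combination ?c (b # bs)) (Plus x Zero)"
      using True by (simp add: combination_def lie_eq.cong_Plus lie_eq.scale_one)
    then show ?thesis by (rule lie_eq.trans[OF _ lie_eq_Plus_Zero])
  next
    case False
    then have "lie_eq R (combination ?c bs) x" using Cons by simp
    then have "lie_eq R (combination ?c (b # bs)) (Plus Zero x)"
      using False by (simp add: combination_def lie_eq.cong_Plus lie_eq_Scale_0)
    then show ?thesis by (rule lie_eq.trans[OF _ lie_eq.add_zero])
  qed
qed simp

lemma lie_eq_combination:
  "distinct bs \<Longrightarrow> atoms x \<subseteq> set bs \<Longrightarrow> lie_eq R (combination (atom_coeff x) bs) x"
proof (induction x)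
  case (Gen g)
  then show ?case using combination_single[of bs "Gen g"] by simp
next
  case Zero
  then show ?case by (simp add: combination_eq_Zero)
next
  case (Plus x y)
  then show ?case
    using lie_eq.trans[OF combination_add lie_eq.cong_Plus] by simp
next
  case (Scale a x)
  then show ?case
    using lie_eq.trans[OF combination_scale lie_eq.cong_Scale] by simp
next
  case (Br x y)
  then show ?case using combination_single[of bs "Br x y"] by simp
qed

lemma lie_eq_by_coeff:
  assumes "\<And>b. atom_coeff x b = atom_coeff y b"
  shows "lie_eq R x y"
proof -
  obtain bs where bs: "distinct bs" "set bs = atoms x \<union> atoms y"
    using finite_distinct_list[OF finite_UnI[OF finite_atoms finite_atoms]] by blast
  have "atom_coeff x = atom_coeff y" using assms by blast
  with bs show ?thesis
    using lie_eq_combination[of bs x] lie_eq_combination[of bs y]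
    by (metis Un_upper1 Un_upper2 lie_eq.sym lie_eq.trans)
qed

lemma lie_eq_Plus_Scale_minus_iff:
  "lie_eq R (Plus x (Scale (- a) y)) Zero \<longleftrightarrow> lie_eq R x (Scale a y)"
proof
  assume "lie_eq R (Plus x (Scale (- a) y)) Zero"
  then have "lie_eq R (Plus (Plus x (Scale (- a) y)) (Scale a y)) (Plus Zero (Scale a y))"
    by (rule lie_eq.cong_Plus[OF _ lie_eq.refl])
  moreover have "lie_eq R x (Plus (Plus x (Scale (- a) y)) (Scale a y))"
    by (rule lie_eq_by_coeff) simp
  ultimately show "lie_eq R x (Scale a y)"
    by (meson lie_eq.trans lie_eq.add_zero)
next
  assume "lie_eq R x (Scale a y)"
  then have "lie_eq R (Plus x (Scale (- a) y)) (Plus (Scale a y) (Scale (- a) y))"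
    by (rule lie_eq.cong_Plus[OF _ lie_eq.refl])
  moreover have "lie_eq R (Plus (Scale a y) (Scale (- a) y)) Zero"
    by (rule lie_eq_by_coeff) simp
  ultimately show "lie_eq R (Plus x (Scale (- a) y)) Zero"
    by (rule lie_eq.trans)
qed

lemma lie_eq_Br_swap: "lie_eq R (Br x y) (Scale (- 1) (Br y x))"
proof -
  have *: "lie_eq R (Br (Plus x y) (Plus x y))
      (Plus (Plus Zero (Br x y)) (Plus (Br y x) Zero))"
    by (meson lie_eq.Br_Plus_left lie_eq.Br_Plus_right lie_eq.Br_self lie_eq.cong_Plus
        lie_eq.refl lie_eq.trans)
  have "lie_eq R (Plus (Br x y) (Scale (- (- 1)) (Br y x)))
      (Plus (Plus Zero (Br x y)) (Plus (Br y x) Zero))"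
    by (rule lie_eq_by_coeff) simp
  also have "lie_eq R \<dots> Zero"
    by (rule lie_eq.trans[OF lie_eq.sym[OF *] lie_eq.Br_self])
  finally show ?thesis unfolding lie_eq_Plus_Scale_minus_iff .
qed

lemma lie_eq_Br_right_Zero: "lie_eq R y Zero \<Longrightarrow> lie_eq R (Br x y) Zero"
  by (rule lie_eq.trans[OF lie_eq.cong_Br[OF lie_eq.refl] lie_eq_Br_Zero])

lemma lie_eq_Br_left_Zero: "lie_eq R x Zero \<Longrightarrow> lie_eq R (Br x y) Zero"
  by (rule lie_eq.trans[OF lie_eq_Br_swap lie_eq.trans[OF
        lie_eq.cong_Scale[OF lie_eq_Br_right_Zero] lie_eq_Scale_Zero]])

lemma lie_eq_Br_right_scale:
  "lie_eq R y (Scale a z) \<Longrightarrow> lie_eq R (Br x y) (Scale a (Br x z))"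
  by (rule lie_eq.trans[OF lie_eq.cong_Br[OF lie_eq.refl] lie_eq.Br_Scale_right])

lemma lie_eq_Br_left_scale:
  "lie_eq R x (Scale a z) \<Longrightarrow> lie_eq R (Br x y) (Scale a (Br z y))"
  by (rule lie_eq.trans[OF lie_eq.cong_Br[OF _ lie_eq.refl] lie_eq.Br_Scale_left])

lemma lie_eq_Plus_Zero_Zero:
  "lie_eq R x Zero \<Longrightarrow> lie_eq R y Zero \<Longrightarrow> lie_eq R (Plus x y) Zero"
  by (rule lie_eq.trans[OF lie_eq.cong_Plus lie_eq.add_zero])

text \<open>The form of the Jacobi identity for an operator \<open>ad x\<close> that acts on both arguments of a
  bracket by scalars.\<close>

lemma lie_eq_Jacobi_scale:
  assumes "lie_eq R (Br (Br x y) z) (Scale a w)" "lie_eq R (Br y (Br x z)) (Scale b w)"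
  shows "lie_eq R (Br x (Br y z)) (Scale (a + b) w)"
proof -
  have "lie_eq R (Br x (Br y z)) (Plus (Scale a w) (Scale b w))"
    by (rule lie_eq.trans[OF lie_eq.Jacobi lie_eq.cong_Plus[OF assms]])
  also have "lie_eq R \<dots> (Scale (a + b) w)"
    by (rule lie_eq.sym[OF lie_eq.scale_add])
  finally show ?thesis .
qed

lemma lie_eq_Scale_cong_0: "a = 0 \<Longrightarrow> lie_eq R (Scale a x) Zero"
  by (simp add: lie_eq_Scale_0)


section \<open>Serre elements are annihilated by the opposite generators\<close>

text \<open>Each bracket with \<open>f\<close> contributes \<open>- 2\<close> to the eigenvalue of \<open>h\<close>.\<close>

lemma lie_eq_Br_ad_weight:
  assumes hf: "lie_eq R (Br h f) (Scale (- 2) f)"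
    and hg: "lie_eq R (Br h g) (Scale (- c) g)"
  shows "lie_eq R (Br h ((Br f ^^ m) g)) (Scale (- (2 * of_nat m + c)) ((Br f ^^ m) g))"
proof (induction m)
  case 0
  then show ?case using hg by simp
next
  case (Suc m)
  have "lie_eq R (Br h (Br f ((Br f ^^ m) g)))
      (Scale (- 2 + - (2 * of_nat m + c)) (Br f ((Br f ^^ m) g)))"
    by (rule lie_eq_Jacobi_scale[OF lie_eq_Br_left_scale[OF hf] lie_eq_Br_right_scale[OF Suc]])
  then show ?case by (simp add: algebra_simps)
qed

text \<open>The computation with an sl(2)-triple.  The factor vanishes for \<open>m = - c\<close>, that is, after the
  \<open>1 - c\<close> brackets of the Serre relation.\<close>

lemma lie_eq_Br_ad_raise:
  assumes ef: "lie_eq R (Br e f) h"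
    and eg: "lie_eq R (Br e g) Zero"
    and hf: "lie_eq R (Br h f) (Scale (- 2) f)"
    and hg: "lie_eq R (Br h g) (Scale (- c) g)"
  shows "lie_eq R (Br e ((Br f ^^ Suc m) g))
     (Scale (of_nat (Suc m) * (- c - of_nat m)) ((Br f ^^ m) g))"
proof (induction m)
  case 0
  have "lie_eq R (Br (Br e f) g) (Scale (- c) g)"
    by (rule lie_eq.trans[OF lie_eq.cong_Br[OF ef lie_eq.refl] hg])
  moreover have "lie_eq R (Br f (Br e g)) (Scale 0 g)"
    by (rule lie_eq.trans[OF lie_eq_Br_right_Zero[OF eg] lie_eq.sym[OF lie_eq_Scale_0]])
  ultimately show ?case using lie_eq_Jacobi_scale[of R e f g "- c" g 0] by simp
next
  case (Suc m)
  let ?y = "(Br f ^^ Suc m) g"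
  have 1: "lie_eq R (Br (Br e f) ?y) (Scale (- (2 * of_nat (Suc m) + c)) ?y)"
    by (rule lie_eq.trans[OF lie_eq.cong_Br[OF ef lie_eq.refl] lie_eq_Br_ad_weight[OF hf hg]])
  have 2: "lie_eq R (Br f (Br e ?y)) (Scale (of_nat (Suc m) * (- c - of_nat m)) ?y)"
    using lie_eq_Br_right_scale[OF Suc] by simp
  have *: "- (2 * of_nat (Suc m) + c) + of_nat (Suc m) * (- c - of_nat m)
      = of_nat (Suc (Suc m)) * (- c - of_nat (Suc m))"
    by (simp add: algebra_simps)
  show ?case
    using lie_eq_Jacobi_scale[OF 1 2] unfolding * by simp
qed

lemma lie_eq_Br_ad_commute:
  assumes "lie_eq R (Br e f) Zero"
  shows "lie_eq R (Br e ((Br f ^^ m) g)) ((Br f ^^ m) (Br e g))"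
proof (induction m)
  case 0
  then show ?case by (simp add: lie_eq.refl)
next
  case (Suc m)
  have "lie_eq R (Br e (Br f ((Br f ^^ m) g)))
      (Plus Zero (Br f ((Br f ^^ m) (Br e g))))"
    by (rule lie_eq.trans[OF lie_eq.Jacobi lie_eq.cong_Plus[OF lie_eq_Br_left_Zero[OF assms]
            lie_eq.cong_Br[OF lie_eq.refl Suc]]])
  then show ?case using lie_eq.trans lie_eq.add_zero by (simp, blast)
qed

lemma lie_eq_ad_Zero: "lie_eq R g Zero \<Longrightarrow> lie_eq R ((Br f ^^ m) g) Zero"
  by (induction m) (simp_all add: lie_eq_Br_right_Zero)

text \<open>For \<open>j = k\<close> this is the computation with an sl(2)-triple.  For \<open>j = l\<close> the factor \<open>f l\<close>
  is replaced by \<open>h l\<close>, which two brackets with \<open>f k\<close> annihilate; if there is only one, then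
  \<open>C k l = 0\<close>, hence \<open>C l k = 0\<close>, and one is enough.  The families \<open>e\<close> and \<open>f\<close> are
  variables as they are to be raising and lowering generators or, with the sign of \<open>h\<close> changed,
  lowering and raising ones.\<close>

lemma serre_commutes:
  fixes C :: "'r \<Rightarrow> 'r \<Rightarrow> int"
  assumes C: "generalized_cartan_matrix C" and kl: "k \<noteq> l"
    and ef: "\<And>j. lie_eq R (Br (e j) (f j)) (h j)"
    and ef0: "\<And>j j'. j \<noteq> j' \<Longrightarrow> lie_eq R (Br (e j) (f j')) Zero"
    and hf: "\<And>j j'. lie_eq R (Br (h j) (f j')) (Scale (- of_int (C j j')) (f j'))"
  shows "lie_eq R (Br (e j) ((Br (f k) ^^ nat (1 - C k l)) (f l))) Zero"
proof -
  have Ckk: "C k k = 2" and Ckl: "C k l \<le> 0" and C0: "C k l = 0 \<longleftrightarrow> C l k = 0"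
    using C kl by (auto simp: generalized_cartan_matrix_def)
  define m where "m = nat (- C k l)"
  have m: "nat (1 - C k l) = Suc m" using Ckl by (simp add: m_def)
  have mC: "- of_int (C k l) - of_nat m = (0 :: complex)" using Ckl by (simp add: m_def)
  consider "j = k" | "j = l" | "j \<noteq> k" "j \<noteq> l" by blast
  then show ?thesis
  proof cases
    case 1
    have "lie_eq R (Br (e k) ((Br (f k) ^^ Suc m) (f l)))
       (Scale (of_nat (Suc m) * (- of_int (C k l) - of_nat m)) ((Br (f k) ^^ m) (f l)))"
      using hf[of k k] by (intro lie_eq_Br_ad_raise[OF ef ef0[OF kl] _ hf]) (simp add: Ckk)
    then show ?thesis
      unfolding 1 m mC by (rule lie_eq.trans[OF _ lie_eq_Scale_cong_0]) simp
  next
    case 2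
    have "lie_eq R (Br (e l) ((Br (f k) ^^ Suc m) (f l))) ((Br (f k) ^^ Suc m) (Br (e l) (f l)))"
      using kl by (intro lie_eq_Br_ad_commute ef0) simp
    also have "lie_eq R \<dots> Zero"
    proof -
      have *: "lie_eq R (Br (f k) (Br (e l) (f l))) (Scale (of_int (C l k)) (f k))"
      proof -
        have "lie_eq R (Br (f k) (Br (e l) (f l))) (Scale (- 1) (Br (Br (e l) (f l)) (f k)))"
          by (rule lie_eq_Br_swap)
        also have "lie_eq R \<dots> (Scale (- 1) (Scale (- of_int (C l k)) (f k)))"
          by (rule lie_eq.cong_Scale[OF lie_eq.trans[OF lie_eq.cong_Br[OF ef lie_eq.refl] hf]])
        also have "lie_eq R \<dots> (Scale (of_int (C l k)) (f k))"
          by (rule lie_eq_by_coeff) simp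
        finally show ?thesis .
      qed
      show ?thesis
      proof (cases m)
        case 0
        then have "C l k = 0" using Ckl C0 by (simp add: m_def)
        then show ?thesis using * 0 lie_eq.trans[OF _ lie_eq_Scale_0] by simp
      next
        case (Suc m')
        have "lie_eq R (Br (f k) (Br (f k) (Br (e l) (f l)))) Zero"
          by (rule lie_eq.trans[OF lie_eq_Br_right_scale[OF *] lie_eq.trans[OF
                lie_eq.cong_Scale[OF lie_eq.Br_self] lie_eq_Scale_Zero]])
        then have "lie_eq R ((Br (f k) ^^ m') (Br (f k) (Br (f k) (Br (e l) (f l))))) Zero"
          by (rule lie_eq_ad_Zero)
        then show ?thesis unfolding Suc by (simp add: funpow_swap1)
      qed
    qed
    finally show ?thesis unfolding 2 m .
  next
    case 3
    then show ?thesis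
      by (intro lie_eq.trans[OF lie_eq_Br_ad_commute lie_eq_ad_Zero] ef0) auto
  qed
qed

section \<open>Operators on vectors\<close>

lemma lookup_scale_vect [simp]:
  "Poly_Mapping.lookup (scale_vect a v) S = a * Poly_Mapping.lookup v S"
  by (simp add: scale_vect_def Poly_Mapping.map.rep_eq when_def)

lemma lookup_minus_vect [simp]:
  "Poly_Mapping.lookup (v - w :: ('n, 'r) vect) S = Poly_Mapping.lookup v S - Poly_Mapping.lookup w S"
  by (simp add: lookup_minus)

lemma scale_vect_simps [simp]:
  "scale_vect 0 v = 0" "scale_vect a 0 = 0" "scale_vect 1 v = v"
  "scale_vect a (scale_vect b v) = scale_vect (a * b) v"
  "scale_vect a (Poly_Mapping.single S b) = Poly_Mapping.single S (a * b)"
  by (auto intro!: poly_mapping_eqI simp: lookup_single when_def)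

lemma scale_vect_distrib:
  "scale_vect a (v + w) = scale_vect a v + scale_vect a w"
  "scale_vect a (v - w) = scale_vect a v - scale_vect a w"
  "scale_vect (a + b) v = scale_vect a v + scale_vect b v"
  "scale_vect (- 1) v = - v"
  by (auto intro!: poly_mapping_eqI simp: lookup_add algebra_simps)

lemma scale_vect_sum: "scale_vect a (sum g A) = (\<Sum>x\<in>A. scale_vect a (g x))"
  by (rule poly_mapping_eqI) (simp add: lookup_sum sum_distrib_left)

definition vect_linear :: "(('n, 'r) vect \<Rightarrow> ('n, 'r) vect) \<Rightarrow> bool" where
  "vect_linear T \<longleftrightarrow> (\<forall>v w. T (v + w) = T v + T w) \<and> (\<forall>a v. T (scale_vect a v) = scale_vect a (T v))"

lemma vect_linearD:
  assumes "vect_linear T"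
  shows "T (v + w) = T v + T w" "T (scale_vect a v) = scale_vect a (T v)" "T 0 = 0"
    "T (v - w) = T v - T w"
proof -
  show add: "T (v + w) = T v + T w" for v w using assms by (simp add: vect_linear_def)
  show scale: "T (scale_vect a v) = scale_vect a (T v)" for a v
    using assms by (simp add: vect_linear_def)
  show "T 0 = 0" using scale[of 0 0] by simp
  show "T (v - w) = T v - T w" using add[of "v - w" w] by simp
qed

lemma vect_linear_sum: "vect_linear T \<Longrightarrow> T (sum g A) = (\<Sum>x\<in>A. T (g x))"
  by (induction A rule: infinite_finite_induct) (simp_all add: vect_linearD)

lemma linear_extension_superset:
  assumes "finite A" "Poly_Mapping.keys v \<subseteq> A"
  shows "linear_extension b v = (\<Sum>S\<in>A. scale_vect (Poly_Mapping.lookup v S) (b S))"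
  unfolding linear_extension_def
  by (rule sum.mono_neutral_left) (use assms in \<open>auto simp: in_keys_iff\<close>)

lemma vect_linear_linear_extension: "vect_linear (linear_extension b)"
proof -
  have "linear_extension b (v + w) = linear_extension b v + linear_extension b w" for v w
  proof -
    let ?A = "Poly_Mapping.keys v \<union> Poly_Mapping.keys w"
    have "linear_extension b u = (\<Sum>S\<in>?A. scale_vect (Poly_Mapping.lookup u S) (b S))"
      if "u = v \<or> u = w \<or> u = v + w" for u
      using that Poly_Mapping.keys_add[of v w] by (intro linear_extension_superset) auto
    then show ?thesis by (simp add: lookup_add scale_vect_distrib sum.distrib)
  qed
  moreover have "linear_extension b (scale_vect a v) = scale_vect a (linear_extension b v)" for a v
  proof -
    have "linear_extension b (scale_vect a v)
        = (\<Sum>S\<in>Poly_Mapping.keys v. scale_vect (Poly_Mapping.lookup (scale_vect a v) S) (b S))"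
      by (intro linear_extension_superset) (auto simp: in_keys_iff)
    then show ?thesis by (simp add: linear_extension_def scale_vect_sum)
  qed
  ultimately show ?thesis by (simp add: vect_linear_def)
qed

lemma linear_extension_single [simp]:
  "linear_extension b (Poly_Mapping.single S a) = scale_vect a (b S)"
  by (subst linear_extension_superset[of "{S}"]) auto

lemma vect_expansion:
  "v = (\<Sum>S\<in>Poly_Mapping.keys v. scale_vect (Poly_Mapping.lookup v S) (Poly_Mapping.single S 1))"
  by (rule poly_mapping_eqI)
    (simp add: lookup_sum lookup_single when_def sum.delta if_distrib[of "\<lambda>x. _ * x"] in_keys_iff
      cong: if_cong)

lemma vect_linear_eqI:
  assumes "vect_linear T" "vect_linear U"
    and "\<And>S. T (Poly_Mapping.single S 1) = U (Poly_Mapping.single S 1)"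
  shows "T v = U v"
proof -
  have *: "V v = (\<Sum>S\<in>Poly_Mapping.keys v.
      scale_vect (Poly_Mapping.lookup v S) (V (Poly_Mapping.single S 1)))" if "vect_linear V" for V
    using that
    by (subst vect_expansion) (simp only: vect_linear_sum vect_linearD)
  show ?thesis using assms by (simp add: *[of T] *[of U])
qed

lemma vect_linear_comp: "vect_linear T \<Longrightarrow> vect_linear U \<Longrightarrow> vect_linear (\<lambda>v. T (U v))"
  by (simp add: vect_linear_def)

lemma vect_linear_add: "vect_linear T \<Longrightarrow> vect_linear U \<Longrightarrow> vect_linear (\<lambda>v. T v + U v)"
  by (simp add: vect_linear_def scale_vect_distrib)

lemma vect_linear_diff: "vect_linear T \<Longrightarrow> vect_linear U \<Longrightarrow> vect_linear (\<lambda>v. T v - U v)"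
  by (simp add: vect_linear_def scale_vect_distrib)

lemma vect_linear_scale: "vect_linear T \<Longrightarrow> vect_linear (\<lambda>v. scale_vect a (T v))"
  by (simp add: vect_linear_def scale_vect_distrib mult.commute)

lemma vect_linear_if: "vect_linear T \<Longrightarrow> vect_linear (\<lambda>v. if b then T v else 0)"
  by (cases b) (simp_all add: vect_linear_def)

lemma vect_linear_e: "vect_linear (e_tilde \<nu> k)"
  unfolding e_tilde_def by (rule vect_linear_linear_extension)

lemma vect_linear_f: "vect_linear (f_tilde C wt \<nu> k)"
  unfolding f_tilde_def by (rule vect_linear_linear_extension)

text \<open>The eigenvalue of a coroot on a basis vector: every letter of the word subtracts a simple root
  from the weight.\<close>

definition lowered_weight ::
    "('r \<Rightarrow> 'r \<Rightarrow> int) \<Rightarrow> ('n \<Rightarrow> 'r \<Rightarrow> real) \<Rightarrow> 'n \<Rightarrow> 'r \<Rightarrow> 'r list \<Rightarrow> complex" where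
  "lowered_weight C wt \<nu> k xs = of_real (wt \<nu> k) - of_int (\<Sum>s\<leftarrow>xs. C k s)"

lemma lowered_weight_simps [simp]:
  "lowered_weight C wt \<nu> k [] = of_real (wt \<nu> k)"
  "lowered_weight C wt \<nu> k (l # xs) = lowered_weight C wt \<nu> k xs - of_int (C k l)"
  "lowered_weight C wt \<nu> k (xs @ l # ys) = lowered_weight C wt \<nu> k (xs @ ys) - of_int (C k l)"
  by (simp_all add: lowered_weight_def)

definition h_tilde ::
    "('r \<Rightarrow> 'r \<Rightarrow> int) \<Rightarrow> ('n \<Rightarrow> 'r \<Rightarrow> real) \<Rightarrow> 'n \<Rightarrow> 'r \<Rightarrow> ('n, 'r) vect \<Rightarrow> ('n, 'r) vect" where
  "h_tilde C wt \<nu> k = linear_extension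
     (\<lambda>S. Poly_Mapping.single S (lowered_weight C wt \<nu> k (S \<nu>)))"

lemma vect_linear_h: "vect_linear (h_tilde C wt \<nu> k)"
  unfolding h_tilde_def by (rule vect_linear_linear_extension)

lemma h_tilde_single [simp]:
  "h_tilde C wt \<nu> k (Poly_Mapping.single S a)
    = Poly_Mapping.single S (lowered_weight C wt \<nu> k (S \<nu>) * a)"
  by (simp add: h_tilde_def mult.commute)

lemma e_tilde_single:
  "e_tilde \<nu> k (Poly_Mapping.single S a) =
     (case S \<nu> of [] \<Rightarrow> 0 | s # S' \<Rightarrow> if s = k then Poly_Mapping.single (S(\<nu> := S')) a else 0)"
  by (simp add: e_tilde_def split: list.split)

definition insert_letter :: "'n \<Rightarrow> nat \<Rightarrow> 'a \<Rightarrow> ('n \<Rightarrow> 'a list) \<Rightarrow> 'n \<Rightarrow> 'a list" where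
  "insert_letter \<nu> p k S = S(\<nu> := take p (S \<nu>) @ k # drop p (S \<nu>))"

lemma f_tilde_single:
  "f_tilde C wt \<nu> k (Poly_Mapping.single S a) = (\<Sum>p\<le>length (S \<nu>).
     Poly_Mapping.single (insert_letter \<nu> p k S) (a * lowered_weight C wt \<nu> k (drop p (S \<nu>))))"
  by (simp add: f_tilde_def scale_vect_sum insert_letter_def lowered_weight_def)

lemma lookup_e_tilde [simp]:
  "Poly_Mapping.lookup (e_tilde \<nu> k v) S = Poly_Mapping.lookup v (S(\<nu> := k # S \<nu>))"
proof -
  have *: "T(\<nu> := S') = S \<longleftrightarrow> T = S(\<nu> := k # S \<nu>)" if "T \<nu> = k # S'" for T S'
    using that by (auto simp: fun_eq_iff)
  have lin: "vect_linear (e_tilde \<nu> k)" by (rule vect_linear_e)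
  have "Poly_Mapping.lookup (e_tilde \<nu> k v) S = (\<Sum>T\<in>Poly_Mapping.keys v.
      Poly_Mapping.lookup v T * Poly_Mapping.lookup (e_tilde \<nu> k (Poly_Mapping.single T 1)) S)"
    by (subst vect_expansion[of v]) (simp only: vect_linear_sum[OF lin] vect_linearD[OF lin]
        lookup_sum lookup_scale_vect)
  also have "\<dots> = (\<Sum>T\<in>Poly_Mapping.keys v.
      if T = S(\<nu> := k # S \<nu>) then Poly_Mapping.lookup v T else 0)"
    by (intro sum.cong HOL.refl)
      (auto simp: e_tilde_single lookup_single when_def * split: list.split)
  also have "\<dots> = Poly_Mapping.lookup v (S(\<nu> := k # S \<nu>))"
    by (simp add: sum.delta in_keys_iff)
  finally show ?thesis .
qed

lemma lookup_h_tilde [simp]: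
  "Poly_Mapping.lookup (h_tilde C wt \<nu> k v) S
    = lowered_weight C wt \<nu> k (S \<nu>) * Poly_Mapping.lookup v S"
proof -
  have lin: "vect_linear (h_tilde C wt \<nu> k)" by (rule vect_linear_h)
  have "Poly_Mapping.lookup (h_tilde C wt \<nu> k v) S = (\<Sum>T\<in>Poly_Mapping.keys v.
      Poly_Mapping.lookup v T * Poly_Mapping.lookup (h_tilde C wt \<nu> k (Poly_Mapping.single T 1)) S)"
    by (subst vect_expansion[of v]) (simp only: vect_linear_sum[OF lin] vect_linearD[OF lin]
        lookup_sum lookup_scale_vect)
  also have "\<dots> = (\<Sum>T\<in>Poly_Mapping.keys v.
      if T = S then lowered_weight C wt \<nu> k (T \<nu>) * Poly_Mapping.lookup v T else 0)"
    by (intro sum.cong HOL.refl) (auto simp: lookup_single when_def)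
  also have "\<dots> = lowered_weight C wt \<nu> k (S \<nu>) * Poly_Mapping.lookup v S"
    by (simp add: sum.delta in_keys_iff)
  finally show ?thesis .
qed

lemma e_f_same_slot:
  "e_tilde \<nu> k (f_tilde C wt \<nu> l v) - f_tilde C wt \<nu> l (e_tilde \<nu> k v)
    = (if k = l then h_tilde C wt \<nu> k v else 0)"
proof (rule vect_linear_eqI[where v = v])
  show "vect_linear (\<lambda>v. e_tilde \<nu> k (f_tilde C wt \<nu> l v) - f_tilde C wt \<nu> l (e_tilde \<nu> k v))"
    by (intro vect_linear_diff vect_linear_comp[OF vect_linear_e vect_linear_f]
        vect_linear_comp[OF vect_linear_f vect_linear_e])
  show "vect_linear (\<lambda>v. if k = l then h_tilde C wt \<nu> k v else 0)"
    by (intro vect_linear_if vect_linear_h)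
next
  fix S :: "'a \<Rightarrow> 'b list"
  let ?one = "Poly_Mapping.single S 1 :: ('a, 'b) vect"
  have "e_tilde \<nu> k (f_tilde C wt \<nu> l ?one) = (\<Sum>p\<le>length (S \<nu>). e_tilde \<nu> k
      (Poly_Mapping.single (insert_letter \<nu> p l S) (lowered_weight C wt \<nu> l (drop p (S \<nu>)))))"
    by (simp add: f_tilde_single vect_linear_sum[OF vect_linear_e])
  also have "\<dots> = (if k = l then h_tilde C wt \<nu> k ?one else 0) + f_tilde C wt \<nu> l (e_tilde \<nu> k ?one)"
  proof (cases "S \<nu>")
    case Nil
    then show ?thesis
      by (simp add: insert_letter_def e_tilde_single vect_linearD[OF vect_linear_f] fun_upd_idem)
  next
    case (Cons s xs)
    have "(\<Sum>p\<le>length (S \<nu>). e_tilde \<nu> k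
        (Poly_Mapping.single (insert_letter \<nu> p l S) (lowered_weight C wt \<nu> l (drop p (S \<nu>)))))
      = (if l = k then Poly_Mapping.single S (lowered_weight C wt \<nu> l (S \<nu>)) else 0) +
        (\<Sum>p\<le>length xs. if s = k then Poly_Mapping.single (insert_letter \<nu> p l (S(\<nu> := xs)))
           (lowered_weight C wt \<nu> l (drop p xs)) else 0)"
      unfolding Cons length_Cons sum.atMost_Suc_shift
      by (cases "s = k") (simp_all add: Cons insert_letter_def e_tilde_single fun_upd_idem)
    moreover have "f_tilde C wt \<nu> l (e_tilde \<nu> k ?one)
        = (\<Sum>p\<le>length xs. if s = k then Poly_Mapping.single (insert_letter \<nu> p l (S(\<nu> := xs)))
           (lowered_weight C wt \<nu> l (drop p xs)) else 0)"
      by (simp add: Cons e_tilde_single f_tilde_single vect_linearD[OF vect_linear_f])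
    ultimately show ?thesis by (simp add: Cons)
  qed
  finally show "e_tilde \<nu> k (f_tilde C wt \<nu> l ?one) - f_tilde C wt \<nu> l (e_tilde \<nu> k ?one)
    = (if k = l then h_tilde C wt \<nu> k ?one else 0)" by simp
qed

lemma e_f_different_slots:
  assumes "\<mu> \<noteq> \<nu>"
  shows "e_tilde \<mu> k (f_tilde C wt \<nu> l v) = f_tilde C wt \<nu> l (e_tilde \<mu> k v)"
proof (rule vect_linear_eqI[where v = v])
  show "vect_linear (\<lambda>v. e_tilde \<mu> k (f_tilde C wt \<nu> l v))"
    by (intro vect_linear_comp[OF vect_linear_e vect_linear_f])
  show "vect_linear (\<lambda>v. f_tilde C wt \<nu> l (e_tilde \<mu> k v))"
    by (intro vect_linear_comp[OF vect_linear_f vect_linear_e])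
next
  fix S :: "'a \<Rightarrow> 'b list"
  let ?one = "Poly_Mapping.single S 1 :: ('a, 'b) vect"
  have "e_tilde \<mu> k (f_tilde C wt \<nu> l ?one) = (\<Sum>p\<le>length (S \<nu>). e_tilde \<mu> k
      (Poly_Mapping.single (insert_letter \<nu> p l S) (lowered_weight C wt \<nu> l (drop p (S \<nu>)))))"
    by (simp add: f_tilde_single vect_linear_sum[OF vect_linear_e])
  also have "\<dots> = f_tilde C wt \<nu> l (e_tilde \<mu> k ?one)"
    using assms
    by (auto simp: e_tilde_single f_tilde_single insert_letter_def vect_linearD[OF vect_linear_f]
        fun_upd_twist split: list.split)
  finally show "e_tilde \<mu> k (f_tilde C wt \<nu> l ?one) = f_tilde C wt \<nu> l (e_tilde \<mu> k ?one)" .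
qed

lemma e_e_different_slots:
  assumes "\<mu> \<noteq> \<nu>"
  shows "e_tilde \<mu> k (e_tilde \<nu> l v) = e_tilde \<nu> l (e_tilde \<mu> k v)"
  using assms by (intro poly_mapping_eqI) (simp add: fun_upd_twist)

lemma h_e_same_slot:
  "h_tilde C wt \<nu> k (e_tilde \<nu> l v) - e_tilde \<nu> l (h_tilde C wt \<nu> k v)
    = scale_vect (of_int (C k l)) (e_tilde \<nu> l v)"
  by (intro poly_mapping_eqI) (simp add: algebra_simps)

lemma h_f:
  "h_tilde C wt \<mu> k (f_tilde C wt \<nu> l v) = f_tilde C wt \<nu> l (h_tilde C wt \<mu> k v)
    - (if \<mu> = \<nu> then scale_vect (of_int (C k l)) (f_tilde C wt \<nu> l v) else 0)"
proof (rule vect_linear_eqI[where v = v])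
  show "vect_linear (\<lambda>v. h_tilde C wt \<mu> k (f_tilde C wt \<nu> l v))"
    by (intro vect_linear_comp[OF vect_linear_h vect_linear_f])
  show "vect_linear (\<lambda>v. f_tilde C wt \<nu> l (h_tilde C wt \<mu> k v)
    - (if \<mu> = \<nu> then scale_vect (of_int (C k l)) (f_tilde C wt \<nu> l v) else 0))"
    by (rule vect_linear_diff[OF vect_linear_comp[OF vect_linear_f vect_linear_h]
          vect_linear_if[OF vect_linear_scale[OF vect_linear_f]]])
next
  fix S :: "'a \<Rightarrow> 'b list"
  let ?one = "Poly_Mapping.single S 1 :: ('a, 'b) vect"
  show "h_tilde C wt \<mu> k (f_tilde C wt \<nu> l ?one) = f_tilde C wt \<nu> l (h_tilde C wt \<mu> k ?one)
    - (if \<mu> = \<nu> then scale_vect (of_int (C k l)) (f_tilde C wt \<nu> l ?one) else 0)"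
  proof -
    let ?c = "\<lambda>p. lowered_weight C wt \<nu> l (drop p (S \<nu>))"
    let ?d = "if \<mu> = \<nu> then of_int (C k l) else 0 :: complex"
    have "h_tilde C wt \<mu> k (f_tilde C wt \<nu> l ?one) = (\<Sum>p\<le>length (S \<nu>).
        Poly_Mapping.single (insert_letter \<nu> p l S) ((lowered_weight C wt \<mu> k (S \<mu>) - ?d) * ?c p))"
      by (auto simp: f_tilde_single vect_linear_sum[OF vect_linear_h] insert_letter_def)
    also have "\<dots> = (\<Sum>p\<le>length (S \<nu>).
        Poly_Mapping.single (insert_letter \<nu> p l S) (lowered_weight C wt \<mu> k (S \<mu>) * ?c p)
        - Poly_Mapping.single (insert_letter \<nu> p l S) (?d * ?c p))"
      by (simp only: left_diff_distrib single_diff)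
    also have "\<dots> = f_tilde C wt \<nu> l (h_tilde C wt \<mu> k ?one)
      - (if \<mu> = \<nu> then scale_vect (of_int (C k l)) (f_tilde C wt \<nu> l ?one) else 0)"
      by (simp add: f_tilde_single sum_subtractf scale_vect_sum)
    finally show ?thesis .
  qed
qed


section \<open>Each slot is a module over the Lie algebra\<close>

text \<open>The action in a single slot.  The residues see the sequences of a tuple one at a time, so that the
  total action does not suffice.\<close>

primrec act_at ::
    "('r \<Rightarrow> 'r \<Rightarrow> int) \<Rightarrow> ('n \<Rightarrow> 'r \<Rightarrow> real) \<Rightarrow> 'n \<Rightarrow> 'r chevalley lie_term \<Rightarrow>
     ('n, 'r) vect \<Rightarrow> ('n, 'r) vect" where
  "act_at C wt \<nu> (Gen g) = (\<lambda>v. case g of E k \<Rightarrow> e_tilde \<nu> k v | F k \<Rightarrow> f_tilde C wt \<nu> k v)"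
| "act_at C wt \<nu> Zero = (\<lambda>v. 0)"
| "act_at C wt \<nu> (Plus x y) = (\<lambda>v. act_at C wt \<nu> x v + act_at C wt \<nu> y v)"
| "act_at C wt \<nu> (Scale a x) = (\<lambda>v. scale_vect a (act_at C wt \<nu> x v))"
| "act_at C wt \<nu> (Br x y) =
     (\<lambda>v. act_at C wt \<nu> x (act_at C wt \<nu> y v) - act_at C wt \<nu> y (act_at C wt \<nu> x v))"

lemma vect_linear_act_at: "vect_linear (act_at C wt \<nu> x)"
proof (induction x)
  case (Gen g)
  then show ?case by (cases g) (simp_all add: vect_linear_e vect_linear_f)
next
  case Zero
  then show ?case by (simp add: vect_linear_def)
next
  case (Plus x y)
  then show ?case by (simp add: vect_linear_add)
next
  case (Scale a x)
  then show ?case by (simp add: vect_linear_scale)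
next
  case (Br x y)
  from vect_linear_diff[OF vect_linear_comp[OF Br] vect_linear_comp[OF Br(2,1)]]
  show ?case by simp
qed

lemma act_at_coroot: "act_at C wt \<nu> (coroot k) v = h_tilde C wt \<nu> k v"
  using e_f_same_slot[of \<nu> k C wt k v] by (simp add: coroot_def)

text \<open>This is applied to the space of all vectors with the relations other than the Serre
  relations, and then to the module with all relations.\<close>

lemma act_at_lie_eq:
  assumes "lie_eq R x y" and "v \<in> W"
    and stable: "\<And>g v. v \<in> W \<Longrightarrow> act_at C wt \<nu> (Gen g) v \<in> W"
    and "0 \<in> W" and add: "\<And>v w. v \<in> W \<Longrightarrow> w \<in> W \<Longrightarrow> v + w \<in> W"
    and scale: "\<And>a v. v \<in> W \<Longrightarrow> scale_vect a v \<in> W"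
    and rel: "\<And>x y v. (x, y) \<in> R \<Longrightarrow> v \<in> W \<Longrightarrow> act_at C wt \<nu> x v = act_at C wt \<nu> y v"
  shows "act_at C wt \<nu> x v = act_at C wt \<nu> y v"
proof -
  have diff: "v - w \<in> W" if "v \<in> W" "w \<in> W" for v w
    using add[OF that(1) scale[OF that(2), of "- 1"]] by (simp add: scale_vect_distrib)
  have W: "act_at C wt \<nu> x v \<in> W" if "v \<in> W" for x v
    using that
  proof (induction x arbitrary: v)
    case (Gen g)
    show ?case by (rule stable[OF Gen])
  qed (simp_all add: \<open>0 \<in> W\<close> add scale diff)
  note lin = vect_linearD[OF vect_linear_act_at]
  have "\<forall>v\<in>W. act_at C wt \<nu> x v = act_at C wt \<nu> y v"
    using assms(1)
  proof induction
    case (rel x y)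
    then show ?case using assms(7) by blast
  qed (simp_all add: W lin scale_vect_distrib algebra_simps)
  with assms(2) show ?thesis by blast
qed

text \<open>The relations from which the commutation of the Serre elements with the opposite generators follows.
  They hold on all vectors, so that they are available before the Serre relations have been proved.\<close>

inductive_set weight_relations ::
    "('r \<Rightarrow> 'r \<Rightarrow> int) \<Rightarrow> ('r chevalley lie_term \<times> 'r chevalley lie_term) set"
  for C :: "'r \<Rightarrow> 'r \<Rightarrow> int" where
  "k \<noteq> l \<Longrightarrow> (Br (Gen (E k)) (Gen (F l)), Zero) \<in> weight_relations C"
| "(Br (coroot k) (Gen (E l)), Scale (of_int (C k l)) (Gen (E l))) \<in> weight_relations C"
| "(Br (coroot k) (Gen (F l)), Scale (- of_int (C k l)) (Gen (F l))) \<in> weight_relations C"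

lemma act_at_weight_relations:
  assumes "(x, y) \<in> weight_relations C"
  shows "act_at C wt \<nu> x v = act_at C wt \<nu> y v"
  using assms
proof cases
  case (1 k l)
  then show ?thesis using e_f_same_slot[of \<nu> k C wt l v] by simp
next
  case (2 k l)
  then show ?thesis using h_e_same_slot[of C wt \<nu> k l v] by (simp add: act_at_coroot)
next
  case (3 k l)
  then show ?thesis using h_f[of C wt \<nu> k \<nu> l v]
    by (simp add: act_at_coroot)
      (intro poly_mapping_eqI, simp)
qed

lemma act_at_weight_lie_eq:
  assumes "lie_eq (weight_relations C) x y"
  shows "act_at C wt \<nu> x v = act_at C wt \<nu> y v"
  using assms by (rule act_at_lie_eq[where W = UNIV]) (simp_all add: act_at_weight_relations)

abbreviation serre_term :: "('r \<Rightarrow> 'r \<Rightarrow> int) \<Rightarrow> ('r \<Rightarrow> 'g) \<Rightarrow> 'r \<Rightarrow> 'r \<Rightarrow> 'g lie_term" where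
  "serre_term C g k l \<equiv> (Br (Gen (g k)) ^^ nat (1 - C k l)) (Gen (g l))"

lemma serre_F_commutes:
  assumes "generalized_cartan_matrix C" "k \<noteq> l"
  shows "lie_eq (weight_relations C) (Br (Gen (E j)) (serre_term C F k l)) Zero"
  using assms
  by (rule serre_commutes[where f = "\<lambda>k. Gen (F k)" and e = "\<lambda>k. Gen (E k)" and h = coroot])
    (auto simp: coroot_def[symmetric] lie_eq.refl intro!: lie_eq.rel weight_relations.intros)

lemma serre_E_commutes:
  assumes "generalized_cartan_matrix C" "k \<noteq> l"
  shows "lie_eq (weight_relations C) (Br (Gen (F j)) (serre_term C E k l)) Zero"
  using assms
proof (rule serre_commutes[where f = "\<lambda>k. Gen (E k)" and e = "\<lambda>k. Gen (F k)"
      and h = "\<lambda>k. Scale (- 1) (coroot k)"])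
  fix j j' :: 'a
  let ?R = "weight_relations C"
  show "lie_eq ?R (Br (Gen (F j)) (Gen (E j))) (Scale (- 1) (coroot j))"
    unfolding coroot_def by (rule lie_eq_Br_swap)
  show "lie_eq ?R (Br (Gen (F j)) (Gen (E j'))) Zero" if "j \<noteq> j'"
  proof (rule lie_eq.trans[OF lie_eq_Br_swap lie_eq.trans[OF lie_eq.cong_Scale lie_eq_Scale_Zero]])
    show "lie_eq ?R (Br (Gen (E j')) (Gen (F j))) Zero"
      using that by (intro lie_eq.rel weight_relations.intros) simp
  qed
  have "lie_eq ?R (Br (Scale (- 1) (coroot j)) (Gen (E j')))
      (Scale (- 1) (Scale (of_int (C j j')) (Gen (E j'))))"
    by (rule lie_eq.trans[OF lie_eq.Br_Scale_left lie_eq.cong_Scale])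
      (intro lie_eq.rel weight_relations.intros)
  also have "lie_eq ?R \<dots> (Scale (- of_int (C j j')) (Gen (E j')))"
    by (rule lie_eq_by_coeff) simp
  finally show "lie_eq ?R (Br (Scale (- 1) (coroot j)) (Gen (E j')))
      (Scale (- of_int (C j j')) (Gen (E j')))" .
qed

lemma act_at_serre_commutes:
  assumes lin: "vect_linear T"
    and T: "\<And>k v. T (act_at C wt \<nu> (Gen (g k)) v) = act_at C wt \<nu> (Gen (g k)) (T v)"
  shows "T (act_at C wt \<nu> ((Br (Gen (g k)) ^^ m) (Gen (g l))) v)
    = act_at C wt \<nu> ((Br (Gen (g k)) ^^ m) (Gen (g l))) (T v)"
proof (induction m arbitrary: v)
  case 0
  show ?case using T by simp
next
  case (Suc m)
  show ?case
    by (simp only: funpow.simps o_apply act_at.simps(5) T[unfolded] Suc vect_linearD(4)[OF lin])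
qed

lemma f_tilde_Nil:
  assumes "S \<nu> = []"
  shows "Poly_Mapping.lookup (f_tilde C wt \<nu> k v) S = 0"
proof -
  have lin: "vect_linear (f_tilde C wt \<nu> k)" by (rule vect_linear_f)
  have "Poly_Mapping.lookup (f_tilde C wt \<nu> k (Poly_Mapping.single T 1)) S = 0" for T
    using assms by (auto simp: f_tilde_single lookup_sum lookup_single when_def insert_letter_def
        intro!: sum.neutral)
  then show ?thesis
    by (subst vect_expansion[of v]) (simp only: vect_linear_sum[OF lin] vect_linearD[OF lin]
        lookup_sum lookup_scale_vect, simp)
qed

text \<open>A vector all of whose images under the operators \<open>e_tilde\<close> vanish is constant.
  The Serre elements in the \<open>F k\<close> commute with these operators, so their image vanishes by
  induction on the length, up to a constant, which is zero as they raise the length.\<close>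

lemma serre_F_acts_by_zero:
  fixes v :: "('n::finite, 'r) vect"
  assumes C: "generalized_cartan_matrix C" and kl: "k \<noteq> l"
  shows "act_at C wt \<nu> (serre_term C F k l) v = 0"
proof (rule poly_mapping_eqI)
  fix S :: "'n \<Rightarrow> 'r list"
  let ?A = "act_at C wt \<nu> (serre_term C F k l)"
  have A: "e_tilde \<mu> j (?A v) = ?A (e_tilde \<mu> j v)" for \<mu> j v
  proof (cases "\<mu> = \<nu>")
    case True
    show ?thesis using act_at_weight_lie_eq[OF serre_F_commutes[OF C kl, of j], of wt \<nu> v]
      by (simp add: True)
  next
    case False
    then show ?thesis
      by (intro act_at_serre_commutes vect_linear_e) (simp add: e_f_different_slots)
  qed
  have Nil: "Poly_Mapping.lookup (act_at C wt \<nu> ((Br (Gen (F k)) ^^ m) (Gen (F l))) v) (\<lambda>_. []) = 0"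
    for m v
    by (induction m arbitrary: v) (simp_all add: f_tilde_Nil)
  have "Poly_Mapping.lookup (?A v) S = 0" for v
  proof (induction "\<Sum>\<mu>\<in>UNIV. length (S \<mu>)" arbitrary: v S rule: less_induct)
    case less
    show ?case
    proof (cases "\<forall>\<mu>. S \<mu> = []")
      case True
      then have "S = (\<lambda>_. [])" by auto
      then show ?thesis using Nil by simp
    next
      case False
      then obtain \<mu> s xs where S: "S \<mu> = s # xs" by (meson neq_Nil_conv)
      have "(\<Sum>\<kappa>\<in>UNIV. length ((S(\<mu> := xs)) \<kappa>)) < (\<Sum>\<kappa>\<in>UNIV. length (S \<kappa>))"
        by (rule sum_strict_mono_ex1) (auto simp: S)
      then have "Poly_Mapping.lookup (?A (e_tilde \<mu> s v)) (S(\<mu> := xs)) = 0" by (rule less)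
      then show ?thesis by (simp add: A[symmetric] fun_upd_idem S)
    qed
  qed
  then show "Poly_Mapping.lookup (?A v) S = Poly_Mapping.lookup 0 S" by simp
qed

text \<open>The vectors obtained from the constant by the operators \<open>f_tilde\<close> alone: they already
  exhaust the module, as the operators \<open>e_tilde\<close> can be moved to the constant, which they
  annihilate.\<close>

inductive_set f_span :: "('r \<Rightarrow> 'r \<Rightarrow> int) \<Rightarrow> ('n \<Rightarrow> 'r \<Rightarrow> real) \<Rightarrow> ('n, 'r) vect set"
  for C :: "'r \<Rightarrow> 'r \<Rightarrow> int" and wt :: "'n \<Rightarrow> 'r \<Rightarrow> real" where
  one: "Poly_Mapping.single (\<lambda>_. []) 1 \<in> f_span C wt"
| zero: "0 \<in> f_span C wt"
| add: "v \<in> f_span C wt \<Longrightarrow> w \<in> f_span C wt \<Longrightarrow> v + w \<in> f_span C wt"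
| scale: "v \<in> f_span C wt \<Longrightarrow> scale_vect a v \<in> f_span C wt"
| f: "v \<in> f_span C wt \<Longrightarrow> f_tilde C wt \<nu> k v \<in> f_span C wt"

lemma f_span_diff: "v \<in> f_span C wt \<Longrightarrow> w \<in> f_span C wt \<Longrightarrow> v - w \<in> f_span C wt"
  using f_span.add[OF _ f_span.scale[of w C wt "- 1"]] by (simp add: scale_vect_distrib)

lemma f_span_h: "v \<in> f_span C wt \<Longrightarrow> h_tilde C wt \<nu> k v \<in> f_span C wt"
proof (induction rule: f_span.induct)
  case one
  have "scale_vect (of_real (wt \<nu> k)) (Poly_Mapping.single (\<lambda>_. []) 1) \<in> f_span C wt"
    by (intro f_span.intros)
  then show ?case by simp
qed (auto simp: vect_linearD[OF vect_linear_h] h_f intro: f_span.intros f_span_diff)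

lemma f_span_e: "v \<in> f_span C wt \<Longrightarrow> e_tilde \<mu> j v \<in> f_span C wt"
proof (induction rule: f_span.induct)
  case (f v \<nu> k)
  show ?case
  proof (cases "\<mu> = \<nu>")
    case True
    have "e_tilde \<nu> j (f_tilde C wt \<nu> k v)
        = f_tilde C wt \<nu> k (e_tilde \<nu> j v) + (if j = k then h_tilde C wt \<nu> j v else 0)"
      using e_f_same_slot[of \<nu> j C wt k v] by (simp add: diff_eq_eq add.commute)
    also have "\<dots> \<in> f_span C wt"
      using f by (intro f_span.add f_span.f) (auto simp: True f_span_h f_span.zero)
    finally show ?thesis unfolding True .
  next
    case False
    then show ?thesis using f by (simp add: e_f_different_slots f_span.f)
  qed
qed (auto simp: vect_linearD[OF vect_linear_e] e_tilde_single intro: f_span.intros)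

lemma V_module_eq_f_span: "V_module C wt = f_span C wt"
proof
  show "V_module C wt \<subseteq> f_span C wt"
  proof
    fix v assume "v \<in> V_module C wt"
    then show "v \<in> f_span C wt" by induction (auto intro: f_span.intros f_span_e)
  qed
  show "f_span C wt \<subseteq> V_module C wt"
  proof
    fix v assume "v \<in> f_span C wt"
    then show "v \<in> V_module C wt" by induction (auto intro: V_module.intros)
  qed
qed

text \<open>The Serre elements in the \<open>E k\<close> annihilate the constant and commute with the operators
  \<open>f_tilde\<close>, by which the module is generated from it.\<close>

lemma serre_E_acts_by_zero:
  assumes C: "generalized_cartan_matrix C" and kl: "k \<noteq> l" and v: "v \<in> V_module C wt"
  shows "act_at C wt \<nu> (serre_term C E k l) v = 0"
proof -
  let ?A = "act_at C wt \<nu> (serre_term C E k l)"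
  have A: "f_tilde C wt \<mu> j (?A v) = ?A (f_tilde C wt \<mu> j v)" for \<mu> j v
  proof (cases "\<mu> = \<nu>")
    case True
    show ?thesis using act_at_weight_lie_eq[OF serre_E_commutes[OF C kl, of j], of wt \<nu> v]
      by (simp add: True)
  next
    case False
    then show ?thesis
      by (intro act_at_serre_commutes vect_linear_f) (simp add: e_f_different_slots)
  qed
  have one: "act_at C wt \<nu> ((Br (Gen (E k)) ^^ m) (Gen (E l))) (Poly_Mapping.single (\<lambda>_. []) 1) = 0"
    for m
    by (induction m) (simp_all add: e_tilde_single vect_linearD[OF vect_linear_e]
        vect_linearD[OF vect_linear_act_at])
  have "v \<in> f_span C wt" using v by (simp add: V_module_eq_f_span)
  then show ?thesis
    by induction (auto simp: one vect_linearD[OF vect_linear_act_at] A[symmetric]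
        vect_linearD[OF vect_linear_f])
qed

lemma act_at_respects_lie_eq:
  fixes v :: "('n::finite, 'r) vect"
  assumes C: "generalized_cartan_matrix C"
    and eq: "lie_eq (km_relations C) x y" and v: "v \<in> V_module C wt"
  shows "act_at C wt \<nu> x v = act_at C wt \<nu> y v"
  using eq v
proof (rule act_at_lie_eq)
  fix x y v assume "(x, y) \<in> km_relations C" and v: "v \<in> V_module C wt"
  then show "act_at C wt \<nu> x v = act_at C wt \<nu> y v"
  proof cases
    case (4 k l)
    then show ?thesis by (intro poly_mapping_eqI) (simp add: act_at_coroot)
  next
    case (5 k l)
    then show ?thesis using serre_E_acts_by_zero[OF C _ v] by simp
  next
    case (6 k l)
    then show ?thesis using serre_F_acts_by_zero[OF C] by simp
  next
    case (1 k l)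
    then show ?thesis by (intro act_at_weight_relations) (auto intro: weight_relations.intros)
  next
    case (2 k l)
    then show ?thesis by (intro act_at_weight_relations) (auto intro: weight_relations.intros)
  next
    case (3 k l)
    then show ?thesis by (intro act_at_weight_relations) (auto intro: weight_relations.intros)
  qed
next
  fix g v assume "v \<in> V_module C wt"
  then show "act_at C wt \<nu> (Gen g) v \<in> V_module C wt"
    by (cases g) (auto intro: V_module.intros)
qed (auto intro: V_module.intros)

text \<open>On the vector obtained from the constant by \<open>F k\<close> in a slot whose weight is positive on the
  coroot, \<open>E k\<close> does not vanish.  This serves for sequences of length one, whose iterated residue is
  the identity and carries no information.\<close>

lemma Gen_E_nonzero:
  assumes "generalized_cartan_matrix C"
  shows "\<not> lie_eq (km_relations C) (Gen (E k)) Zero"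
proof
  assume eq: "lie_eq (km_relations C) (Gen (E k)) Zero"
  define wt :: "unit \<Rightarrow> 'a \<Rightarrow> real" where "wt = (\<lambda>_ _. 1)"
  define one :: "(unit, 'a) vect" where "one = Poly_Mapping.single (\<lambda>_. []) 1"
  have "one \<in> V_module C wt" unfolding one_def by (rule V_module.one)
  then have "act_at C wt () (Gen (E k)) (f_tilde C wt () k one) = act_at C wt () Zero (f_tilde C wt () k one)"
    by (intro act_at_respects_lie_eq[OF assms eq] V_module.f)
  moreover have "e_tilde () k (f_tilde C wt () k one) = one"
    using e_f_same_slot[of "()" k C wt k one]
    by (simp add: one_def e_tilde_single vect_linearD[OF vect_linear_f] wt_def)
  ultimately have "one = 0" by simp
  then have "Poly_Mapping.lookup one (\<lambda>_. []) = 0" by simp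
  then show False by (simp add: one_def)
qed

section \<open>The root space of the highest root\<close>

definition height :: "('r::finite \<Rightarrow> int) \<Rightarrow> int" where
  "height \<beta> = (\<Sum>k\<in>UNIV. \<beta> k)"

lemma height_simps [simp]:
  "height (simple_root k) = 1"
  "height (\<lambda>l. - simple_root k l) = - 1"
  "height (\<lambda>l. \<beta> l + \<gamma> l) = height \<beta> + height \<gamma>"
  "height (\<lambda>l. \<beta> l - \<gamma> l) = height \<beta> - height \<gamma>"
  by (simp_all add: height_def simple_root_def sum.distrib sum_negf sum_subtractf)

text \<open>An automorphism for which the terms of a given height are eigenvectors; it serves to
  separate terms of different heights.\<close>

primrec dilate :: "'r chevalley lie_term \<Rightarrow> 'r chevalley lie_term" where
  "dilate (Gen g) = (case g of E k \<Rightarrow> Scale 2 (Gen g) | F k \<Rightarrow> Scale (1 / 2) (Gen g))"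
| "dilate Zero = Zero"
| "dilate (Plus x y) = Plus (dilate x) (dilate y)"
| "dilate (Scale a x) = Scale a (dilate x)"
| "dilate (Br x y) = Br (dilate x) (dilate y)"

lemma dilate_homogeneous:
  fixes \<beta> :: "'r::finite \<Rightarrow> int"
  assumes "homogeneous x \<beta>"
  shows "lie_eq R (dilate x) (Scale (2 powi height \<beta>) x)"
  using assms
proof induction
  case (homogeneous_E k)
  then show ?case by (simp add: lie_eq.refl)
next
  case (homogeneous_F k)
  then show ?case by (simp add: lie_eq.refl power_int_minus inverse_eq_divide)
next
  case (homogeneous_Zero \<beta>)
  then show ?case by (simp add: lie_eq_Scale_Zero lie_eq.sym)
next
  case (homogeneous_Plus x \<beta> y)
  have "lie_eq R (dilate (Plus x y)) (Plus (Scale (2 powi height \<beta>) x) (Scale (2 powi height \<beta>) y))"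
    using homogeneous_Plus.IH by (simp add: lie_eq.cong_Plus)
  then show ?case by (rule lie_eq.trans[OF _ lie_eq.sym[OF lie_eq.scale_Plus]])
next
  case (homogeneous_Scale x \<beta> a)
  have "lie_eq R (dilate (Scale a x)) (Scale a (Scale (2 powi height \<beta>) x))"
    using homogeneous_Scale.IH by (simp add: lie_eq.cong_Scale)
  also have "lie_eq R \<dots> (Scale (2 powi height \<beta>) (Scale a x))"
    by (rule lie_eq_by_coeff) simp
  finally show ?case .
next
  case (homogeneous_Br x \<beta> y \<gamma>)
  let ?a = "2 powi height \<beta> :: complex" and ?b = "2 powi height \<gamma> :: complex"
  have "lie_eq R (dilate (Br x y)) (Br (Scale ?a x) (Scale ?b y))"
    using homogeneous_Br.IH by (simp add: lie_eq.cong_Br)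
  also have "lie_eq R \<dots> (Scale ?a (Scale ?b (Br x y)))"
    by (rule lie_eq.trans[OF lie_eq.Br_Scale_left lie_eq.cong_Scale[OF lie_eq.Br_Scale_right]])
  also have "lie_eq R \<dots> (Scale (?a * ?b) (Br x y))"
    by (rule lie_eq.scale_scale)
  finally show ?case by (simp add: power_int_add)
qed

lemma homogeneous_ad:
  assumes "homogeneous x \<beta>" "homogeneous y \<gamma>"
  shows "\<exists>\<delta>. homogeneous ((Br x ^^ m) y) \<delta>"
proof (induction m)
  case 0
  then show ?case using assms(2) by auto
next
  case (Suc m)
  then show ?case using homogeneous_Br[OF assms(1)] by auto
qed

lemma homogeneous_coroot: "homogeneous (coroot k) (\<lambda>_. 0)"
  using homogeneous_Br[OF homogeneous_E[of k] homogeneous_F[of k]] by (simp add: coroot_def)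

lemma km_relations_homogeneous:
  assumes "(x, y) \<in> km_relations C"
  shows "\<exists>\<beta>. homogeneous x \<beta> \<and> homogeneous y \<beta>"
  using assms
proof cases
  case (1 k l)
  show ?thesis
    unfolding 1
    by (rule exI, rule conjI, rule homogeneous_Br[OF homogeneous_E homogeneous_F], rule homogeneous_Zero)
next
  case (2 k l)
  have "homogeneous (Br (coroot k) (Gen (E l))) (simple_root l)"
    using homogeneous_Br[OF homogeneous_coroot homogeneous_E] by simp
  then show ?thesis
    unfolding 2 by (intro exI[of _ "simple_root l"] conjI homogeneous_Scale homogeneous_E)
next
  case (3 k l)
  have "homogeneous (Br (coroot k) (Gen (F l))) (\<lambda>m. - simple_root l m)"
    using homogeneous_Br[OF homogeneous_coroot homogeneous_F] by simp
  then show ?thesis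
    unfolding 3 by (intro exI[of _ "\<lambda>m. - simple_root l m"] conjI homogeneous_Scale homogeneous_F)
next
  case (4 k l)
  show ?thesis
    unfolding 4
    by (rule exI, rule conjI, rule homogeneous_Br[OF homogeneous_coroot homogeneous_coroot],
        rule homogeneous_Zero)
next
  case (5 k l)
  from homogeneous_ad[OF homogeneous_E[of k] homogeneous_E[of l], of "nat (1 - C k l)"]
  obtain \<delta> where "homogeneous x \<delta>" unfolding 5 ..
  then show ?thesis
    unfolding 5(2) by (intro exI[of _ \<delta>] conjI homogeneous_Zero)
next
  case (6 k l)
  from homogeneous_ad[OF homogeneous_F[of k] homogeneous_F[of l], of "nat (1 - C k l)"]
  obtain \<delta> where "homogeneous x \<delta>" unfolding 6 ..
  then show ?thesis
    unfolding 6(2) by (intro exI[of _ \<delta>] conjI homogeneous_Zero)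
qed

lemma dilate_lie_eq:
  fixes C :: "'r::finite \<Rightarrow> 'r \<Rightarrow> int"
  assumes "lie_eq (km_relations C) x y"
  shows "lie_eq (km_relations C) (dilate x) (dilate y)"
  using assms
proof induction
  case (rel x y)
  then obtain \<beta> where \<beta>: "homogeneous x \<beta>" "homogeneous y \<beta>"
    using km_relations_homogeneous by blast
  have "lie_eq (km_relations C) (Scale (2 powi height \<beta>) x) (Scale (2 powi height \<beta>) y)"
    by (intro lie_eq.cong_Scale lie_eq.rel rel)
  then show ?case
    by (rule lie_eq.trans[OF dilate_homogeneous[OF \<beta>(1)] lie_eq.trans[OF _
          lie_eq.sym[OF dilate_homogeneous[OF \<beta>(2)]]]])
next
  case (sym x y)
  then show ?case by (simp add: lie_eq.sym)
next
  case (trans x y z)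
  show ?case by (rule lie_eq.trans[OF trans.IH])
qed (simp_all add: lie_eq.refl lie_eq.cong_Plus lie_eq.cong_Scale lie_eq.cong_Br lie_eq.add_assoc
    lie_eq.add_comm lie_eq.add_zero lie_eq.add_inverse lie_eq.scale_Plus lie_eq.scale_add
    lie_eq.scale_scale lie_eq.scale_one lie_eq.Br_Plus_left lie_eq.Br_Plus_right
    lie_eq.Br_Scale_left lie_eq.Br_Scale_right lie_eq.Br_self lie_eq.Jacobi)

inductive lower_sum :: "('r::finite \<Rightarrow> 'r \<Rightarrow> int) \<Rightarrow> int \<Rightarrow> 'r chevalley lie_term \<Rightarrow> bool"
  for C :: "'r \<Rightarrow> 'r \<Rightarrow> int" and d :: int where
  lower: "homogeneous x \<beta> \<Longrightarrow> height \<beta> < d \<Longrightarrow> lower_sum C d x"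
| Plus: "lower_sum C d x \<Longrightarrow> lower_sum C d y \<Longrightarrow> lower_sum C d (Plus x y)"
| Scale: "lower_sum C d x \<Longrightarrow> lower_sum C d (Scale a x)"
| eq: "lower_sum C d x \<Longrightarrow> lie_eq (km_relations C) x y \<Longrightarrow> lower_sum C d y"

lemma lower_sum_Zero: "lower_sum C d Zero"
proof (rule lower_sum.lower)
  \<comment> \<open>Zero is homogeneous of every degree; this one has height \<open>d - 1\<close>.\<close>
  show "homogeneous Zero (\<lambda>k. if k = undefined then d - 1 else 0)"
    by (rule homogeneous_Zero)
  show "height (\<lambda>k. if k = undefined then d - 1 else 0) < d"
    by (simp add: height_def)
qed

lemma lower_sum_Br_F: "lower_sum C d x \<Longrightarrow> lower_sum C d (Br (Gen (F k)) x)"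
proof (induction rule: lower_sum.induct)
  case (lower x \<beta>)
  have "homogeneous (Br (Gen (F k)) x) (\<lambda>l. - simple_root k l + \<beta> l)"
    by (intro homogeneous_Br homogeneous_F lower)
  then show ?case by (rule lower_sum.lower) (use lower in simp)
next
  case (Plus x y)
  then have "lower_sum C d (Plus (Br (Gen (F k)) x) (Br (Gen (F k)) y))"
    by (intro lower_sum.Plus)
  then show ?case by (rule lower_sum.eq[OF _ lie_eq.sym[OF lie_eq.Br_Plus_right]])
next
  case (Scale x a)
  then have "lower_sum C d (Scale a (Br (Gen (F k)) x))"
    by (intro lower_sum.Scale)
  then show ?case by (rule lower_sum.eq[OF _ lie_eq.sym[OF lie_eq.Br_Scale_right]])
next
  case (eq x y)
  show ?case by (rule lower_sum.eq[OF eq.IH lie_eq.cong_Br[OF lie_eq.refl eq.hyps(2)]])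
qed

text \<open>The factor of an annihilating polynomial of \<open>dilate\<close> that vanishes on the terms of height
  \<open>d\<close>; on those of another height it is a nonzero scalar.\<close>

definition shift_dilate :: "int \<Rightarrow> 'r chevalley lie_term \<Rightarrow> 'r chevalley lie_term" where
  "shift_dilate d x = Plus (dilate x) (Scale (- (2 powi d)) x)"

context
  fixes C :: "'r::finite \<Rightarrow> 'r \<Rightarrow> int"
begin

private abbreviation eqv (infix "\<doteq>" 50) where "x \<doteq> y \<equiv> lie_eq (km_relations C) x y"

lemma shift_dilate_cong: "x \<doteq> y \<Longrightarrow> shift_dilate d x \<doteq> shift_dilate d y"
  unfolding shift_dilate_def by (intro lie_eq.cong_Plus lie_eq.cong_Scale dilate_lie_eq)

lemma shift_dilates_cong: "x \<doteq> y \<Longrightarrow> foldr shift_dilate ds x \<doteq> foldr shift_dilate ds y"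
  by (induction ds) (simp_all add: shift_dilate_cong)

lemma shift_dilates_linear:
  "foldr shift_dilate ds (Plus (Scale a x) (Scale b y))
    \<doteq> Plus (Scale a (foldr shift_dilate ds x)) (Scale b (foldr shift_dilate ds y))"
proof (induction ds)
  case Nil
  then show ?case by (simp add: lie_eq.refl)
next
  case (Cons d ds)
  have "foldr shift_dilate (d # ds) (Plus (Scale a x) (Scale b y))
    \<doteq> shift_dilate d (Plus (Scale a (foldr shift_dilate ds x)) (Scale b (foldr shift_dilate ds y)))"
    using shift_dilate_cong[OF Cons] by simp
  also have "\<dots> \<doteq> Plus (Scale a (foldr shift_dilate (d # ds) x)) (Scale b (foldr shift_dilate (d # ds) y))"
    by (rule lie_eq_by_coeff) (simp add: shift_dilate_def algebra_simps)
  finally show ?case .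
qed

lemma shift_dilate_swap:
  "foldr shift_dilate ds (shift_dilate d x) \<doteq> shift_dilate d (foldr shift_dilate ds x)"
proof (induction ds)
  case Nil
  then show ?case by (simp add: lie_eq.refl)
next
  case (Cons c ds)
  have "foldr shift_dilate (c # ds) (shift_dilate d x)
      \<doteq> shift_dilate c (shift_dilate d (foldr shift_dilate ds x))"
    using shift_dilate_cong[OF Cons] by simp
  also have "\<dots> \<doteq> shift_dilate d (foldr shift_dilate (c # ds) x)"
    by (rule lie_eq_by_coeff) (simp add: shift_dilate_def algebra_simps)
  finally show ?case .
qed

lemma shift_dilates_swap:
  "foldr shift_dilate ds (foldr shift_dilate cs x) \<doteq> foldr shift_dilate cs (foldr shift_dilate ds x)"
proof (induction cs)
  case Nil
  then show ?case by (simp add: lie_eq.refl)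
next
  case (Cons c cs)
  show ?case
    using lie_eq.trans[OF shift_dilate_swap shift_dilate_cong[OF Cons]] by simp
qed

lemma shift_dilates_Zero: "x \<doteq> Zero \<Longrightarrow> foldr shift_dilate ds x \<doteq> Zero"
proof (induction ds)
  case (Cons d ds)
  then have "shift_dilate d (foldr shift_dilate ds x) \<doteq> shift_dilate d Zero"
    by (intro shift_dilate_cong) simp
  also have "\<dots> \<doteq> Zero" by (rule lie_eq_by_coeff) (simp add: shift_dilate_def)
  finally show ?case by simp
qed simp

lemma shift_dilates_homogeneous:
  assumes "homogeneous x \<beta>"
  shows "foldr shift_dilate ds x \<doteq> Scale (\<Prod>d\<leftarrow>ds. 2 powi height \<beta> - 2 powi d) x"
proof (induction ds)
  case Nil
  then show ?case by (simp add: lie_eq.sym[OF lie_eq.scale_one])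
next
  case (Cons d ds)
  let ?q = "\<Prod>d\<leftarrow>ds. 2 powi height \<beta> - 2 powi d :: complex"
  have "foldr shift_dilate (d # ds) x \<doteq> shift_dilate d (Scale ?q x)"
    using shift_dilate_cong[OF Cons] by simp
  also have "\<dots> \<doteq> Plus (Scale (2 powi height \<beta>) (Scale ?q x)) (Scale (- (2 powi d)) (Scale ?q x))"
    unfolding shift_dilate_def
    by (rule lie_eq.cong_Plus[OF dilate_homogeneous[OF homogeneous_Scale[OF assms]] lie_eq.refl])
  also have "\<dots> \<doteq> Scale (\<Prod>d\<leftarrow>d # ds. 2 powi height \<beta> - 2 powi d) x"
    by (rule lie_eq_by_coeff) (simp add: algebra_simps)
  finally show ?case .
qed

text \<open>There is one factor for every height that occurs; as the factors commute, those for two summands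
  can be combined.\<close>

lemma lower_sum_annihilated:
  assumes "lower_sum C d x"
  shows "\<exists>ds. (\<forall>c\<in>set ds. c < d) \<and> foldr shift_dilate ds x \<doteq> Zero"
  using assms
proof induction
  case (lower x \<beta>)
  have "foldr shift_dilate [height \<beta>] x \<doteq> Scale 0 x"
    using shift_dilates_homogeneous[OF lower(1), of "[height \<beta>]"] by simp
  then have "foldr shift_dilate [height \<beta>] x \<doteq> Zero"
    by (rule lie_eq.trans[OF _ lie_eq_Scale_0])
  then show ?case using lower(2) by (intro exI[of _ "[height \<beta>]"]) simp
next
  case (Plus x y)
  then obtain cs ds where
    cs: "\<forall>c\<in>set cs. c < d" "foldr shift_dilate cs x \<doteq> Zero" and
    ds: "\<forall>c\<in>set ds. c < d" "foldr shift_dilate ds y \<doteq> Zero" by blast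
  have x: "foldr shift_dilate (cs @ ds) x \<doteq> Zero"
    using lie_eq.trans[OF shift_dilates_swap shift_dilates_Zero[OF cs(2)]] by simp
  have y: "foldr shift_dilate (cs @ ds) y \<doteq> Zero"
    using shift_dilates_Zero[OF ds(2)] by simp
  have "Plus x y \<doteq> Plus (Scale 1 x) (Scale 1 y)"
    by (rule lie_eq_by_coeff) simp
  then have "foldr shift_dilate (cs @ ds) (Plus x y)
      \<doteq> foldr shift_dilate (cs @ ds) (Plus (Scale 1 x) (Scale 1 y))"
    by (rule shift_dilates_cong)
  also have "\<dots> \<doteq> Plus (Scale 1 (foldr shift_dilate (cs @ ds) x)) (Scale 1 (foldr shift_dilate (cs @ ds) y))"
    by (rule shift_dilates_linear)
  also have "\<dots> \<doteq> Zero"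
    by (intro lie_eq_Plus_Zero_Zero lie_eq.trans[OF lie_eq.scale_one x] lie_eq.trans[OF lie_eq.scale_one y])
  finally show ?case using cs(1) ds(1) by (intro exI[of _ "cs @ ds"]) auto
next
  case (Scale x a)
  then obtain ds where ds: "\<forall>c\<in>set ds. c < d" "foldr shift_dilate ds x \<doteq> Zero" by blast
  have "Scale a x \<doteq> Plus (Scale a x) (Scale 0 x)"
    by (rule lie_eq_by_coeff) simp
  then have "foldr shift_dilate ds (Scale a x) \<doteq> foldr shift_dilate ds (Plus (Scale a x) (Scale 0 x))"
    by (rule shift_dilates_cong)
  also have "\<dots> \<doteq> Plus (Scale a (foldr shift_dilate ds x)) (Scale 0 (foldr shift_dilate ds x))"
    by (rule shift_dilates_linear)
  also have "\<dots> \<doteq> Zero"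
    by (intro lie_eq_Plus_Zero_Zero lie_eq_Scale_0 lie_eq.trans[OF lie_eq.cong_Scale[OF ds(2)]
          lie_eq_Scale_Zero])
  finally show ?case using ds(1) by blast
next
  case (eq x y)
  then obtain ds where ds: "\<forall>c\<in>set ds. c < d" "foldr shift_dilate ds x \<doteq> Zero" by blast
  have "foldr shift_dilate ds y \<doteq> Zero"
    by (rule lie_eq.trans[OF shift_dilates_cong[OF lie_eq.sym[OF eq.hyps(2)]] ds(2)])
  then show ?case using ds(1) by blast
qed

text \<open>Eigenvectors for different eigenvalues are independent: a product of factors that annihilates
  the lower terms multiplies \<open>x\<close> by a nonzero scalar.\<close>

lemma lower_sum_homogeneous_Zero:
  assumes "lower_sum C (height \<beta>) x" "homogeneous x \<beta>"
  shows "x \<doteq> Zero"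
proof -
  obtain ds where ds: "\<forall>c\<in>set ds. c < height \<beta>" "foldr shift_dilate ds x \<doteq> Zero"
    using lower_sum_annihilated[OF assms(1)] by blast
  let ?q = "\<Prod>d\<leftarrow>ds. 2 powi height \<beta> - 2 powi d :: complex"
  have "?q \<noteq> 0"
  proof
    assume "?q = 0"
    then obtain d where d: "d \<in> set ds" "2 powi height \<beta> = (2 powi d :: complex)"
      by (auto simp: prod_list_zero_iff)
    from d(2) have "of_real (2 powi height \<beta>) = (of_real (2 powi d) :: complex)" by simp
    then have "2 powi height \<beta> = (2 powi d :: real)" by (simp only: of_real_eq_iff)
    moreover have "d < height \<beta>" using ds d(1) by blast
    then have "2 powi d < (2 powi height \<beta> :: real)" by (intro power_int_strict_increasing) auto
    ultimately show False by simp
  qed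
  have "x \<doteq> Scale (1 / ?q) (Scale ?q x)"
    by (rule lie_eq_by_coeff) (use \<open>?q \<noteq> 0\<close> in simp)
  also have "\<dots> \<doteq> Scale (1 / ?q) Zero"
    by (rule lie_eq.cong_Scale[OF lie_eq.trans[OF lie_eq.sym[OF shift_dilates_homogeneous] ds(2)]])
      (rule assms)
  also have "\<dots> \<doteq> Zero" by (rule lie_eq_Scale_Zero)
  finally show ?thesis .
qed

inductive_set lowered :: "'r chevalley lie_term \<Rightarrow> 'r chevalley lie_term set"
  for x :: "'r chevalley lie_term" where
  start: "x \<in> lowered x"
| Zero: "Zero \<in> lowered x"
| Plus: "y \<in> lowered x \<Longrightarrow> z \<in> lowered x \<Longrightarrow> Plus y z \<in> lowered x"
| Scale: "y \<in> lowered x \<Longrightarrow> Scale a y \<in> lowered x"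
| eq: "y \<in> lowered x \<Longrightarrow> y \<doteq> z \<Longrightarrow> z \<in> lowered x"
| F: "y \<in> lowered x \<Longrightarrow> Br (Gen (F k)) y \<in> lowered x"

lemma lowered_eq: "y \<in> lowered x \<Longrightarrow> z \<doteq> y \<Longrightarrow> z \<in> lowered x"
  by (rule lowered.eq[OF _ lie_eq.sym])

text \<open>By the Jacobi identity the operators \<open>ad (E j)\<close> and \<open>ad (coroot k)\<close> can be moved past the
  \<open>ad (F k)\<close> until they reach \<open>x\<close>, on which they are scalars; the remaining elements are
  brackets of generators.\<close>

lemma lowered_Br:
  assumes hom: "homogeneous x \<beta>" and top: "\<And>j. Br (Gen (E j)) x \<doteq> Zero"
    and y: "y \<in> lowered x"
  shows "Br u y \<in> lowered x"
proof -
  have linear: "Br v (Plus y z) \<in> lowered x" "Br v (Scale a y) \<in> lowered x"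
    if "Br v y \<in> lowered x" "Br v z \<in> lowered x" for v a y z
    using that lowered_eq[OF lowered.Plus lie_eq.Br_Plus_right]
      lowered_eq[OF lowered.Scale lie_eq.Br_Scale_right] by blast+
  have eq: "Br v z \<in> lowered x" if "Br v y \<in> lowered x" "y \<doteq> z" for v y z
    by (rule lowered.eq[OF that(1) lie_eq.cong_Br[OF lie_eq.refl that(2)]])
  have Jac: "Br v (Br (Gen (F k)) y) \<in> lowered x"
    if "Br (Br v (Gen (F k))) y \<in> lowered x" "Br v y \<in> lowered x" for v k y
    by (rule lowered_eq[OF lowered.Plus[OF that(1) lowered.F[OF that(2)]] lie_eq.Jacobi])
  have H: "Br (coroot k) y \<in> lowered x" if "y \<in> lowered x" for k y
    using that
  proof induction
    case start
    show ?case
      by (rule lowered_eq[OF lowered.Scale[OF lowered.start] homogeneous_weight[OF hom]])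
  next
    case Zero
    show ?case by (rule lowered_eq[OF lowered.Zero lie_eq_Br_Zero])
  next
    case (F y l)
    have "Br (coroot k) (Gen (F l)) \<doteq> Scale (- of_int (C k l)) (Gen (F l))"
      by (intro lie_eq.rel km_relations.intros)
    then have "Br (Br (coroot k) (Gen (F l))) y \<doteq> Scale (- of_int (C k l)) (Br (Gen (F l)) y)"
      by (rule lie_eq_Br_left_scale)
    then have "Br (Br (coroot k) (Gen (F l))) y \<in> lowered x"
      by (rule lowered_eq[OF lowered.Scale[OF lowered.F[OF F(1)]]])
    then show ?case using F by (intro Jac)
  qed (auto intro: linear eq)
  have E: "Br (Gen (E j)) y \<in> lowered x" if "y \<in> lowered x" for j y
    using that
  proof induction
    case start
    show ?case by (rule lowered_eq[OF lowered.Zero top])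
  next
    case Zero
    show ?case by (rule lowered_eq[OF lowered.Zero lie_eq_Br_Zero])
  next
    case (F y k)
    have "Br (Br (Gen (E j)) (Gen (F k))) y \<in> lowered x"
    proof (cases "j = k")
      case True
      then show ?thesis using H[OF F(1), of k] by (simp add: coroot_def)
    next
      case False
      then have "Br (Br (Gen (E j)) (Gen (F k))) y \<doteq> Zero"
        by (intro lie_eq_Br_left_Zero lie_eq.rel km_relations.intros)
      then show ?thesis by (rule lowered_eq[OF lowered.Zero])
    qed
    then show ?case using F by (intro Jac)
  qed (auto intro: linear eq)
  show ?thesis
    using y
  proof (induction u arbitrary: y)
    case (Gen g)
    then show ?case by (cases g) (auto intro: E lowered.F)
  next
    case Zero
    have "Br Zero y \<doteq> Zero" by (rule lie_eq_Br_left_Zero[OF lie_eq.refl])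
    then show ?case by (rule lowered_eq[OF lowered.Zero])
  next
    case (Plus u v)
    show ?case
      by (rule lowered_eq[OF lowered.Plus[OF Plus.IH[OF Plus.prems]] lie_eq.Br_Plus_left])
  next
    case (Scale a u)
    show ?case
      by (rule lowered_eq[OF lowered.Scale[OF Scale.IH[OF Scale.prems]] lie_eq.Br_Scale_left])
  next
    case (Br u v)
    have "Plus (Br u (Br v y)) (Scale (- 1) (Br v (Br u y))) \<in> lowered x"
      by (intro lowered.Plus[OF Br.IH(1)[OF Br.IH(2)[OF Br.prems]]]
          lowered.Scale[OF Br.IH(2)[OF Br.IH(1)[OF Br.prems]]])
    moreover have "Plus (Br u (Br v y)) (Scale (- 1) (Br v (Br u y))) \<doteq> Br (Br u v) y"
    proof -
      have "Plus (Br u (Br v y)) (Scale (- 1) (Br v (Br u y)))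
        \<doteq> Plus (Plus (Br (Br u v) y) (Br v (Br u y))) (Scale (- 1) (Br v (Br u y)))"
        by (intro lie_eq.cong_Plus lie_eq.Jacobi lie_eq.refl)
      also have "\<dots> \<doteq> Br (Br u v) y" by (rule lie_eq_by_coeff) simp
      finally show ?thesis .
    qed
    ultimately show ?case by (rule lowered.eq)
  qed
qed

lemma lowered_decomposition:
  assumes hom: "homogeneous x \<beta>" and y: "y \<in> lowered x"
  shows "\<exists>a u. lower_sum C (height \<beta>) u \<and> y \<doteq> Plus (Scale a x) u"
  using y
proof induction
  case start
  have "x \<doteq> Plus (Scale 1 x) Zero" by (rule lie_eq_by_coeff) simp
  then show ?case using lower_sum_Zero by blast
next
  case Zero
  have "Zero \<doteq> Plus (Scale 0 x) Zero" by (rule lie_eq_by_coeff) simp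
  then show ?case using lower_sum_Zero by blast
next
  case (Plus y z)
  then obtain a u b v where
    u: "lower_sum C (height \<beta>) u" "y \<doteq> Plus (Scale a x) u" and
    v: "lower_sum C (height \<beta>) v" "z \<doteq> Plus (Scale b x) v" by blast
  have "Plus y z \<doteq> Plus (Plus (Scale a x) u) (Plus (Scale b x) v)"
    by (intro lie_eq.cong_Plus u v)
  also have "\<dots> \<doteq> Plus (Scale (a + b) x) (Plus u v)"
    by (rule lie_eq_by_coeff) (simp add: algebra_simps)
  finally show ?case using lower_sum.Plus[OF u(1) v(1)] by blast
next
  case (Scale y b)
  then obtain a u where u: "lower_sum C (height \<beta>) u" "y \<doteq> Plus (Scale a x) u" by blast
  have "Scale b y \<doteq> Scale b (Plus (Scale a x) u)"
    by (intro lie_eq.cong_Scale u)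
  also have "\<dots> \<doteq> Plus (Scale (b * a) x) (Scale b u)"
    by (rule lie_eq_by_coeff) (simp add: algebra_simps)
  finally show ?case using lower_sum.Scale[OF u(1)] by blast
next
  case (eq y z)
  then show ?case using lie_eq.trans[OF lie_eq.sym[OF eq.hyps(2)]] by blast
next
  case (F y k)
  then obtain a u where u: "lower_sum C (height \<beta>) u" "y \<doteq> Plus (Scale a x) u" by blast
  let ?f = "Gen (F k)"
  have "Br ?f y \<doteq> Plus (Br ?f (Scale a x)) (Br ?f u)"
    by (rule lie_eq.trans[OF lie_eq.cong_Br[OF lie_eq.refl u(2)] lie_eq.Br_Plus_right])
  also have "\<dots> \<doteq> Plus (Scale 0 x) (Plus (Br ?f (Scale a x)) (Br ?f u))"
    by (rule lie_eq_by_coeff) simp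
  finally have *: "Br ?f y \<doteq> Plus (Scale 0 x) (Plus (Br ?f (Scale a x)) (Br ?f u))" .
  have "homogeneous (Br ?f (Scale a x)) (\<lambda>l. - simple_root k l + \<beta> l)"
    by (intro homogeneous_Br homogeneous_F homogeneous_Scale hom)
  then have "lower_sum C (height \<beta>) (Br ?f (Scale a x))"
    by (rule lower_sum.lower) simp
  then have "lower_sum C (height \<beta>) (Plus (Br ?f (Scale a x)) (Br ?f u))"
    by (rule lower_sum.Plus[OF _ lower_sum_Br_F[OF u(1)]])
  with * show ?case by blast
qed

text \<open>If a homogeneous element is annihilated by all \<open>E j\<close>, then its images under
  products of the \<open>ad (F k)\<close> span an ideal, in which it spans the part of maximal height.  In a
  simple Lie algebra the ideal is everything.\<close>

lemma simple_highest_generates: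
  assumes simple: "lie_simple (km_relations C)"
    and hom: "homogeneous x \<beta>" and x: "\<not> x \<doteq> Zero"
    and top: "\<And>j. Br (Gen (E j)) x \<doteq> Zero"
  shows "generates_root_space C \<beta> x"
proof -
  have "lie_ideal (km_relations C) (lowered x)"
    unfolding lie_ideal_def using lowered_Br[OF hom top] by (blast intro: lowered.intros)
  moreover have "lowered x \<noteq> {y. y \<doteq> Zero}" using x lowered.start by blast
  ultimately have UNIV: "lowered x = UNIV" using simple unfolding lie_simple_def by blast
  have "\<exists>a. y \<doteq> Scale a x" if y: "y \<in> root_space C \<beta>" for y
  proof -
    obtain z where z: "homogeneous z \<beta>" "y \<doteq> z"
      using y by (auto simp: root_space_def)
    obtain a u where u: "lower_sum C (height \<beta>) u" "z \<doteq> Plus (Scale a x) u"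
      using lowered_decomposition[OF hom] UNIV by blast
    let ?w = "Plus z (Scale (- a) x)"
    have "?w \<doteq> Plus (Plus (Scale a x) u) (Scale (- a) x)"
      by (intro lie_eq.cong_Plus u lie_eq.refl)
    also have "\<dots> \<doteq> u" by (rule lie_eq_by_coeff) simp
    finally have "lower_sum C (height \<beta>) ?w" by (rule lower_sum.eq[OF u(1) lie_eq.sym])
    then have "?w \<doteq> Zero"
      by (rule lower_sum_homogeneous_Zero) (intro homogeneous_Plus homogeneous_Scale z hom)
    then have "z \<doteq> Scale a x" by (simp only: lie_eq_Plus_Scale_minus_iff)
    then show ?thesis using lie_eq.trans[OF z(2)] by blast
  qed
  moreover have "x \<in> root_space C \<beta>"
    using hom lie_eq.refl unfolding root_space_def by blast
  ultimately show ?thesis using x unfolding generates_root_space_def by blast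
qed

end

section \<open>Residues of sums over tuples of sequences\<close>

definition nonrepeating :: "('n \<Rightarrow> 'i list) \<Rightarrow> bool" where
  "nonrepeating D \<longleftrightarrow> (\<forall>\<nu>. distinct (D \<nu>)) \<and> disjoint_family (\<lambda>\<nu>. set (D \<nu>))"

definition tuples :: "'i set \<Rightarrow> ('n \<Rightarrow> 'i list) set" where
  "tuples X = {D. nonrepeating D \<and> (\<Union>\<nu>. set (D \<nu>)) = X}"

definition zeta_prod :: "('n::finite \<Rightarrow> complex) \<Rightarrow> ('n \<Rightarrow> 'i list) \<Rightarrow> ('i \<Rightarrow> complex) \<Rightarrow> complex" where
  "zeta_prod z D t = (\<Prod>\<nu>\<in>UNIV. zeta_coeff (D \<nu>) (z \<nu>) t)"

text \<open>The polydifferentials of the module and their iterated residues are of this form at generic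
  points; taking a residue becomes an operation on the coefficients \<open>\<Phi>\<close>.\<close>

definition pd_of ::
    "('n::finite \<Rightarrow> complex) \<Rightarrow> (('n \<Rightarrow> 'i list) \<Rightarrow> complex) \<Rightarrow> 'i polydifferential" where
  "pd_of z \<Phi> X t = (\<Sum>D\<in>tuples X. \<Phi> D * zeta_prod z D t)"

lemma tuples_subset: "D \<in> tuples X \<Longrightarrow> set (D \<nu>) \<subseteq> X"
  by (auto simp: tuples_def)

lemma finite_tuples:
  assumes "finite X"
  shows "finite (tuples X :: ('n::finite \<Rightarrow> 'i list) set)"
proof (rule finite_subset)
  show "tuples X \<subseteq> PiE (UNIV :: 'n set) (\<lambda>_. {xs. set xs \<subseteq> X \<and> distinct xs})"
    by (auto simp: tuples_def nonrepeating_def)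
  show "finite (PiE (UNIV :: 'n set) (\<lambda>_. {xs. set xs \<subseteq> X \<and> distinct xs}))"
    by (intro finite_PiE finite_subset_distinct assms) simp
qed

lemma zeta_sum_eq:
  assumes "finite X"
  shows "zeta_sum \<pi> z S X t = (\<Sum>D\<in>{D\<in>tuples X. (\<lambda>\<nu>. map \<pi> (D \<nu>)) = S}. zeta_prod z D t)"
  unfolding zeta_sum_def
proof (rule sum.mono_neutral_cong_right)
  have "{II. \<forall>\<nu>. map \<pi> (II \<nu>) = S \<nu> \<and> set (II \<nu>) \<subseteq> X}
      \<subseteq> PiE UNIV (\<lambda>\<nu>. {xs. set xs \<subseteq> X \<and> length xs = length (S \<nu>)})"
    by (auto dest: map_eq_imp_length_eq) (metis length_map)
  then show "finite {II. \<forall>\<nu>. map \<pi> (II \<nu>) = S \<nu> \<and> set (II \<nu>) \<subseteq> X}"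
    by (rule finite_subset) (intro finite_PiE finite_lists_length_eq assms finite)
qed (auto simp: tuples_def nonrepeating_def zeta_tuple_def zeta_prod_def)

lemma polydiff_eq_pd_of:
  fixes v :: "('n::finite, 'r) vect" and X :: "'i set"
  assumes "finite X"
  shows "polydiff \<pi> z v X t
    = pd_of z (\<lambda>D. Poly_Mapping.lookup v (\<lambda>\<nu>. map \<pi> (D \<nu>))) X t"
proof -
  let ?m = "\<lambda>D \<nu>. map \<pi> (D \<nu>)"
  have fin: "finite (tuples X :: ('n \<Rightarrow> 'i list) set)" by (rule finite_tuples[OF assms])
  have "polydiff \<pi> z v X t = (\<Sum>S\<in>Poly_Mapping.keys v. \<Sum>D\<in>tuples X.
      if ?m D = S then Poly_Mapping.lookup v S * zeta_prod z D t else 0)"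
    unfolding polydiff_def
  proof (intro sum.cong HOL.refl)
    fix S
    have "(\<Sum>D\<in>{D\<in>tuples X. ?m D = S}. zeta_prod z D t)
        = (\<Sum>D\<in>tuples X. if ?m D = S then zeta_prod z D t else 0)"
      by (rule sum.inter_filter[OF fin])
    then show "Poly_Mapping.lookup v S * zeta_sum \<pi> z S X t = (\<Sum>D\<in>tuples X.
        if ?m D = S then Poly_Mapping.lookup v S * zeta_prod z D t else 0)"
      by (simp add: zeta_sum_eq[OF assms] sum_distrib_left if_distrib[of "\<lambda>x. _ * x"] cong: if_cong)
  qed
  also have "\<dots> = (\<Sum>D\<in>tuples X. \<Sum>S\<in>Poly_Mapping.keys v.
      if ?m D = S then Poly_Mapping.lookup v S * zeta_prod z D t else 0)"
    by (rule sum.swap)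
  also have "\<dots> = pd_of z (\<lambda>D. Poly_Mapping.lookup v (?m D)) X t"
    unfolding pd_of_def by (intro sum.cong HOL.refl) (simp add: sum.delta' in_keys_iff)
  finally show ?thesis .
qed

lemma insert_letter_split:
  obtains xs ys where "D \<nu> = xs @ ys" "insert_letter \<nu> p i D = D(\<nu> := xs @ i # ys)"
  using that[of "take p (D \<nu>)" "drop p (D \<nu>)"] by (simp add: insert_letter_def)

lemma set_insert_letter:
  "set (insert_letter \<nu> p i D \<mu>) = (if \<mu> = \<nu> then insert i (set (D \<mu>)) else set (D \<mu>))"
  by (rule insert_letter_split[of D \<nu> p i]) auto

lemma nonrepeating_insert_letter:
  assumes "nonrepeating D" "\<And>\<mu>. i \<notin> set (D \<mu>)"
  shows "nonrepeating (insert_letter \<nu> p i D)"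
proof -
  obtain xs ys where *: "D \<nu> = xs @ ys" "insert_letter \<nu> p i D = D(\<nu> := xs @ i # ys)"
    by (rule insert_letter_split)
  have "distinct (xs @ i # ys)"
  proof -
    have "distinct (xs @ ys)" "i \<notin> set (xs @ ys)"
      using assms(1) assms(2)[of \<nu>] *(1) unfolding nonrepeating_def by metis+
    then show ?thesis by simp
  qed
  then have "distinct (insert_letter \<nu> p i D \<mu>)" for \<mu>
    using assms(1) unfolding *(2) by (simp add: nonrepeating_def)
  moreover have "set (insert_letter \<nu> p i D \<mu>) \<inter> set (insert_letter \<nu> p i D \<mu>') = {}"
    if "\<mu> \<noteq> \<mu>'" for \<mu> \<mu>'
  proof -
    have "set (D \<mu>) \<inter> set (D \<mu>') = {}"
      using assms(1) that by (simp add: nonrepeating_def disjoint_family_on_def)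
    then show ?thesis
      using assms(2)[of \<mu>] assms(2)[of \<mu>'] that by (cases "\<mu> = \<nu>") (auto simp: set_insert_letter)
  qed
  ultimately show ?thesis by (simp add: nonrepeating_def disjoint_family_on_def)
qed

lemma insert_letter_in_tuples:
  assumes "D \<in> tuples X" "i \<notin> X"
  shows "insert_letter \<nu> p i D \<in> tuples (insert i X)"
proof -
  have "nonrepeating (insert_letter \<nu> p i D)"
    using assms by (intro nonrepeating_insert_letter) (auto simp: tuples_def)
  moreover have "(\<Union>\<mu>. set (insert_letter \<nu> p i D \<mu>)) = insert i X"
    using assms by (auto simp: tuples_def set_insert_letter)
  ultimately show ?thesis by (simp add: tuples_def)
qed

lemma filter_insert_letter:
  assumes "\<And>\<mu>. i \<notin> set (D \<mu>)"
  shows "(\<lambda>\<mu>. filter (\<lambda>k. k \<noteq> i) (insert_letter \<nu> p i D \<mu>)) = D"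
proof
  fix \<mu>
  obtain xs ys where *: "D \<nu> = xs @ ys" "insert_letter \<nu> p i D = D(\<nu> := xs @ i # ys)"
    by (rule insert_letter_split)
  have id: "filter (\<lambda>k. k \<noteq> i) zs = zs" if "i \<notin> set zs" for zs
    using that by (induction zs) auto
  have "i \<notin> set xs" "i \<notin> set ys" using assms[of \<nu>] *(1) by simp_all
  then show "filter (\<lambda>k. k \<noteq> i) (insert_letter \<nu> p i D \<mu>) = D \<mu>"
    using assms[of \<mu>] by (simp add: * id)
qed

text \<open>The inverse of insertion removes \<open>i\<close>, which occurs in exactly one place of a tuple that
  contains it.\<close>

lemma sum_tuples_insert:
  fixes G :: "('n::finite \<Rightarrow> 'i list) \<Rightarrow> 'c::comm_monoid_add"
  assumes "finite X" "i \<notin> X"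
  shows "(\<Sum>D\<in>tuples (insert i X). G D)
    = (\<Sum>D\<in>tuples X. \<Sum>\<nu>\<in>UNIV. \<Sum>p\<le>length (D \<nu>). G (insert_letter \<nu> p i D))"
proof -
  let ?S = "SIGMA D:tuples X. SIGMA \<nu>:UNIV. {..length (D \<nu>)} :: (('n \<Rightarrow> 'i list) \<times> 'n \<times> nat) set"
  let ?ins = "\<lambda>(D, \<nu>, p). insert_letter \<nu> p i D"
  have notin: "i \<notin> set (D \<mu>)" if "D \<in> tuples X" for D :: "'n \<Rightarrow> 'i list" and \<mu>
    using that assms(2) by (auto simp: tuples_def)
  have "inj_on ?ins ?S"
  proof (rule inj_onI)
    fix a b assume ab: "a \<in> ?S" "b \<in> ?S" "?ins a = ?ins b"
    obtain D \<nu> p where a: "a = (D, \<nu>, p)" by (cases a)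
    obtain D' \<nu>' p' where b: "b = (D', \<nu>', p')" by (cases b)
    have D: "D \<in> tuples X" "D' \<in> tuples X" and p: "p \<le> length (D \<nu>)" "p' \<le> length (D' \<nu>')"
      and eq: "insert_letter \<nu> p i D = insert_letter \<nu>' p' i D'"
      using ab by (simp_all add: a b)
    have DD: "D = D'"
      using filter_insert_letter[of i D \<nu> p] filter_insert_letter[of i D' \<nu>' p'] notin D eq by simp
    have "i \<in> set (insert_letter \<nu>' p' i D' \<nu>)" unfolding eq[symmetric] by (simp add: set_insert_letter)
    then have \<nu>: "\<nu> = \<nu>'" using notin[OF D(2), of \<nu>] by (auto simp: set_insert_letter split: if_splits)
    have ni: "i \<notin> set (D \<nu>)" using notin[OF D(1)] .
    have tw: "takeWhile (\<lambda>k. k \<noteq> i) (take q (D \<nu>) @ i # drop q (D \<nu>)) = take q (D \<nu>)" for q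
      using ni by (subst takeWhile_append2) (auto dest: in_set_takeD)
    have "take p (D \<nu>) @ i # drop p (D \<nu>) = take p' (D \<nu>) @ i # drop p' (D \<nu>)"
      using fun_cong[OF eq, of \<nu>] by (simp add: insert_letter_def DD \<nu>)
    then have "take p (D \<nu>) = take p' (D \<nu>)" using tw[of p] tw[of p'] by simp
    then have "length (take p (D \<nu>)) = length (take p' (D \<nu>))" by simp
    then have "p = p'" using p DD \<nu> by simp
    then show "a = b" using DD \<nu> by (simp add: a b)
  qed
  moreover have "?ins ` ?S = tuples (insert i X)"
  proof
    show "?ins ` ?S \<subseteq> tuples (insert i X)" using insert_letter_in_tuples[OF _ assms(2)] by auto
    show "tuples (insert i X) \<subseteq> ?ins ` ?S"
    proof
      fix D' :: "'n \<Rightarrow> 'i list" assume D': "D' \<in> tuples (insert i X)"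
      then obtain \<nu> where "i \<in> set (D' \<nu>)" by (auto simp: tuples_def)
      then obtain A B where AB: "D' \<nu> = A @ i # B" by (meson split_list)
      define D where "D = D'(\<nu> := A @ B)"
      have dis: "distinct (A @ i # B)" using D' AB by (metis (mono_tags) tuples_def nonrepeating_def mem_Collect_eq)
      have disj: "set (D' \<mu>) \<inter> set (D' \<mu>') = {}" if "\<mu> \<noteq> \<mu>'" for \<mu> \<mu>'
        using D' that by (auto simp: tuples_def nonrepeating_def disjoint_family_on_def)
      have sub: "set (D \<mu>) \<subseteq> set (D' \<mu>)" for \<mu> by (auto simp: D_def AB)
      have iD: "i \<notin> set (D \<mu>)" for \<mu>
        using dis disj[of \<mu> \<nu>] AB by (auto simp: D_def)
      have dD: "distinct (D \<mu>)" for \<mu>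
        using D' dis by (auto simp: D_def tuples_def nonrepeating_def)
      have djD: "disjoint_family (\<lambda>\<mu>. set (D \<mu>))"
        unfolding disjoint_family_on_def using disj sub by blast
      have "insert_letter \<nu> (length A) i D = D'"
        by (simp add: insert_letter_def D_def AB[symmetric])
      moreover have "(\<Union>\<mu>. set (D \<mu>)) = X"
      proof -
        have "(\<Union>\<mu>. set (insert_letter \<nu> (length A) i D \<mu>)) = insert i (\<Union>\<mu>. set (D \<mu>))"
          by (auto simp: set_insert_letter split: if_splits)
        moreover have "(\<Union>\<mu>. set (D' \<mu>)) = insert i X" using D' by (simp add: tuples_def)
        ultimately have "insert i (\<Union>\<mu>. set (D \<mu>)) = insert i X"
          using \<open>insert_letter \<nu> (length A) i D = D'\<close> by simp
        moreover have "i \<notin> (\<Union>\<mu>. set (D \<mu>))" using iD by simp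
        ultimately show ?thesis using assms(2) by (simp add: insert_ident)
      qed
      then have "D \<in> tuples X" using dD djD by (simp add: tuples_def nonrepeating_def)
      moreover have "length A \<le> length (D \<nu>)" by (simp add: D_def)
      ultimately show "D' \<in> ?ins ` ?S"
        by (intro image_eqI[of _ _ "(D, \<nu>, length A)"]) auto
    qed
  qed
  ultimately have "bij_betw ?ins ?S (tuples (insert i X))" by (simp add: bij_betw_def)
  then have "(\<Sum>D\<in>tuples (insert i X). G D) = (\<Sum>x\<in>?S. G (?ins x))"
    by (rule sum.reindex_bij_betw[symmetric])
  also have "\<dots> = (\<Sum>D\<in>tuples X. \<Sum>y\<in>(SIGMA \<nu>:UNIV. {..length (D \<nu>)}). G (?ins (D, y)))"
    using finite_tuples[OF assms(1)] by (subst sum.Sigma) (auto simp: case_prod_unfold)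
  also have "\<dots> = (\<Sum>D\<in>tuples X. \<Sum>\<nu>\<in>UNIV. \<Sum>p\<le>length (D \<nu>). G (insert_letter \<nu> p i D))"
    by (intro sum.cong HOL.refl, subst sum.Sigma) (auto simp: case_prod_unfold)
  finally show ?thesis .
qed

text \<open>The value that is subtracted from the coordinate of a letter placed in front of \<open>xs\<close>.\<close>

definition first_value :: "'i list \<Rightarrow> complex \<Rightarrow> ('i \<Rightarrow> complex) \<Rightarrow> complex" where
  "first_value xs z t = (case xs of [] \<Rightarrow> z | x # _ \<Rightarrow> t x)"

lemma first_value_simps [simp]:
  "first_value [] z t = z" "first_value (x # xs) z t = t x"
  by (simp_all add: first_value_def)

lemma zeta_coeff_Cons:
  "zeta_coeff (i # xs) z t = 1 / (t i - first_value xs z t) * zeta_coeff xs z t"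
  by (cases xs) simp_all

lemma zeta_coeff_append:
  "zeta_coeff (xs @ ys) z t = zeta_coeff xs (first_value ys z t) t * zeta_coeff ys z t"
proof (induction xs)
  case (Cons x xs)
  have "first_value (xs @ ys) z t = first_value xs (first_value ys z t) t" by (cases xs) simp_all
  then show ?case using Cons by (simp add: zeta_coeff_Cons)
qed simp

lemma zeta_coeff_fun_upd: "i \<notin> set xs \<Longrightarrow> zeta_coeff xs z (t(i := w)) = zeta_coeff xs z t"
proof (induction xs)
  case (Cons x xs)
  then show ?case by (cases xs) (auto simp: zeta_coeff_Cons)
qed simp

lemma zeta_coeff_insert:
  assumes "i \<notin> set xs" "i \<notin> set ys"
  shows "zeta_coeff (xs @ i # ys) z (t(i := w))
    = zeta_coeff xs w t * (1 / (w - first_value ys z t)) * zeta_coeff ys z t"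
proof -
  have "first_value ys z (t(i := w)) = first_value ys z t" using assms(2) by (cases ys) auto
  then show ?thesis
    using assms by (simp add: zeta_coeff_append zeta_coeff_Cons zeta_coeff_fun_upd)
qed

lemma zeta_coeff_analytic:
  assumes "xs \<noteq> [] \<Longrightarrow> t (last xs) \<noteq> p"
  shows "(\<lambda>w. zeta_coeff xs w t) analytic_on {p}"
proof (cases xs rule: rev_cases)
  case (snoc ys y)
  then have "t y \<noteq> p" using assms by simp
  then show ?thesis
    unfolding snoc by (auto simp: zeta_coeff_append intro!: analytic_intros)
qed simp

text \<open>A pole of order at most one with residue \<open>c\<close>.  Unlike \<open>residue\<close>, this is compatible with
  finite sums without further conditions.\<close>

definition has_simple_residue :: "(complex \<Rightarrow> complex) \<Rightarrow> complex \<Rightarrow> complex \<Rightarrow> bool" where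
  "has_simple_residue f p c \<longleftrightarrow>
     (\<exists>g. g analytic_on {p} \<and> g p = c \<and> (\<forall>\<^sub>F w in at p. f w = g w / (w - p)))"

lemma has_simple_residue_imp_residue:
  assumes "has_simple_residue f p c"
  shows "residue f p = c"
proof -
  obtain g where g: "g analytic_on {p}" "g p = c" "\<forall>\<^sub>F w in at p. f w = g w / (w - p)"
    using assms unfolding has_simple_residue_def by blast
  obtain e where e: "e > 0" "g holomorphic_on ball p e"
    using g(1) by (auto simp: analytic_on_def)
  have "residue f p = residue (\<lambda>w. g w / (w - p)) p" by (rule residue_cong[OF g(3) HOL.refl])
  also have "\<dots> = g p" by (rule residue_simple[OF _ _ e(2)]) (use e(1) in auto)
  finally show ?thesis using g(2) by simp
qed

lemma has_simple_residue_cong: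
  assumes "has_simple_residue g p c" "\<forall>\<^sub>F w in at p. f w = g w"
  shows "has_simple_residue f p c"
proof -
  obtain h where h: "h analytic_on {p}" "h p = c" "\<forall>\<^sub>F w in at p. g w = h w / (w - p)"
    using assms(1) unfolding has_simple_residue_def by blast
  have "\<forall>\<^sub>F w in at p. f w = h w / (w - p)"
    using assms(2) h(3) by eventually_elim simp
  then show ?thesis using h(1,2) unfolding has_simple_residue_def by blast
qed

lemma has_simple_residue_cmult:
  assumes "has_simple_residue f p c"
  shows "has_simple_residue (\<lambda>w. a * f w) p (a * c)"
proof -
  obtain g where g: "g analytic_on {p}" "g p = c" "\<forall>\<^sub>F w in at p. f w = g w / (w - p)"
    using assms unfolding has_simple_residue_def by blast
  have "\<forall>\<^sub>F w in at p. a * f w = a * g w / (w - p)"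
    using g(3) by eventually_elim simp
  moreover have "(\<lambda>w. a * g w) analytic_on {p}" by (intro analytic_intros g(1))
  ultimately show ?thesis
    unfolding has_simple_residue_def using g(2) by (intro exI[of _ "\<lambda>w. a * g w"]) simp
qed

lemma has_simple_residue_add:
  assumes "has_simple_residue f p c" "has_simple_residue f' p c'"
  shows "has_simple_residue (\<lambda>w. f w + f' w) p (c + c')"
proof -
  obtain g where g: "g analytic_on {p}" "g p = c" "\<forall>\<^sub>F w in at p. f w = g w / (w - p)"
    using assms(1) unfolding has_simple_residue_def by blast
  obtain g' where g': "g' analytic_on {p}" "g' p = c'" "\<forall>\<^sub>F w in at p. f' w = g' w / (w - p)"
    using assms(2) unfolding has_simple_residue_def by blast
  have "\<forall>\<^sub>F w in at p. f w + f' w = (g w + g' w) / (w - p)"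
    using g(3) g'(3) by eventually_elim (simp add: add_divide_distrib)
  moreover have "(\<lambda>w. g w + g' w) analytic_on {p}" by (intro analytic_intros g(1) g'(1))
  ultimately show ?thesis
    unfolding has_simple_residue_def using g(2) g'(2)
    by (intro exI[of _ "\<lambda>w. g w + g' w"]) simp
qed

lemma has_simple_residue_analytic:
  assumes "f analytic_on {p}"
  shows "has_simple_residue f p 0"
  unfolding has_simple_residue_def
proof (intro exI conjI)
  show "(\<lambda>w. f w * (w - p)) analytic_on {p}" by (intro analytic_intros assms)
  have "\<forall>\<^sub>F w in at p. w \<noteq> p" by (rule eventually_neq_at_within)
  then show "\<forall>\<^sub>F w in at p. f w = f w * (w - p) / (w - p)" by eventually_elim simp
qed simp

lemma has_simple_residue_sum:
  assumes "\<And>x. x \<in> A \<Longrightarrow> has_simple_residue (f x) p (c x)"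
  shows "has_simple_residue (\<lambda>w. \<Sum>x\<in>A. f x w) p (\<Sum>x\<in>A. c x)"
  using assms
proof (induction A rule: infinite_finite_induct)
  case (insert x A)
  then show ?case by (simp add: has_simple_residue_add)
qed (simp_all add: has_simple_residue_analytic)

text \<open>The residue of an inserted letter at the coordinate of \<open>j\<close> is 1 if the letter stands
  immediately before \<open>j\<close> and -1 if it stands immediately after \<open>j\<close>: this is the
  coefficient of a commutator.\<close>

definition adjacency :: "'i \<Rightarrow> 'i list \<Rightarrow> 'i list \<Rightarrow> complex" where
  "adjacency j xs ys =
     (if ys \<noteq> [] \<and> hd ys = j then 1 else 0) - (if xs \<noteq> [] \<and> last xs = j then 1 else 0)"

lemma adjacency_nonzero: "adjacency j xs ys \<noteq> 0 \<Longrightarrow> j \<in> set xs \<or> j \<in> set ys"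
  by (auto simp: adjacency_def split: if_splits)

text \<open>Only the two factors on the sides of the inserted letter depend on \<open>w\<close>, and at most one of them
  has a pole at \<open>t j\<close>; at the pole the other one becomes the factor that connects the neighbours of
  the letter.\<close>

lemma has_simple_residue_zeta_coeff_insert:
  assumes i: "i \<notin> set xs" "i \<notin> set ys" and dist: "distinct (xs @ ys)"
    and inj: "inj_on t (insert j (set (xs @ ys)))" and z: "z \<notin> t ` insert j (set (xs @ ys))"
  shows "has_simple_residue (\<lambda>w. zeta_coeff (xs @ i # ys) z (t(i := w))) (t j)
    (adjacency j xs ys * zeta_coeff (xs @ ys) z t)"
proof -
  let ?b = "first_value ys z t"
  note eq = zeta_coeff_insert[OF i, of z t]
  have neq: "t k \<noteq> t j" if "k \<in> set (xs @ ys)" "k \<noteq> j" for k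
    using inj that by (auto simp: inj_on_def)
  have b: "?b \<noteq> t j" if "ys = [] \<or> hd ys \<noteq> j"
    using that z neq by (cases ys) auto
  show ?thesis
  proof (cases "ys \<noteq> [] \<and> hd ys = j")
    case True
    then have bj: "?b = t j" by (cases ys) auto
    have last: "last xs \<noteq> j" if "xs \<noteq> []"
      using dist True that by (cases ys) auto
    have "(\<lambda>w. zeta_coeff xs w t * zeta_coeff ys z t) analytic_on {t j}"
      using last neq by (intro analytic_intros zeta_coeff_analytic) simp_all
    then have "has_simple_residue (\<lambda>w. zeta_coeff (xs @ i # ys) z (t(i := w))) (t j)
        (zeta_coeff xs (t j) t * zeta_coeff ys z t)"
      unfolding has_simple_residue_def eq bj
      by (intro exI[of _ "\<lambda>w. zeta_coeff xs w t * zeta_coeff ys z t"]) simp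
    then show ?thesis
      using True last by (auto simp: adjacency_def zeta_coeff_append bj)
  next
    case False
    then have bj: "?b \<noteq> t j" using b by blast
    show ?thesis
    proof (cases "xs \<noteq> [] \<and> last xs = j")
      case True
      then obtain xs' where xs: "xs = xs' @ [j]" by (metis append_butlast_last_id)
      let ?g = "\<lambda>w. - zeta_coeff xs' (t j) t * (1 / (w - ?b)) * zeta_coeff ys z t"
      have "?g analytic_on {t j}" using bj by (auto intro!: analytic_intros)
      moreover have "?g (t j) = - zeta_coeff (xs @ ys) z t"
        by (simp add: xs zeta_coeff_append zeta_coeff_Cons)
      moreover have "zeta_coeff (xs @ i # ys) z (t(i := w)) = ?g w / (w - t j)" for w
      proof -
        have "1 / (t j - w) = - (1 / (w - t j))" by (metis minus_diff_eq minus_divide_right)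
        then show ?thesis unfolding eq by (simp add: xs zeta_coeff_append)
      qed
      ultimately have "has_simple_residue (\<lambda>w. zeta_coeff (xs @ i # ys) z (t(i := w))) (t j)
          (- zeta_coeff (xs @ ys) z t)"
        unfolding has_simple_residue_def by (intro exI[of _ ?g]) simp
      then show ?thesis using True False by (auto simp: adjacency_def)
    next
      case False2: False
      then have "t (last xs) \<noteq> t j" if "xs \<noteq> []" using neq[of "last xs"] that by simp
      then have "(\<lambda>w. zeta_coeff (xs @ i # ys) z (t(i := w))) analytic_on {t j}"
        unfolding eq using bj by (intro analytic_intros zeta_coeff_analytic) auto
      then show ?thesis using False False2 has_simple_residue_analytic
        by (auto simp: adjacency_def)
    qed
  qed
qed

text \<open>As the coordinates are infinitely many and may accumulate, a generic point need not stay generic if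
  one coordinate is moved a little.  It does if genericity is only required of finitely many
  coordinates.\<close>

definition generic_on :: "('n \<Rightarrow> complex) \<Rightarrow> 'i set \<Rightarrow> ('i \<Rightarrow> complex) \<Rightarrow> bool" where
  "generic_on z Y t \<longleftrightarrow> inj_on t Y \<and> t ` Y \<inter> range z = {}"

lemma generic_on_generic_points: "t \<in> generic_points z \<Longrightarrow> generic_on z Y t"
  unfolding generic_points_def generic_on_def by (blast intro: inj_on_subset)

lemma generic_on_subset: "generic_on z Y t \<Longrightarrow> X \<subseteq> Y \<Longrightarrow> generic_on z X t"
  unfolding generic_on_def by (blast intro: inj_on_subset)

lemma generic_on_fun_upd:
  assumes "generic_on z (X - {i}) t" "u \<notin> t ` (X - {i})" "u \<notin> range z"
  shows "generic_on z (insert i X) (t(i := u))"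
proof -
  have "inj_on (t(i := u)) (X - {i})"
    using assms(1) inj_on_cong[of "X - {i}" "t(i := u)" t] by (simp add: generic_on_def)
  moreover have image: "(t(i := u)) ` (X - {i}) = t ` (X - {i})" by auto
  moreover have "(t(i := u)) i \<notin> (t(i := u)) ` (X - {i} - {i})" using assms(2) image by simp
  ultimately have "inj_on (t(i := u)) (insert i X)"
    using inj_on_insert[of "t(i := u)" i "X - {i}"] by (simp only: insert_Diff_single simp_thms)
  moreover have "(t(i := u)) ` insert i X = insert u (t ` (X - {i}))"
    using image by auto
  ultimately show ?thesis using assms unfolding generic_on_def by simp
qed

lemma eventually_notin_finite:
  fixes p :: "'a::t1_space"
  assumes "finite A"
  shows "\<forall>\<^sub>F w in at p. w \<notin> A"
  using assms
proof induction
  case (insert x A)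
  have "\<forall>\<^sub>F w in at p. w \<noteq> x" by (rule eventually_neq_at_within)
  with insert.IH show ?case by eventually_elim simp
qed simp

lemma eventually_generic:
  fixes z :: "'n::finite \<Rightarrow> complex"
  assumes "generic_on z (X - {i}) t" "finite X"
  shows "\<forall>\<^sub>F w in at p. generic_on z (insert i X) (t(i := w))"
proof -
  have "\<forall>\<^sub>F w in at p. w \<notin> t ` (X - {i}) \<union> range z"
    using assms(2) by (intro eventually_notin_finite) simp
  then show ?thesis
    by eventually_elim (rule generic_on_fun_upd[OF assms(1)], simp_all)
qed

lemma zeta_prod_insert_letter:
  assumes "\<And>\<mu>. i \<notin> set (D \<mu>)"
  shows "zeta_prod z (insert_letter \<nu> p i D) (t(i := w))
    = zeta_coeff (take p (D \<nu>) @ i # drop p (D \<nu>)) (z \<nu>) (t(i := w))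
      * (\<Prod>\<mu>\<in>UNIV - {\<nu>}. zeta_coeff (D \<mu>) (z \<mu>) t)"
  unfolding zeta_prod_def
  by (subst prod.remove[of _ \<nu>]) (auto simp: insert_letter_def zeta_coeff_fun_upd assms)

text \<open>The coefficients of the residue: \<open>i\<close> is inserted into \<open>D\<close> in all possible ways.  They vanish
  if \<open>i\<close> occurs in \<open>D\<close>, because the diagonal does not have the coordinate \<open>t i\<close>.\<close>

definition res_coeff ::
    "'i \<Rightarrow> 'i \<Rightarrow> (('n::finite \<Rightarrow> 'i list) \<Rightarrow> complex) \<Rightarrow> ('n \<Rightarrow> 'i list) \<Rightarrow> complex" where
  "res_coeff i j \<Phi> D = (if \<exists>\<mu>. i \<in> set (D \<mu>) then 0
     else \<Sum>\<nu>\<in>UNIV. \<Sum>p\<le>length (D \<nu>).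
       adjacency j (take p (D \<nu>)) (drop p (D \<nu>)) * \<Phi> (insert_letter \<nu> p i D))"

lemma Res_diag_pd_of:
  fixes z :: "'n::finite \<Rightarrow> complex"
  assumes X: "finite X" "i \<notin> X" and t: "generic_on z (insert j X) t"
    and \<omega>: "\<And>t. generic_on z (insert i X) t \<Longrightarrow> \<omega> (insert i X) t = pd_of z \<Phi> (insert i X) t"
  shows "Res_diag i j \<omega> X t = pd_of z (res_coeff i j \<Phi>) X t"
proof -
  let ?c = "\<lambda>D \<nu> p. adjacency j (take p (D \<nu>)) (drop p (D \<nu>)) * \<Phi> (insert_letter \<nu> p i D)"
  have inner: "has_simple_residue (\<lambda>w. \<Phi> (insert_letter \<nu> p i D) * zeta_prod z (insert_letter \<nu> p i D) (t(i := w)))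
      (t j) (?c D \<nu> p * zeta_prod z D t)"
    if D: "D \<in> tuples X" for D :: "'n \<Rightarrow> 'a list" and \<nu> p
  proof -
    have i: "i \<notin> set (D \<mu>)" for \<mu> using X(2) tuples_subset[OF D] by blast
    have sub: "set (take p (D \<nu>) @ drop p (D \<nu>)) \<subseteq> X"
      using tuples_subset[OF D, of \<nu>] by (simp only: append_take_drop_id)
    have generic: "generic_on z (insert j (set (take p (D \<nu>) @ drop p (D \<nu>)))) t"
      by (rule generic_on_subset[OF t insert_mono[OF sub]])
    let ?r = "\<Prod>\<mu>\<in>UNIV - {\<nu>}. zeta_coeff (D \<mu>) (z \<mu>) t"
    have "has_simple_residue (\<lambda>w. zeta_coeff (take p (D \<nu>) @ i # drop p (D \<nu>)) (z \<nu>) (t(i := w))) (t j)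
      (adjacency j (take p (D \<nu>)) (drop p (D \<nu>)) * zeta_coeff (take p (D \<nu>) @ drop p (D \<nu>)) (z \<nu>) t)"
    proof (rule has_simple_residue_zeta_coeff_insert)
      show "i \<notin> set (take p (D \<nu>))" "i \<notin> set (drop p (D \<nu>))"
        using i[of \<nu>] by (auto dest: in_set_takeD in_set_dropD)
      show "distinct (take p (D \<nu>) @ drop p (D \<nu>))"
        using D unfolding append_take_drop_id by (simp add: tuples_def nonrepeating_def)
      show "inj_on t (insert j (set (take p (D \<nu>) @ drop p (D \<nu>))))"
        using generic unfolding generic_on_def by (rule conjunct1)
      show "z \<nu> \<notin> t ` insert j (set (take p (D \<nu>) @ drop p (D \<nu>)))"
        using generic unfolding generic_on_def by blast
    qed
    from has_simple_residue_cmult[OF this, of "\<Phi> (insert_letter \<nu> p i D) * ?r"]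
    have "has_simple_residue (\<lambda>w. (\<Phi> (insert_letter \<nu> p i D) * ?r)
        * zeta_coeff (take p (D \<nu>) @ i # drop p (D \<nu>)) (z \<nu>) (t(i := w))) (t j)
      ((\<Phi> (insert_letter \<nu> p i D) * ?r)
        * (adjacency j (take p (D \<nu>)) (drop p (D \<nu>)) * zeta_coeff (D \<nu>) (z \<nu>) t))"
      unfolding append_take_drop_id .
    moreover have "zeta_prod z D t = zeta_coeff (D \<nu>) (z \<nu>) t * ?r"
      unfolding zeta_prod_def by (rule prod.remove) simp_all
    ultimately show ?thesis
      by (simp only: zeta_prod_insert_letter[OF i] mult_ac)
  qed
  have "has_simple_residue (\<lambda>w. pd_of z \<Phi> (insert i X) (t(i := w))) (t j)
     (\<Sum>D\<in>tuples X. \<Sum>\<nu>\<in>UNIV. \<Sum>p\<le>length (D \<nu>). ?c D \<nu> p * zeta_prod z D t)"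
    unfolding pd_of_def sum_tuples_insert[OF X] by (intro has_simple_residue_sum inner)
  moreover have "\<forall>\<^sub>F w in at (t j). \<omega> (insert i X) (t(i := w)) = pd_of z \<Phi> (insert i X) (t(i := w))"
  proof -
    have "generic_on z (X - {i}) t" using t by (rule generic_on_subset) blast
    from eventually_generic[OF this X(1)] show ?thesis
      by (rule eventually_mono) (rule \<omega>)
  qed
  ultimately have "has_simple_residue (\<lambda>w. \<omega> (insert i X) (t(i := w))) (t j)
     (\<Sum>D\<in>tuples X. \<Sum>\<nu>\<in>UNIV. \<Sum>p\<le>length (D \<nu>). ?c D \<nu> p * zeta_prod z D t)"
    by (rule has_simple_residue_cong)
  from has_simple_residue_imp_residue[OF this] have "Res_diag i j \<omega> X t
      = (\<Sum>D\<in>tuples X. \<Sum>\<nu>\<in>UNIV. \<Sum>p\<le>length (D \<nu>). ?c D \<nu> p * zeta_prod z D t)"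
    using X(2) by (simp only: Res_diag_def if_False)
  also have "\<dots> = pd_of z (res_coeff i j \<Phi>) X t"
    unfolding pd_of_def
  proof (intro sum.cong HOL.refl)
    fix D :: "'n \<Rightarrow> 'a list" assume "D \<in> tuples X"
    then have "\<not> (\<exists>\<mu>. i \<in> set (D \<mu>))" using X(2) tuples_subset[of D X] by blast
    then show "(\<Sum>\<nu>\<in>UNIV. \<Sum>p\<le>length (D \<nu>). ?c D \<nu> p * zeta_prod z D t)
        = res_coeff i j \<Phi> D * zeta_prod z D t"
      by (simp add: res_coeff_def sum_distrib_right)
  qed
  finally show ?thesis .
qed

text \<open>The coordinate of \<open>i\<close> has to be generic even if \<open>i\<close> is not in \<open>X\<close>: the preceding
  residue has been taken at this point.\<close>

definition pd_agrees ::
    "('n::finite \<Rightarrow> complex) \<Rightarrow> 'i \<Rightarrow> 'i polydifferential \<Rightarrow> (('n \<Rightarrow> 'i list) \<Rightarrow> complex) \<Rightarrow> bool" where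
  "pd_agrees z i \<omega> \<Phi> \<longleftrightarrow>
     (\<forall>X t. finite X \<longrightarrow> generic_on z (insert i X) t \<longrightarrow> \<omega> X t = pd_of z \<Phi> X t)"

lemma pd_agrees_Res_diag:
  assumes "pd_agrees z i \<omega> \<Phi>"
  shows "pd_agrees z j (Res_diag i j \<omega>) (res_coeff i j \<Phi>)"
  unfolding pd_agrees_def
proof (intro allI impI)
  fix X :: "'b set" and t assume X: "finite X" and t: "generic_on z (insert j X) t"
  show "Res_diag i j \<omega> X t = pd_of z (res_coeff i j \<Phi>) X t"
  proof (cases "i \<in> X")
    case True
    have "pd_of z (res_coeff i j \<Phi>) X t = 0"
      unfolding pd_of_def
    proof (rule sum.neutral, rule ballI)
      fix D :: "'a \<Rightarrow> 'b list" assume "D \<in> tuples X"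
      then have "\<exists>\<mu>. i \<in> set (D \<mu>)" using True by (auto simp: tuples_def)
      then show "res_coeff i j \<Phi> D * zeta_prod z D t = 0" by (simp add: res_coeff_def)
    qed
    then show ?thesis using True by (simp add: Res_diag_def)
  next
    case False
    show ?thesis
      by (rule Res_diag_pd_of[OF X False t]) (use assms X in \<open>simp add: pd_agrees_def\<close>)
  qed
qed

fun res_coeffs ::
    "'i list \<Rightarrow> (('n::finite \<Rightarrow> 'i list) \<Rightarrow> complex) \<Rightarrow> ('n \<Rightarrow> 'i list) \<Rightarrow> complex" where
  "res_coeffs (i # j # is) \<Phi> = res_coeffs (j # is) (res_coeff i j \<Phi>)"
| "res_coeffs _ \<Phi> = \<Phi>"

lemma pd_agrees_Res_seq:
  "pd_agrees z i \<omega> \<Phi> \<Longrightarrow> pd_agrees z (last (i # is)) (Res_seq (i # is) \<omega>) (res_coeffs (i # is) \<Phi>)"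
proof (induction "is" arbitrary: i \<omega> \<Phi>)
  case (Cons j "is")
  from Cons.IH[OF pd_agrees_Res_diag[OF Cons.prems, of j]] show ?case by simp
qed simp

lemma res_coeff_nonzeroD:
  assumes "res_coeff i j \<Phi> D \<noteq> 0"
  shows "i \<notin> set (D \<mu>)"
    and "\<exists>\<nu> p. adjacency j (take p (D \<nu>)) (drop p (D \<nu>)) \<noteq> 0 \<and> \<Phi> (insert_letter \<nu> p i D) \<noteq> 0"
proof -
  have i: "\<not> (\<exists>\<mu>. i \<in> set (D \<mu>))" using assms unfolding res_coeff_def by presburger
  then have "(\<Sum>\<nu>\<in>UNIV. \<Sum>p\<le>length (D \<nu>).
       adjacency j (take p (D \<nu>)) (drop p (D \<nu>)) * \<Phi> (insert_letter \<nu> p i D)) \<noteq> 0"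
    using assms by (simp add: res_coeff_def)
  then obtain \<nu> where "(\<Sum>p\<le>length (D \<nu>).
       adjacency j (take p (D \<nu>)) (drop p (D \<nu>)) * \<Phi> (insert_letter \<nu> p i D)) \<noteq> 0"
    by (rule sum.not_neutral_contains_not_neutral)
  then obtain p where "adjacency j (take p (D \<nu>)) (drop p (D \<nu>)) * \<Phi> (insert_letter \<nu> p i D) \<noteq> 0"
    by (rule sum.not_neutral_contains_not_neutral)
  then show "\<exists>\<nu> p. adjacency j (take p (D \<nu>)) (drop p (D \<nu>)) \<noteq> 0 \<and> \<Phi> (insert_letter \<nu> p i D) \<noteq> 0"
    by (intro exI[of _ \<nu>] exI[of _ p]) simp
  show "i \<notin> set (D \<mu>)" using i by blast
qed

lemma res_coeffs_avoid:
  assumes "res_coeffs (i # is) \<Phi> D \<noteq> 0"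
  shows "set (D \<mu>) \<inter> set (butlast (i # is)) = {}"
proof -
  have "set (D \<mu>) \<inter> (K \<union> set (butlast (i # is))) = {}"
    if "\<And>D \<mu>. \<Phi> D \<noteq> 0 \<Longrightarrow> set (D \<mu>) \<inter> K = {}" "res_coeffs (i # is) \<Phi> D \<noteq> 0" for K
    using that
  proof (induction "is" arbitrary: i \<Phi> K)
    case Nil
    then show ?case by simp
  next
    case (Cons j "is")
    have "set (D \<mu>) \<inter> (insert i K \<union> set (butlast (j # is))) = {}"
    proof (rule Cons.IH)
      show "res_coeffs (j # is) (res_coeff i j \<Phi>) D \<noteq> 0" using Cons.prems by simp
    next
      fix D \<mu> assume *: "res_coeff i j \<Phi> D \<noteq> 0"
      obtain \<nu> p where ne: "\<Phi> (insert_letter \<nu> p i D) \<noteq> 0"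
        using res_coeff_nonzeroD(2)[OF *] by blast
      have i: "i \<notin> set (D \<mu>)" for \<mu> by (rule res_coeff_nonzeroD(1)[OF *])
      have "set (insert_letter \<nu> p i D \<mu>) \<inter> K = {}"
        by (rule Cons.prems(1)[OF ne])
      then show "set (D \<mu>) \<inter> insert i K = {}"
        using i[of \<mu>] by (auto simp: set_insert_letter split: if_splits)
    qed
    then show ?case by auto
  qed
  from this[of "{}"] assms show ?thesis by simp
qed

lemma res_coeffs_contains:
  assumes "res_coeffs (i # j # is) \<Phi> D \<noteq> 0"
  shows "\<exists>\<mu>. last (j # is) \<in> set (D \<mu>)"
  using assms
proof (induction "is" arbitrary: i j \<Phi>)
  case Nil
  then have *: "res_coeff i j \<Phi> D \<noteq> 0" by simp
  obtain \<nu> p where "adjacency j (take p (D \<nu>)) (drop p (D \<nu>)) \<noteq> 0"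
    using res_coeff_nonzeroD(2)[OF *] by blast
  then have "j \<in> set (take p (D \<nu>)) \<or> j \<in> set (drop p (D \<nu>))"
    by (intro adjacency_nonzero)
  then have "j \<in> set (D \<nu>)" by (meson in_set_takeD in_set_dropD)
  then show ?case by auto
next
  case (Cons k "is")
  then show ?case using Cons.IH[of j k "res_coeff i j \<Phi>"] by simp
qed


section \<open>Iterated residues are iterated brackets\<close>

definition strip :: "'n \<Rightarrow> 'r list \<Rightarrow> ('n, 'r) vect \<Rightarrow> ('n, 'r) vect" where
  "strip \<nu> ks v = fold (e_tilde \<nu>) ks v"

lemma lookup_strip:
  "Poly_Mapping.lookup (strip \<nu> ks v) S = Poly_Mapping.lookup v (S(\<nu> := ks @ S \<nu>))"
  by (induction ks arbitrary: v) (simp_all add: strip_def)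

lemma strip_V_module: "v \<in> V_module C wt \<Longrightarrow> strip \<nu> ks v \<in> V_module C wt"
  by (induction ks arbitrary: v) (simp_all add: strip_def V_module.e)

text \<open>The coefficients \<open>\<Phi>\<close> come from \<open>v\<close> with the letter \<open>i\<close> standing for the Lie element
  \<open>y\<close>: reading a coefficient of \<open>v\<close> amounts to removing letters from the left, which are the
  operators \<open>e_tilde\<close>, and at the letter \<open>i\<close> the element \<open>y\<close> acts instead.  The set
  \<open>K\<close> contains the indices that have been eliminated.\<close>

definition represents ::
    "('r \<Rightarrow> 'r \<Rightarrow> int) \<Rightarrow> ('n \<Rightarrow> 'r \<Rightarrow> real) \<Rightarrow> ('i \<Rightarrow> 'r) \<Rightarrow> ('n, 'r) vect \<Rightarrow>
     'r chevalley lie_term \<Rightarrow> 'i \<Rightarrow> 'i set \<Rightarrow> (('n \<Rightarrow> 'i list) \<Rightarrow> complex) \<Rightarrow> bool" where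
  "represents C wt \<pi> v y i K \<Phi> \<longleftrightarrow> (\<forall>D \<nu> xs ys.
     nonrepeating D \<longrightarrow> (\<forall>\<mu>. set (D \<mu>) \<inter> K = {}) \<longrightarrow> D \<nu> = xs @ i # ys \<longrightarrow>
     \<Phi> D = Poly_Mapping.lookup (act_at C wt \<nu> y (strip \<nu> (map \<pi> xs) v))
       ((\<lambda>\<mu>. map \<pi> (D \<mu>))(\<nu> := map \<pi> ys)))"

lemma represents_start:
  fixes v :: "('n, 'r) vect" and \<pi> :: "'i \<Rightarrow> 'r"
  shows "represents C wt \<pi> v (Gen (E (\<pi> i))) i {} (\<lambda>D. Poly_Mapping.lookup v (\<lambda>\<nu>. map \<pi> (D \<nu>)))"
  unfolding represents_def
proof (intro allI impI)
  fix D :: "'n \<Rightarrow> 'i list" and \<nu> xs ys assume D: "D \<nu> = xs @ i # ys"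
  have "(\<lambda>\<mu>. map \<pi> (D \<mu>))(\<nu> := map \<pi> xs @ \<pi> i # map \<pi> ys) = (\<lambda>\<mu>. map \<pi> (D \<mu>))"
    by (auto simp: D)
  then show "Poly_Mapping.lookup v (\<lambda>\<nu>. map \<pi> (D \<nu>))
      = Poly_Mapping.lookup (act_at C wt \<nu> (Gen (E (\<pi> i))) (strip \<nu> (map \<pi> xs) v))
       ((\<lambda>\<mu>. map \<pi> (D \<mu>))(\<nu> := map \<pi> ys))"
    by (simp add: lookup_strip)
qed

lemma adjacency_position:
  assumes "distinct (xs @ j # ys)" "p \<le> length (xs @ j # ys)"
  shows "adjacency j (take p (xs @ j # ys)) (drop p (xs @ j # ys))
    = (if p = length xs then 1 else 0) - (if p = Suc (length xs) then 1 else 0)"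
proof -
  let ?l = "xs @ j # ys"
  have nth: "?l ! q = j \<longleftrightarrow> q = length xs" if "q < length ?l" for q
    using nth_eq_iff_index_eq[OF assms(1) that, of "length xs"] by simp
  have "drop p ?l \<noteq> [] \<and> hd (drop p ?l) = j \<longleftrightarrow> p = length xs"
    using nth[of p] by (cases "p < length ?l") (auto simp: hd_drop_conv_nth simp del: drop_append)
  moreover have "take p ?l \<noteq> [] \<and> last (take p ?l) = j \<longleftrightarrow> p = Suc (length xs)"
  proof (cases p)
    case (Suc q)
    then have "last (take p ?l) = ?l ! q" using assms(2)
      by (subst last_conv_nth) (auto simp del: take_append)
    then show ?thesis using nth[of q] Suc assms(2) by auto
  qed simp
  ultimately show ?thesis by (simp only: adjacency_def)
qed

lemma res_coeff_split:
  assumes D: "nonrepeating D" and i: "\<And>\<mu>. i \<notin> set (D \<mu>)" and \<nu>: "D \<nu> = xs @ j # ys"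
  shows "res_coeff i j \<Phi> D = \<Phi> (D(\<nu> := xs @ i # j # ys)) - \<Phi> (D(\<nu> := (xs @ [j]) @ i # ys))"
proof -
  let ?s = "\<lambda>\<mu>. \<Sum>p\<le>length (D \<mu>).
       adjacency j (take p (D \<mu>)) (drop p (D \<mu>)) * \<Phi> (insert_letter \<mu> p i D)"
  have "?s \<mu> = 0" if "\<mu> \<noteq> \<nu>" for \<mu>
  proof (rule sum.neutral, rule ballI)
    fix p
    have "set (D \<mu>) \<inter> set (D \<nu>) = {}"
      using D that by (auto simp: nonrepeating_def disjoint_family_on_def)
    then have j: "j \<notin> set (D \<mu>)" using \<nu> by auto
    then have "\<not> (take p (D \<mu>) \<noteq> [] \<and> last (take p (D \<mu>)) = j)"
      using in_set_takeD last_in_set by metis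
    moreover have "\<not> (drop p (D \<mu>) \<noteq> [] \<and> hd (drop p (D \<mu>)) = j)"
      using in_set_dropD hd_in_set j by metis
    ultimately show "adjacency j (take p (D \<mu>)) (drop p (D \<mu>)) * \<Phi> (insert_letter \<mu> p i D) = 0"
      by (simp only: adjacency_def if_False) simp
  qed
  then have "(\<Sum>\<mu>\<in>UNIV. ?s \<mu>) = ?s \<nu>"
    by (subst sum.remove[of _ \<nu>]) simp_all
  also have "\<dots> = (\<Sum>p\<le>length (D \<nu>). (if p = length xs then \<Phi> (insert_letter \<nu> p i D) else 0)
      - (if p = Suc (length xs) then \<Phi> (insert_letter \<nu> p i D) else 0))"
  proof (intro sum.cong HOL.refl)
    fix p assume p: "p \<in> {..length (D \<nu>)}"
    have "distinct (D \<nu>)" using D by (simp add: nonrepeating_def)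
    then have "adjacency j (take p (D \<nu>)) (drop p (D \<nu>))
        = (if p = length xs then 1 else 0) - (if p = Suc (length xs) then 1 else 0)"
      using p unfolding \<nu> by (intro adjacency_position) simp_all
    then show "adjacency j (take p (D \<nu>)) (drop p (D \<nu>)) * \<Phi> (insert_letter \<nu> p i D)
      = (if p = length xs then \<Phi> (insert_letter \<nu> p i D) else 0)
        - (if p = Suc (length xs) then \<Phi> (insert_letter \<nu> p i D) else 0)"
      by (simp only:) simp
  qed
  also have "\<dots> = \<Phi> (insert_letter \<nu> (length xs) i D) - \<Phi> (insert_letter \<nu> (Suc (length xs)) i D)"
    by (auto simp: sum_subtractf \<nu> Suc_le_eq)
  finally show ?thesis using i by (simp add: res_coeff_def insert_letter_def \<nu>)
qed

text \<open>The residue is the difference of the two orders of the adjacent letters \<open>i\<close> and \<open>j\<close>, hence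
  the difference of the two products of \<open>y\<close> and \<open>E (\<pi> j)\<close>.\<close>

lemma represents_res_coeff:
  fixes v :: "('n::finite, 'r) vect" and \<pi> :: "'i \<Rightarrow> 'r"
  assumes \<Phi>: "represents C wt \<pi> v y i K \<Phi>" and ij: "i \<noteq> j" "i \<notin> K" "j \<notin> K"
  shows "represents C wt \<pi> v (Br (Gen (E (\<pi> j))) y) j (insert i K) (res_coeff i j \<Phi>)"
  unfolding represents_def
proof (intro allI impI)
  fix D :: "'n \<Rightarrow> 'i list" and \<nu> xs ys
  assume D: "nonrepeating D" and K: "\<forall>\<mu>. set (D \<mu>) \<inter> insert i K = {}" and \<nu>: "D \<nu> = xs @ j # ys"
  have i: "i \<notin> set (D \<mu>)" for \<mu> using K by auto
  have upd [simp]: "(\<lambda>\<mu>. map \<pi> (if \<mu> = \<nu> then zs else D \<mu>))(\<nu> := ws)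
      = (\<lambda>\<mu>. map \<pi> (D \<mu>))(\<nu> := ws)" for zs ws
    by auto
  let ?S = "(\<lambda>\<mu>. map \<pi> (D \<mu>))(\<nu> := map \<pi> ys)"
  let ?a = "act_at C wt \<nu> y" and ?v = "strip \<nu> (map \<pi> xs) v"
  have ins: "nonrepeating D' \<and> (\<forall>\<mu>. set (D' \<mu>) \<inter> K = {})"
    if "D' = insert_letter \<nu> p i D" for D' p
    using that K ij(2) nonrepeating_insert_letter[OF D i] by (auto simp: set_insert_letter)
  have "\<Phi> (D(\<nu> := xs @ i # j # ys)) = Poly_Mapping.lookup (?a ?v) (?S(\<nu> := \<pi> j # map \<pi> ys))"
    using \<Phi>[unfolded represents_def, rule_format, of "D(\<nu> := xs @ i # j # ys)" \<nu> xs "j # ys"]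
      ins[of "D(\<nu> := xs @ i # j # ys)" "length xs"]
    by (simp add: insert_letter_def \<nu>)
  moreover have "\<Phi> (D(\<nu> := (xs @ [j]) @ i # ys))
      = Poly_Mapping.lookup (?a (strip \<nu> (map \<pi> (xs @ [j])) v)) ?S"
    using \<Phi>[unfolded represents_def, rule_format, of "D(\<nu> := (xs @ [j]) @ i # ys)" \<nu> "xs @ [j]" ys]
      ins[of "D(\<nu> := (xs @ [j]) @ i # ys)" "Suc (length xs)"]
    by (simp add: insert_letter_def \<nu>)
  moreover have "strip \<nu> (map \<pi> (xs @ [j])) v = e_tilde \<nu> (\<pi> j) ?v"
    by (simp add: strip_def)
  ultimately show "res_coeff i j \<Phi> D
      = Poly_Mapping.lookup (act_at C wt \<nu> (Br (Gen (E (\<pi> j))) y) ?v) ?S"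
    by (simp add: res_coeff_split[OF D i \<nu>])
qed

definition ad_E :: "('i \<Rightarrow> 'r) \<Rightarrow> 'i list \<Rightarrow> 'r chevalley lie_term \<Rightarrow> 'r chevalley lie_term" where
  "ad_E \<pi> is y = fold (\<lambda>j. Br (Gen (E (\<pi> j)))) is y"

lemma ad_E_simps [simp]:
  "ad_E \<pi> [] y = y" "ad_E \<pi> (j # is) y = ad_E \<pi> is (Br (Gen (E (\<pi> j))) y)"
  "ad_E \<pi> (is @ js) y = ad_E \<pi> js (ad_E \<pi> is y)"
  by (simp_all add: ad_E_def)

lemma represents_res_coeffs:
  assumes "represents C wt \<pi> v y i K \<Phi>" "distinct (i # is)" "set (i # is) \<inter> K = {}"
  shows "represents C wt \<pi> v (ad_E \<pi> is y) (last (i # is)) (K \<union> set (butlast (i # is)))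
    (res_coeffs (i # is) \<Phi>)"
  using assms
proof (induction "is" arbitrary: y i K \<Phi>)
  case (Cons j "is")
  have "represents C wt \<pi> v (ad_E \<pi> is (Br (Gen (E (\<pi> j))) y)) (last (j # is))
     (insert i K \<union> set (butlast (j # is))) (res_coeffs (j # is) (res_coeff i j \<Phi>))"
    using Cons.prems by (intro Cons.IH represents_res_coeff) auto
  then show ?case by simp
qed simp

text \<open>The head of the sequence, which is eliminated first, is the innermost entry of the bracket.\<close>

definition nested_bracket :: "('i \<Rightarrow> 'r) \<Rightarrow> 'i list \<Rightarrow> 'r chevalley lie_term" where
  "nested_bracket \<pi> I = ad_E \<pi> (tl I) (Gen (E (\<pi> (hd I))))"

definition Res_coefficients ::
    "('i \<Rightarrow> 'r) \<Rightarrow> 'i list \<Rightarrow> ('n::finite, 'r) vect \<Rightarrow> ('n \<Rightarrow> 'i list) \<Rightarrow> complex" where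
  "Res_coefficients \<pi> I v = res_coeffs I (\<lambda>D. Poly_Mapping.lookup v (\<lambda>\<nu>. map \<pi> (D \<nu>)))"

lemma Res_seq_polydiff:
  assumes "I \<noteq> []" "finite X" "generic_on z (insert (last I) X) t"
  shows "Res_seq I (polydiff \<pi> z v) X t = pd_of z (Res_coefficients \<pi> I v) X t"
proof -
  obtain i "is" where I: "I = i # is" using assms(1) by (cases I) auto
  have "pd_agrees z i (polydiff \<pi> z v) (\<lambda>D. Poly_Mapping.lookup v (\<lambda>\<nu>. map \<pi> (D \<nu>)))"
    by (simp add: pd_agrees_def polydiff_eq_pd_of)
  from pd_agrees_Res_seq[OF this, of "is"] assms show ?thesis
    by (simp only: pd_agrees_def Res_coefficients_def I)
qed

lemma Res_coefficients_eq:
  assumes "I \<noteq> []" "distinct I"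
    and "nonrepeating D" "\<And>\<mu>. set (D \<mu>) \<inter> set (butlast I) = {}" "D \<nu> = xs @ last I # ys"
  shows "Res_coefficients \<pi> I v D
    = Poly_Mapping.lookup (act_at C wt \<nu> (nested_bracket \<pi> I) (strip \<nu> (map \<pi> xs) v))
        ((\<lambda>\<mu>. map \<pi> (D \<mu>))(\<nu> := map \<pi> ys))"
proof -
  obtain i "is" where I: "I = i # is" using assms(1) by (cases I) auto
  have "represents C wt \<pi> v (nested_bracket \<pi> I) (last I) (set (butlast I)) (Res_coefficients \<pi> I v)"
    using represents_res_coeffs[OF represents_start[of C wt \<pi> v i], of "is"] assms(2)
    unfolding nested_bracket_def Res_coefficients_def I by simp
  then show ?thesis using assms(3-5) unfolding represents_def by blast
qed

section \<open>Nested brackets and the root system\<close>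

lemma homogeneous_ad_E:
  assumes "homogeneous y \<beta>"
  shows "homogeneous (ad_E \<pi> is y) (\<lambda>k. (\<Sum>j\<leftarrow>is. simple_root (\<pi> j) k) + \<beta> k)"
  using assms
proof (induction "is" arbitrary: y \<beta>)
  case (Cons j "is")
  from Cons.IH[OF homogeneous_Br[OF homogeneous_E Cons.prems]] show ?case
    by (simp add: algebra_simps)
qed simp

lemma homogeneous_nested_bracket:
  assumes "J \<noteq> []" "distinct J"
  shows "homogeneous (nested_bracket \<pi> J) (alpha_seq \<pi> J)"
proof -
  obtain i "is" where J: "J = i # is" using assms(1) by (cases J) auto
  have "alpha_seq \<pi> J = (\<lambda>k. (\<Sum>j\<leftarrow>is. simple_root (\<pi> j) k) + simple_root (\<pi> i) k)"
    using assms(2) by (auto simp: alpha_seq_def J sum_list_distinct_conv_sum_set add.commute)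
  then show ?thesis
    using homogeneous_ad_E[OF homogeneous_E, of \<pi> "is"] by (simp add: nested_bracket_def J)
qed

lemma alpha_seq_nonneg: "alpha_seq \<pi> J k \<ge> 0"
  by (auto simp: alpha_seq_def simple_root_def intro: sum_nonneg)

lemma alpha_seq_nonzero:
  assumes "J \<noteq> []"
  shows "alpha_seq \<pi> J \<noteq> (\<lambda>_. 0)"
proof -
  have "simple_root (\<pi> (hd J)) (\<pi> (hd J)) \<le> alpha_seq \<pi> J (\<pi> (hd J))"
    unfolding alpha_seq_def
    by (rule member_le_sum) (use assms in \<open>auto simp: simple_root_def\<close>)
  then show ?thesis by (auto simp: simple_root_def)
qed

lemma is_root_alpha_seq:
  assumes "J \<noteq> []" "distinct J" "\<not> lie_eq (km_relations C) (nested_bracket \<pi> J) Zero"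
  shows "is_root C (alpha_seq \<pi> J)"
proof -
  have "nested_bracket \<pi> J \<in> root_space C (alpha_seq \<pi> J)"
    using homogeneous_nested_bracket[OF assms(1,2)] lie_eq.refl unfolding root_space_def by blast
  then show ?thesis using alpha_seq_nonzero[OF assms(1)] assms(3) unfolding is_root_def by blast
qed

lemma nested_bracket_prefix_nonzero:
  assumes "J \<noteq> []" "prefix J I" "\<not> lie_eq R (nested_bracket \<pi> I) Zero"
  shows "\<not> lie_eq R (nested_bracket \<pi> J) Zero"
proof
  assume *: "lie_eq R (nested_bracket \<pi> J) Zero"
  obtain K where I: "I = J @ K" using assms(2) by (auto simp: prefix_def)
  have "lie_eq R (ad_E \<pi> K y) Zero" if "lie_eq R y Zero" for y
    using that by (induction K arbitrary: y) (simp_all add: lie_eq_Br_right_Zero)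
  from this[OF *] have "lie_eq R (nested_bracket \<pi> I) Zero"
    using assms(1) by (cases J) (simp_all add: I nested_bracket_def)
  with assms(3) show False by blast
qed

text \<open>The coefficients of the iterated residue are values of the action of the bracket, which is zero on
  the module if the bracket is.\<close>

lemma nested_bracket_nonzero:
  fixes z :: "'n::finite \<Rightarrow> complex" and wt :: "'n \<Rightarrow> 'r \<Rightarrow> real" and \<pi> :: "'i \<Rightarrow> 'r"
  assumes C: "generalized_cartan_matrix C" and I: "I \<noteq> []" "distinct I"
    and v: "v \<in> V_module C wt"
    and nonzero: "\<not> pd_eq z (Res_seq I (polydiff \<pi> z v)) (\<lambda>X t. 0)"
  shows "\<not> lie_eq (km_relations C) (nested_bracket \<pi> I) Zero"
proof (cases "tl I")
  case Nil
  then have "nested_bracket \<pi> I = Gen (E (\<pi> (hd I)))" by (simp add: nested_bracket_def)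
  then show ?thesis using Gen_E_nonzero[OF C] by simp
next
  case (Cons j "is")
  then have Ieq: "I = hd I # j # is" using I(1) by (cases I) simp_all
  obtain X t where X: "finite X" and t: "t \<in> generic_points z"
    and ne: "Res_seq I (polydiff \<pi> z v) X t \<noteq> 0"
    using nonzero unfolding pd_eq_def by blast
  have "pd_of z (Res_coefficients \<pi> I v) X t \<noteq> 0"
    using ne Res_seq_polydiff[OF I(1) X generic_on_generic_points[OF t], of \<pi> v] by simp
  then obtain D where D: "D \<in> tuples X" and "Res_coefficients \<pi> I v D * zeta_prod z D t \<noteq> 0"
    unfolding pd_of_def by (rule sum.not_neutral_contains_not_neutral)
  then have ne: "Res_coefficients \<pi> I v D \<noteq> 0" by simp
  then have ne': "res_coeffs (hd I # j # is) (\<lambda>D. Poly_Mapping.lookup v (\<lambda>\<nu>. map \<pi> (D \<nu>))) D \<noteq> 0"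
    unfolding Res_coefficients_def by (subst (asm) Ieq)
  have "last I = last (j # is)" by (subst Ieq) simp
  then obtain \<nu> where "last I \<in> set (D \<nu>)" using res_coeffs_contains[OF ne'] by auto
  then obtain xs ys where \<nu>: "D \<nu> = xs @ last I # ys" by (meson split_list)
  have "set (D \<mu>) \<inter> set (butlast I) = {}" for \<mu>
    using res_coeffs_avoid[OF ne', of \<mu>] by (subst Ieq)
  then have "Res_coefficients \<pi> I v D
      = Poly_Mapping.lookup (act_at C wt \<nu> (nested_bracket \<pi> I) (strip \<nu> (map \<pi> xs) v))
        ((\<lambda>\<mu>. map \<pi> (D \<mu>))(\<nu> := map \<pi> ys))"
    using D by (intro Res_coefficients_eq I \<nu>) (simp_all add: tuples_def)
  with ne have *: "act_at C wt \<nu> (nested_bracket \<pi> I) (strip \<nu> (map \<pi> xs) v) \<noteq> 0" by auto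
  show ?thesis
  proof
    assume "lie_eq (km_relations C) (nested_bracket \<pi> I) Zero"
    then have "act_at C wt \<nu> (nested_bracket \<pi> I) (strip \<nu> (map \<pi> xs) v)
        = act_at C wt \<nu> Zero (strip \<nu> (map \<pi> xs) v)"
      by (rule act_at_respects_lie_eq[OF C _ strip_V_module[OF v]])
    with * show False by simp
  qed
qed

lemma Br_E_highest:
  assumes "highest_root C (alpha_seq \<pi> I)" "I \<noteq> []" "distinct I"
  shows "lie_eq (km_relations C) (Br (Gen (E j)) (nested_bracket \<pi> I)) Zero"
proof (rule ccontr)
  assume *: "\<not> lie_eq (km_relations C) (Br (Gen (E j)) (nested_bracket \<pi> I)) Zero"
  let ?\<beta> = "\<lambda>l. simple_root j l + alpha_seq \<pi> I l"
  have "homogeneous (Br (Gen (E j)) (nested_bracket \<pi> I)) ?\<beta>"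
    by (intro homogeneous_Br homogeneous_E homogeneous_nested_bracket assms)
  then have mem: "Br (Gen (E j)) (nested_bracket \<pi> I) \<in> root_space C ?\<beta>"
    using lie_eq.refl unfolding root_space_def by blast
  have "?\<beta> j > 0" using alpha_seq_nonneg[of \<pi> I j] by (simp add: simple_root_def)
  then have "?\<beta> \<noteq> (\<lambda>_. 0)" by (metis less_irrefl)
  with mem * have "is_root C ?\<beta>" unfolding is_root_def by blast
  then have "?\<beta> j \<le> alpha_seq \<pi> I j" using assms(1) unfolding highest_root_def by blast
  then show False by (simp add: simple_root_def)
qed


section \<open>The action of a nested bracket on all slots\<close>

lemma act_at_ad_E_commutes:
  assumes "\<mu> \<noteq> \<nu>" and y: "\<And>k v. e_tilde \<mu> k (act_at C wt \<nu> y v) = act_at C wt \<nu> y (e_tilde \<mu> k v)"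
  shows "e_tilde \<mu> k (act_at C wt \<nu> (ad_E \<pi> is y) v) = act_at C wt \<nu> (ad_E \<pi> is y) (e_tilde \<mu> k v)"
  using y
proof (induction "is" arbitrary: y k v)
  case (Cons j "is")
  have "e_tilde \<mu> k (act_at C wt \<nu> (Br (Gen (E (\<pi> j))) y) v)
      = act_at C wt \<nu> (Br (Gen (E (\<pi> j))) y) (e_tilde \<mu> k v)" for k v
    by (simp add: vect_linearD(4)[OF vect_linear_e] e_e_different_slots[OF assms(1)] Cons.prems)
  from Cons.IH[OF this] show ?case by simp
qed simp

text \<open>The mixed terms of the bracket cancel, as the actions in different slots commute.\<close>

lemma act_Br_E:
  fixes v :: "('n::finite, 'r) vect"
  assumes y: "\<And>v :: ('n, 'r) vect. act C wt y v = (\<Sum>\<nu>\<in>UNIV. act_at C wt \<nu> y v)"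
    and comm: "\<And>\<mu> \<nu> k v. \<mu> \<noteq> \<nu> \<Longrightarrow> e_tilde \<mu> k (act_at C wt \<nu> y v) = act_at C wt \<nu> y (e_tilde \<mu> k v)"
  shows "act C wt (Br (Gen (E k)) y) v = (\<Sum>\<nu>\<in>UNIV. act_at C wt \<nu> (Br (Gen (E k)) y) v)"
proof -
  have "act C wt (Br (Gen (E k)) y) v
      = (\<Sum>\<mu>\<in>UNIV. \<Sum>\<nu>\<in>UNIV. e_tilde \<mu> k (act_at C wt \<nu> y v))
        - (\<Sum>\<nu>\<in>UNIV. \<Sum>\<mu>\<in>UNIV. act_at C wt \<nu> y (e_tilde \<mu> k v))"
    by (simp add: y vect_linear_sum[OF vect_linear_e] vect_linear_sum[OF vect_linear_act_at])
  also have "(\<Sum>\<mu>\<in>UNIV. \<Sum>\<nu>\<in>UNIV. e_tilde \<mu> k (act_at C wt \<nu> y v))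
      = (\<Sum>\<nu>\<in>UNIV. \<Sum>\<mu>\<in>UNIV. e_tilde \<mu> k (act_at C wt \<nu> y v))"
    by (rule sum.swap)
  also have "\<dots> - (\<Sum>\<nu>\<in>UNIV. \<Sum>\<mu>\<in>UNIV. act_at C wt \<nu> y (e_tilde \<mu> k v))
      = (\<Sum>\<nu>\<in>UNIV. \<Sum>\<mu>\<in>UNIV. e_tilde \<mu> k (act_at C wt \<nu> y v) - act_at C wt \<nu> y (e_tilde \<mu> k v))"
    by (simp only: sum_subtractf)
  also have "\<dots> = (\<Sum>\<nu>\<in>UNIV. \<Sum>\<mu>\<in>UNIV. if \<mu> = \<nu> then act_at C wt \<nu> (Br (Gen (E k)) y) v else 0)"
    by (intro sum.cong HOL.refl) (simp add: comm)
  also have "\<dots> = (\<Sum>\<nu>\<in>UNIV. act_at C wt \<nu> (Br (Gen (E k)) y) v)"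
    by (simp del: act_at.simps)
  finally show ?thesis .
qed

lemma act_ad_E:
  fixes v :: "('n::finite, 'r) vect"
  assumes y: "\<And>v :: ('n, 'r) vect. act C wt y v = (\<Sum>\<nu>\<in>UNIV. act_at C wt \<nu> y v)"
    and comm: "\<And>\<mu> \<nu> k v. \<mu> \<noteq> \<nu> \<Longrightarrow> e_tilde \<mu> k (act_at C wt \<nu> y v) = act_at C wt \<nu> y (e_tilde \<mu> k v)"
  shows "act C wt (ad_E \<pi> is y) v = (\<Sum>\<nu>\<in>UNIV. act_at C wt \<nu> (ad_E \<pi> is y) v)"
  using y comm
proof (induction "is" arbitrary: y v)
  case (Cons j "is")
  have "act C wt (ad_E \<pi> is (Br (Gen (E (\<pi> j))) y)) v
      = (\<Sum>\<nu>\<in>UNIV. act_at C wt \<nu> (ad_E \<pi> is (Br (Gen (E (\<pi> j))) y)) v)"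
  proof (rule Cons.IH)
    show "act C wt (Br (Gen (E (\<pi> j))) y) v = (\<Sum>\<nu>\<in>UNIV. act_at C wt \<nu> (Br (Gen (E (\<pi> j))) y) v)" for v
      by (rule act_Br_E[OF Cons.prems])
    show "e_tilde \<mu> k (act_at C wt \<nu> (Br (Gen (E (\<pi> j))) y) v)
      = act_at C wt \<nu> (Br (Gen (E (\<pi> j))) y) (e_tilde \<mu> k v)" if "\<mu> \<noteq> \<nu>" for \<mu> \<nu> k v
      using act_at_ad_E_commutes[OF that Cons.prems(2)[OF that], of k \<pi> "[j]" v] by simp
  qed
  then show ?case by simp
qed simp

lemma act_nested_bracket:
  "act C wt (nested_bracket \<pi> I) v = (\<Sum>\<nu>\<in>UNIV. act_at C wt \<nu> (nested_bracket \<pi> I) v)"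
  unfolding nested_bracket_def by (rule act_ad_E) (simp_all add: e_e_different_slots)

lemma act_ad_E_primitive:
  assumes "\<And>k. act C wt (Gen (E k)) v = 0" "act C wt y v = 0"
  shows "act C wt (ad_E \<pi> is y) v = 0"
  using assms(2)
proof (induction "is" arbitrary: y)
  case (Cons j "is")
  have zero: "act C wt x 0 = 0" for x
  proof (induction x)
    case (Gen g)
    then show ?case
      by (cases g) (simp_all add: vect_linearD(3)[OF vect_linear_e] vect_linearD(3)[OF vect_linear_f])
  qed simp_all
  have "act C wt (Br (Gen (E (\<pi> j))) y) v = 0"
    using assms(1) Cons.prems by (simp only: act.simps(5) zero diff_self)
  from Cons.IH[OF this] show ?case by simp
qed simp

lemma act_nested_bracket_primitive:
  assumes "v \<in> V_prim C wt"
  shows "act C wt (nested_bracket \<pi> I) v = 0"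
  unfolding nested_bracket_def
  by (rule act_ad_E_primitive) (use assms in \<open>simp_all only: V_prim_def mem_Collect_eq\<close>)


section \<open>The iterated residue for the highest root\<close>

text \<open>Inserting a letter in all possible ways is multiplication by a simple fraction: this is
  the shuffle product with a word of length one.\<close>

lemma sum_insert_zeta_coeff:
  assumes "inj_on t (set xs)" "distinct xs" "u \<notin> t ` set xs" "u \<noteq> z" "z \<notin> t ` set xs" "i \<notin> set xs"
  shows "(\<Sum>p\<le>length xs. zeta_coeff (take p xs @ i # drop p xs) z (t(i := u)))
    = zeta_coeff xs z t / (u - z)"
  using assms
proof (induction xs)
  case Nil
  then show ?case by simp
next
  case (Cons x xs)
  let ?t = "t(i := u)"
  let ?b = "first_value xs z t"
  let ?s = "\<lambda>p. zeta_coeff (take p xs @ i # drop p xs) z ?t"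
  have xi: "x \<noteq> i" and ixs: "i \<notin> set xs" using Cons.prems(6) by auto
  note inj = Cons.prems(1) and dist = Cons.prems(2) and ut = Cons.prems(3)
  have b: "t x \<noteq> ?b" "u \<noteq> ?b"
  proof -
    have "t x \<noteq> ?b \<and> u \<noteq> ?b"
    proof (cases xs)
      case Nil
      then show ?thesis using Cons.prems(4,5) by auto
    next
      case (Cons y ys)
      have "t x = t y \<Longrightarrow> x = y"
        using inj by (rule inj_onD) (simp_all add: Cons)
      then show ?thesis using dist ut by (auto simp: Cons)
    qed
    then show "t x \<noteq> ?b" "u \<noteq> ?b" by simp_all
  qed
  have ux: "u \<noteq> t x" using Cons.prems(3) by auto
  have uz: "u \<noteq> z" by (rule Cons.prems(4))
  have IH: "(\<Sum>p\<le>length xs. ?s p) = zeta_coeff xs z t / (u - z)"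
    using Cons.prems by (intro Cons.IH) (auto simp: inj_on_def)
  have first: "first_value (i # xs) z ?t = u" by simp
  have fb: "first_value xs z ?t = ?b" using ixs by (cases xs) auto
  have s0: "?s 0 = zeta_coeff xs z t / (u - ?b)"
    using ixs by (simp add: zeta_coeff_Cons zeta_coeff_fun_upd fb)
  \<comment> \<open>The letter following \<open>x\<close> is the first letter of \<open>xs\<close>, except that it is
    the inserted one for \<open>p = 0\<close>.\<close>
  have step: "zeta_coeff (take (Suc p) (x # xs) @ i # drop (Suc p) (x # xs)) z ?t
     = 1 / (t x - ?b) * ?s p + (if p = 0 then (1 / (t x - u) - 1 / (t x - ?b)) * ?s 0 else 0)"
    if p: "p \<le> length xs" for p
  proof (cases p)
    case 0
    then show ?thesis using xi by (simp add: zeta_coeff_Cons[of x] algebra_simps)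
  next
    case (Suc q)
    then obtain y ys where xs: "xs = y # ys" using p by (cases xs) auto
    have "first_value (take p xs @ i # drop p xs) z ?t = ?b"
      using ixs by (auto simp: xs Suc)
    then show ?thesis using xi Suc by (simp add: zeta_coeff_Cons[of x])
  qed
  have "(\<Sum>p\<le>length (x # xs). zeta_coeff (take p (x # xs) @ i # drop p (x # xs)) z ?t)
      = zeta_coeff (i # x # xs) z ?t
        + (\<Sum>p\<le>length xs. zeta_coeff (take (Suc p) (x # xs) @ i # drop (Suc p) (x # xs)) z ?t)"
    unfolding length_Cons sum.atMost_Suc_shift by simp
  also have "(\<Sum>p\<le>length xs. zeta_coeff (take (Suc p) (x # xs) @ i # drop (Suc p) (x # xs)) z ?t)
      = (\<Sum>p\<le>length xs. 1 / (t x - ?b) * ?s p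
          + (if p = 0 then (1 / (t x - u) - 1 / (t x - ?b)) * ?s 0 else 0))"
    by (intro sum.cong HOL.refl step) simp
  also have "\<dots> = 1 / (t x - ?b) * (\<Sum>p\<le>length xs. ?s p) + (1 / (t x - u) - 1 / (t x - ?b)) * ?s 0"
    by (simp add: sum.distrib sum_distrib_left)
  also have "zeta_coeff (i # x # xs) z ?t = 1 / (u - t x) * (1 / (t x - ?b) * zeta_coeff xs z t)"
    using xi ixs by (simp add: zeta_coeff_Cons fb zeta_coeff_fun_upd)
  also have "1 / (u - t x) * (1 / (t x - ?b) * zeta_coeff xs z t)
      + (1 / (t x - ?b) * (\<Sum>p\<le>length xs. ?s p) + (1 / (t x - u) - 1 / (t x - ?b)) * ?s 0)
    = 1 / (t x - ?b) * zeta_coeff xs z t / (u - z)"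
  proof -
    \<comment> \<open>The terms without \<open>d\<close> cancel by the partial fraction identity for three points.\<close>
    have field: "1 / (u - c) * (1 / (c - b) * w) + (1 / (c - b) * (w / (u - d))
        + (1 / (c - u) - 1 / (c - b)) * (w / (u - b))) = 1 / (c - b) * w / (u - d)"
      if "u \<noteq> c" "c \<noteq> b" "u \<noteq> b" for b c d w :: complex
    proof -
      have "1 / (u - c) * (1 / (c - b)) + (1 / (c - u) - 1 / (c - b)) * (1 / (u - b)) = 0"
        using that by (simp add: divide_simps)
      then have "w * (1 / (u - c) * (1 / (c - b)) + (1 / (c - u) - 1 / (c - b)) * (1 / (u - b))) = 0"
        by simp
      moreover have "1 / (u - c) * (1 / (c - b) * w) + (1 / (c - b) * (w / (u - d))
          + (1 / (c - u) - 1 / (c - b)) * (w / (u - b)))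
        = w * (1 / (u - c) * (1 / (c - b)) + (1 / (c - u) - 1 / (c - b)) * (1 / (u - b)))
          + 1 / (c - b) * w / (u - d)"
        by (simp only: divide_inverse mult_1_left) (simp only: algebra_simps)
      ultimately show ?thesis by simp
    qed
    show ?thesis unfolding IH s0 by (rule field[OF ux b])
  qed
  finally show ?case by (simp add: zeta_coeff_Cons)
qed

lemma sum_insert_zeta_prod:
  fixes z :: "'n::finite \<Rightarrow> complex"
  assumes D: "D \<in> tuples X" "i \<notin> X" and t: "generic_on z X t"
    and u: "u \<notin> t ` X" "u \<notin> range z"
  shows "(\<Sum>p\<le>length (D \<nu>). zeta_prod z (insert_letter \<nu> p i D) (t(i := u)))
    = zeta_prod z D t / (u - z \<nu>)"
proof -
  let ?r = "\<Prod>\<mu>\<in>UNIV - {\<nu>}. zeta_coeff (D \<mu>) (z \<mu>) t"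
  have sub: "set (D \<nu>) \<subseteq> X" by (rule tuples_subset[OF D(1)])
  have i: "i \<notin> set (D \<mu>)" for \<mu> using D(2) tuples_subset[OF D(1), of \<mu>] by blast
  have g: "generic_on z (set (D \<nu>)) t" by (rule generic_on_subset[OF t sub])
  have "(\<Sum>p\<le>length (D \<nu>). zeta_coeff (take p (D \<nu>) @ i # drop p (D \<nu>)) (z \<nu>) (t(i := u)))
      = zeta_coeff (D \<nu>) (z \<nu>) t / (u - z \<nu>)"
  proof (rule sum_insert_zeta_coeff)
    show "inj_on t (set (D \<nu>))" "z \<nu> \<notin> t ` set (D \<nu>)" using g unfolding generic_on_def by auto
    show "distinct (D \<nu>)" using D(1) by (simp add: tuples_def nonrepeating_def)
    show "u \<notin> t ` set (D \<nu>)" "u \<noteq> z \<nu>" using u sub by auto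
  qed (rule i)
  moreover have "(\<Sum>p\<le>length (D \<nu>). zeta_prod z (insert_letter \<nu> p i D) (t(i := u)))
      = (\<Sum>p\<le>length (D \<nu>). zeta_coeff (take p (D \<nu>) @ i # drop p (D \<nu>)) (z \<nu>) (t(i := u))) * ?r"
    by (simp only: zeta_prod_insert_letter[OF i] sum_distrib_right)
  moreover have "zeta_prod z D t = zeta_coeff (D \<nu>) (z \<nu>) t * ?r"
    unfolding zeta_prod_def by (rule prod.remove) simp_all
  ultimately show ?thesis by simp
qed

text \<open>As the bracket with every \<open>E j\<close> vanishes, the action does not depend on how many letters
  have been removed before.\<close>

lemma act_at_strip:
  fixes v :: "('n::finite, 'r) vect"
  assumes C: "generalized_cartan_matrix C"
    and top: "\<And>j. lie_eq (km_relations C) (Br (Gen (E j)) x) Zero"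
    and v: "v \<in> V_module C wt"
  shows "act_at C wt \<nu> x (strip \<nu> ks v) = strip \<nu> ks (act_at C wt \<nu> x v)"
  using v
proof (induction ks arbitrary: v)
  case (Cons k ks)
  have "act_at C wt \<nu> (Br (Gen (E k)) x) v = act_at C wt \<nu> Zero v"
    by (rule act_at_respects_lie_eq[OF C top Cons.prems])
  then have "act_at C wt \<nu> x (e_tilde \<nu> k v) = e_tilde \<nu> k (act_at C wt \<nu> x v)" by simp
  then show ?case using Cons.IH[OF V_module.e[OF Cons.prems], of \<nu> k] by (simp add: strip_def)
qed (simp add: strip_def)

text \<open>The coefficient of the iterated residue is then the same for all positions of the
  remaining index in a given sequence, and the shuffle identity applies.\<close>

lemma Res_seq_partial_fractions:
  fixes z :: "'n::finite \<Rightarrow> complex" and wt :: "'n \<Rightarrow> 'r \<Rightarrow> real" and \<pi> :: "'i \<Rightarrow> 'r"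
  assumes C: "generalized_cartan_matrix C" and I: "I \<noteq> []" "distinct I"
    and top: "\<And>j. lie_eq (km_relations C) (Br (Gen (E j)) (nested_bracket \<pi> I)) Zero"
    and v: "v \<in> V_module C wt"
    and X: "finite X" "last I \<notin> X" and t: "generic_on z X t"
    and u: "u \<notin> t ` X" "u \<notin> range z"
  shows "Res_seq I (polydiff \<pi> z v) (insert (last I) X) (t(last I := u))
    = (\<Sum>\<nu>\<in>UNIV. pd_restrict (- set I)
        (polydiff \<pi> z (act_at C wt \<nu> (nested_bracket \<pi> I) v)) X t / (u - z \<nu>))"
proof -
  let ?i = "last I" and ?x = "nested_bracket \<pi> I"
  have setI: "set I = insert ?i (set (butlast I))"
    using arg_cong[OF append_butlast_last_id[OF I(1)], of set] by simp
  have ib: "?i \<notin> set (butlast I)"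
    using arg_cong[OF append_butlast_last_id[OF I(1)], of distinct] I(2) by simp
  have "generic_on z (insert ?i (insert ?i X)) (t(?i := u))"
    using generic_on_fun_upd[of z X ?i t u] X(2) t u by simp
  then have "Res_seq I (polydiff \<pi> z v) (insert ?i X) (t(?i := u))
      = pd_of z (Res_coefficients \<pi> I v) (insert ?i X) (t(?i := u))"
    using X(1) by (intro Res_seq_polydiff I) auto
  also have "\<dots> = (\<Sum>D\<in>tuples X. \<Sum>\<nu>\<in>UNIV. \<Sum>p\<le>length (D \<nu>).
      Res_coefficients \<pi> I v (insert_letter \<nu> p ?i D) * zeta_prod z (insert_letter \<nu> p ?i D) (t(?i := u)))"
    unfolding pd_of_def by (rule sum_tuples_insert[OF X])
  also have "\<dots> = (\<Sum>\<nu>\<in>UNIV. pd_restrict (- set I)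
        (polydiff \<pi> z (act_at C wt \<nu> ?x v)) X t / (u - z \<nu>))"
  proof (cases "X \<inter> set (butlast I) = {}")
    case True
    let ?c = "\<lambda>D \<nu>. Poly_Mapping.lookup (act_at C wt \<nu> ?x v) (\<lambda>\<mu>. map \<pi> (D \<mu>))"
    have coeff: "Res_coefficients \<pi> I v (insert_letter \<nu> p ?i D) = ?c D \<nu>"
      if D: "D \<in> tuples X" for D \<nu> p
    proof -
      let ?xs = "take p (D \<nu>)" and ?ys = "drop p (D \<nu>)"
      have i: "?i \<notin> set (D \<mu>)" for \<mu> using X(2) tuples_subset[OF D, of \<mu>] by blast
      have "set (D \<mu>) \<inter> set (butlast I) = {}" for \<mu>
        using True tuples_subset[OF D, of \<mu>] by blast
      then have "set (insert_letter \<nu> p ?i D \<mu>) \<inter> set (butlast I) = {}" for \<mu>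
        using ib by (simp add: set_insert_letter)
      moreover have "nonrepeating (insert_letter \<nu> p ?i D)"
        using D i by (intro nonrepeating_insert_letter) (simp_all add: tuples_def)
      moreover have "insert_letter \<nu> p ?i D \<nu> = ?xs @ ?i # ?ys" by (simp add: insert_letter_def)
      ultimately have "Res_coefficients \<pi> I v (insert_letter \<nu> p ?i D)
        = Poly_Mapping.lookup (act_at C wt \<nu> ?x (strip \<nu> (map \<pi> ?xs) v))
          ((\<lambda>\<mu>. map \<pi> (insert_letter \<nu> p ?i D \<mu>))(\<nu> := map \<pi> ?ys))"
        by (intro Res_coefficients_eq I)
      also have "((\<lambda>\<mu>. map \<pi> (insert_letter \<nu> p ?i D \<mu>))(\<nu> := map \<pi> ?ys))
          = (\<lambda>\<mu>. map \<pi> (D \<mu>))(\<nu> := map \<pi> ?ys)"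
        by (auto simp: insert_letter_def)
      also have "Poly_Mapping.lookup (act_at C wt \<nu> ?x (strip \<nu> (map \<pi> ?xs) v))
          ((\<lambda>\<mu>. map \<pi> (D \<mu>))(\<nu> := map \<pi> ?ys))
        = Poly_Mapping.lookup (act_at C wt \<nu> ?x v)
          ((\<lambda>\<mu>. map \<pi> (D \<mu>))(\<nu> := map \<pi> ?xs @ map \<pi> ?ys))"
        by (simp only: act_at_strip[OF C top v] lookup_strip fun_upd_upd fun_upd_same)
      also have "(\<lambda>\<mu>. map \<pi> (D \<mu>))(\<nu> := map \<pi> ?xs @ map \<pi> ?ys) = (\<lambda>\<mu>. map \<pi> (D \<mu>))"
        by (simp only: map_append[symmetric] append_take_drop_id fun_upd_triv[of "\<lambda>\<mu>. map \<pi> (D \<mu>)"])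
      finally show ?thesis .
    qed
    have "(\<Sum>D\<in>tuples X. \<Sum>\<nu>\<in>UNIV. \<Sum>p\<le>length (D \<nu>).
        Res_coefficients \<pi> I v (insert_letter \<nu> p ?i D) * zeta_prod z (insert_letter \<nu> p ?i D) (t(?i := u)))
      = (\<Sum>D\<in>tuples X. \<Sum>\<nu>\<in>UNIV. ?c D \<nu> * (\<Sum>p\<le>length (D \<nu>). zeta_prod z (insert_letter \<nu> p ?i D) (t(?i := u))))"
      by (intro sum.cong HOL.refl) (simp add: coeff sum_distrib_left)
    also have "\<dots> = (\<Sum>D\<in>tuples X. \<Sum>\<nu>\<in>UNIV. ?c D \<nu> * (zeta_prod z D t / (u - z \<nu>)))"
      by (intro sum.cong HOL.refl) (simp add: sum_insert_zeta_prod[OF _ X(2) t u])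
    also have "\<dots> = (\<Sum>\<nu>\<in>UNIV. \<Sum>D\<in>tuples X. ?c D \<nu> * (zeta_prod z D t / (u - z \<nu>)))"
      by (rule sum.swap)
    also have "\<dots> = (\<Sum>\<nu>\<in>UNIV. pd_restrict (- set I) (polydiff \<pi> z (act_at C wt \<nu> ?x v)) X t / (u - z \<nu>))"
    proof (intro sum.cong HOL.refl)
      fix \<nu>
      have "X \<subseteq> - set I" using True X(2) unfolding setI by blast
      then show "(\<Sum>D\<in>tuples X. ?c D \<nu> * (zeta_prod z D t / (u - z \<nu>)))
        = pd_restrict (- set I) (polydiff \<pi> z (act_at C wt \<nu> ?x v)) X t / (u - z \<nu>)"
        by (simp add: pd_restrict_def polydiff_eq_pd_of[OF X(1)] pd_of_def sum_divide_distrib)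
    qed
    finally show ?thesis .
  next
    case False
    then have "\<not> X \<subseteq> - set I" unfolding setI by blast
    moreover have "Res_coefficients \<pi> I v (insert_letter \<nu> p ?i D) = 0"
      if D: "D \<in> tuples X" for D \<nu> p
    proof (rule ccontr)
      assume "Res_coefficients \<pi> I v (insert_letter \<nu> p ?i D) \<noteq> 0"
      then have *: "set (insert_letter \<nu> p ?i D \<mu>) \<inter> set (butlast I) = {}" for \<mu>
        using res_coeffs_avoid[of "hd I" "tl I"] I(1) by (simp add: Res_coefficients_def)
      have "set (D \<mu>) \<inter> set (butlast I) = {}" for \<mu>
        using *[of \<mu>] by (auto simp: set_insert_letter split: if_splits)
      moreover have "X = (\<Union>\<mu>. set (D \<mu>))" using D by (simp add: tuples_def)
      ultimately show False using False by blast
    qed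
    ultimately show ?thesis by (simp add: pd_restrict_def)
  qed
  finally show ?thesis .
qed

lemma Res_seq_constant:
  fixes z :: "'n::finite \<Rightarrow> complex" and \<pi> :: "'i \<Rightarrow> 'r"
  assumes I: "I \<noteq> []" and X: "finite X" "last I \<notin> X" and t: "generic_on z X t"
    and u: "u \<notin> t ` X" "u \<notin> range z"
  shows "Res_seq I (polydiff \<pi> z v) X (t(last I := u)) = pd_of z (Res_coefficients \<pi> I v) X t"
proof -
  let ?i = "last I"
  have "generic_on z (insert ?i X) (t(?i := u))"
    using generic_on_fun_upd[of z X ?i t u] X(2) t u by simp
  then have "Res_seq I (polydiff \<pi> z v) X (t(?i := u)) = pd_of z (Res_coefficients \<pi> I v) X (t(?i := u))"
    by (intro Res_seq_polydiff I X)
  also have "\<dots> = pd_of z (Res_coefficients \<pi> I v) X t"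
    unfolding pd_of_def
  proof (intro sum.cong HOL.refl)
    fix D :: "'n \<Rightarrow> 'i list" assume D: "D \<in> tuples X"
    have "?i \<notin> set (D \<nu>)" for \<nu> using X(2) tuples_subset[OF D, of \<nu>] by blast
    then have "zeta_prod z D (t(?i := u)) = zeta_prod z D t"
      by (simp add: zeta_prod_def zeta_coeff_fun_upd)
    then show "Res_coefficients \<pi> I v D * zeta_prod z D (t(?i := u))
      = Res_coefficients \<pi> I v D * zeta_prod z D t" by simp
  qed
  finally show ?thesis .
qed

lemma not_pole_if_analytic:
  assumes "g analytic_on {p}" "\<forall>\<^sub>F w in at p. f w = g w"
  shows "\<not> is_pole f p"
proof -
  obtain e where "e > 0" "g holomorphic_on ball p e"
    using assms(1) by (auto simp: analytic_on_def)
  then have "\<not> is_pole g p" by (intro not_is_pole_holomorphic[of "ball p e"]) auto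
  then show ?thesis using is_pole_cong[OF assms(2) HOL.refl] by simp
qed

lemma has_simple_residue_partial_fractions:
  fixes z :: "'n::finite \<Rightarrow> complex"
  assumes "inj z"
  shows "has_simple_residue (\<lambda>u. \<Sum>\<mu>\<in>UNIV. c \<mu> / (u - z \<mu>)) (z \<nu>) (c \<nu>)"
proof -
  have "has_simple_residue (\<lambda>u. c \<mu> / (u - z \<mu>)) (z \<nu>) (if \<mu> = \<nu> then c \<mu> else 0)" for \<mu>
  proof (cases "\<mu> = \<nu>")
    case True
    then show ?thesis
      unfolding has_simple_residue_def by (intro exI[of _ "\<lambda>_. c \<mu>"]) simp
  next
    case False
    then have "z \<nu> \<noteq> z \<mu>" using assms by (simp add: inj_eq)
    then have "(\<lambda>u. c \<mu> / (u - z \<mu>)) analytic_on {z \<nu>}" by (intro analytic_intros) auto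
    then show ?thesis using False by (simp add: has_simple_residue_analytic)
  qed
  then have "has_simple_residue (\<lambda>u. \<Sum>\<mu>\<in>UNIV. c \<mu> / (u - z \<mu>)) (z \<nu>)
      (\<Sum>\<mu>\<in>UNIV. if \<mu> = \<nu> then c \<mu> else 0)"
    by (intro has_simple_residue_sum)
  then show ?thesis by simp
qed

text \<open>With sum zero of the coefficients the sum of the fractions vanishes to second order at
  infinity, which compensates the double pole of the differential of the coordinate.\<close>

lemma partial_fractions_at_infinity:
  fixes z :: "'n::finite \<Rightarrow> complex"
  assumes "(\<Sum>\<nu>\<in>UNIV. c \<nu>) = 0" "s \<noteq> 0" "1 / s \<notin> range z"
  shows "(\<Sum>\<nu>\<in>UNIV. c \<nu> / (1 / s - z \<nu>)) * (- 1 / s\<^sup>2) = (\<Sum>\<nu>\<in>UNIV. - (c \<nu> * z \<nu>) / (1 - s * z \<nu>))"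
proof -
  have "c \<nu> / (1 / s - z \<nu>) * (- 1 / s\<^sup>2) = - (c \<nu> * z \<nu>) / (1 - s * z \<nu>) - c \<nu> / s" for \<nu>
  proof -
    have ne: "1 - s * z \<nu> \<noteq> 0"
    proof
      assume "1 - s * z \<nu> = 0"
      then have "1 / s = z \<nu>" using assms(2) by (simp add: field_simps)
      then show False using assms(3) by blast
    qed
    have "1 / s - z \<nu> = (1 - s * z \<nu>) / s" using assms(2) by (simp add: field_simps)
    then have "c \<nu> / (1 / s - z \<nu>) * (- 1 / s\<^sup>2) = - (c \<nu> / (s * (1 - s * z \<nu>)))"
      using assms(2) ne by (simp add: power2_eq_square)
    also have "\<dots> = - (c \<nu> * z \<nu>) / (1 - s * z \<nu>) - c \<nu> / s"
      using assms(2) ne by (simp add: divide_simps) (simp add: algebra_simps)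
    finally show ?thesis .
  qed
  then have "(\<Sum>\<nu>\<in>UNIV. c \<nu> / (1 / s - z \<nu>)) * (- 1 / s\<^sup>2)
      = (\<Sum>\<nu>\<in>UNIV. - (c \<nu> * z \<nu>) / (1 - s * z \<nu>) - c \<nu> / s)"
    by (simp only: sum_distrib_right)
  also have "\<dots> = (\<Sum>\<nu>\<in>UNIV. - (c \<nu> * z \<nu>) / (1 - s * z \<nu>)) - (\<Sum>\<nu>\<in>UNIV. c \<nu>) / s"
    by (simp only: sum_subtractf sum_divide_distrib)
  finally show ?thesis using assms(1) by simp
qed

lemma polydiff_sum:
  assumes "finite X"
  shows "polydiff \<pi> z (\<Sum>\<nu>\<in>A. w \<nu>) X t = (\<Sum>\<nu>\<in>A. polydiff \<pi> z (w \<nu>) X t)"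
  unfolding polydiff_eq_pd_of[OF assms] pd_of_def lookup_sum sum_distrib_right by (rule sum.swap)

lemma pd_restrict_sum:
  assumes "finite X"
  shows "(\<Sum>\<nu>\<in>UNIV. pd_restrict A (polydiff \<pi> z (w \<nu>)) X t)
    = pd_restrict A (polydiff \<pi> z (\<Sum>\<nu>\<in>UNIV. w \<nu>)) X t"
  by (simp add: pd_restrict_def polydiff_sum[OF assms])

context
  fixes C :: "'r::finite \<Rightarrow> 'r \<Rightarrow> int" and \<pi> :: "'i \<Rightarrow> 'r"
    and wt :: "'n::finite \<Rightarrow> 'r \<Rightarrow> real" and I :: "'i list" and z :: "'n \<Rightarrow> complex"
    and v :: "('n, 'r) vect" and X :: "'i set" and t :: "'i \<Rightarrow> complex"
  assumes C: "generalized_cartan_matrix C" and I: "I \<noteq> []" "distinct I"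
    and top: "\<And>j. lie_eq (km_relations C) (Br (Gen (E j)) (nested_bracket \<pi> I)) Zero"
    and v: "v \<in> V_module C wt" and X: "finite X" and t: "t \<in> generic_points z"
begin

private abbreviation "residue_at \<nu> Y \<equiv>
  pd_restrict (- set I) (polydiff \<pi> z (act_at C wt \<nu> (nested_bracket \<pi> I) v)) Y t"

lemma Res_seq_eventually:
  obtains "last I \<in> X" "\<And>u. u \<notin> t ` (X - {last I}) \<union> range z \<Longrightarrow>
      Res_seq I (polydiff \<pi> z v) X (t(last I := u)) = (\<Sum>\<nu>\<in>UNIV. residue_at \<nu> (X - {last I}) / (u - z \<nu>))"
  | c where "last I \<notin> X" "\<And>u. u \<notin> t ` (X - {last I}) \<union> range z \<Longrightarrow>
      Res_seq I (polydiff \<pi> z v) X (t(last I := u)) = c"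
proof (cases "last I \<in> X")
  case True
  have "Res_seq I (polydiff \<pi> z v) X (t(last I := u)) = (\<Sum>\<nu>\<in>UNIV. residue_at \<nu> (X - {last I}) / (u - z \<nu>))"
    if "u \<notin> t ` (X - {last I}) \<union> range z" for u
    using Res_seq_partial_fractions[OF C I top v, of "X - {last I}" z t u] X that
      generic_on_generic_points[OF t] True by (simp add: insert_absorb)
  then show ?thesis using that(1) True by blast
next
  case False
  have "Res_seq I (polydiff \<pi> z v) X (t(last I := u)) = pd_of z (Res_coefficients \<pi> I v) X t"
    if "u \<notin> t ` (X - {last I}) \<union> range z" for u
    using that False by (intro Res_seq_constant I X generic_on_generic_points[OF t]) simp_all
  then show ?thesis using that(2) False by blast
qed

lemma Res_seq_pole:
  assumes "pole_at (last I) p (Res_seq I (polydiff \<pi> z v)) X t"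
  shows "p \<in> range z"
proof (rule ccontr)
  assume p: "p \<notin> range z"
  have ev: "\<forall>\<^sub>F u in at p. u \<notin> t ` (X - {last I}) \<union> range z"
    using X by (intro eventually_notin_finite) simp
  have "\<not> is_pole (\<lambda>u. Res_seq I (polydiff \<pi> z v) X (t(last I := u))) p"
  proof (cases rule: Res_seq_eventually)
    case 1
    have "(\<lambda>u. \<Sum>\<nu>\<in>UNIV. residue_at \<nu> (X - {last I}) / (u - z \<nu>)) analytic_on {p}"
      using p by (intro analytic_intros) auto
    then show ?thesis
      by (rule not_pole_if_analytic) (rule eventually_mono[OF ev 1(2)])
  next
    case (2 c)
    have "(\<lambda>u. c) analytic_on {p}" by (intro analytic_intros)
    then show ?thesis
      by (rule not_pole_if_analytic) (rule eventually_mono[OF ev 2(2)])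
  qed
  then show False using assms unfolding pole_at_def by blast
qed

lemma Res_seq_infinity:
  assumes "v \<in> V_prim C wt"
  shows "\<not> pole_at_infinity (last I) (Res_seq I (polydiff \<pi> z v)) X t"
proof -
  let ?F = "t ` (X - {last I}) \<union> range z"
  \<comment> \<open>The formula for the residue is available at \<open>1 / s\<close> for all small nonzero \<open>s\<close>.\<close>
  have "\<forall>\<^sub>F s in at 0. s \<notin> insert 0 ((\<lambda>a. 1 / a) ` ?F)"
    using X by (intro eventually_notin_finite) simp
  then have ev: "\<forall>\<^sub>F s in at 0. s \<noteq> 0 \<and> 1 / s \<notin> ?F"
  proof eventually_elim
    case (elim s)
    have "1 / s \<notin> ?F"
    proof
      assume "1 / s \<in> ?F"
      then have "1 / (1 / s) \<in> (\<lambda>a. 1 / a) ` ?F" by (rule imageI)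
      then show False using elim by simp
    qed
    then show ?case using elim by simp
  qed
  have "\<not> is_pole (\<lambda>s. Res_seq I (polydiff \<pi> z v) X (t(last I := 1 / s))
      * (if last I \<in> X then - 1 / s\<^sup>2 else 1)) 0"
  proof (cases rule: Res_seq_eventually)
    case 1
    let ?c = "\<lambda>\<nu>. residue_at \<nu> (X - {last I})"
    have "(\<Sum>\<nu>\<in>UNIV. ?c \<nu>) = pd_restrict (- set I) (polydiff \<pi> z 0) (X - {last I}) t"
      using X by (simp add: pd_restrict_sum act_nested_bracket[symmetric]
          act_nested_bracket_primitive[OF assms])
    then have c: "(\<Sum>\<nu>\<in>UNIV. ?c \<nu>) = 0" by (simp add: pd_restrict_def polydiff_def)
    have "(\<lambda>s. \<Sum>\<nu>\<in>UNIV. - (?c \<nu> * z \<nu>) / (1 - s * z \<nu>)) analytic_on {0}"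
      by (intro analytic_intros) auto
    moreover have "\<forall>\<^sub>F s in at 0. Res_seq I (polydiff \<pi> z v) X (t(last I := 1 / s))
      * (if last I \<in> X then - 1 / s\<^sup>2 else 1) = (\<Sum>\<nu>\<in>UNIV. - (?c \<nu> * z \<nu>) / (1 - s * z \<nu>))"
      using ev
    proof eventually_elim
      case (elim s)
      have "Res_seq I (polydiff \<pi> z v) X (t(last I := 1 / s)) = (\<Sum>\<nu>\<in>UNIV. ?c \<nu> / (1 / s - z \<nu>))"
        using elim by (intro 1(2)) simp
      then show ?case
        using partial_fractions_at_infinity[OF c, of s z] elim 1(1) by simp
    qed
    ultimately show ?thesis by (rule not_pole_if_analytic)
  next
    case (2 c)
    have "(\<lambda>s. c) analytic_on {0}" by (intro analytic_intros)
    moreover have "\<forall>\<^sub>F s in at 0. Res_seq I (polydiff \<pi> z v) X (t(last I := 1 / s))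
      * (if last I \<in> X then - 1 / s\<^sup>2 else 1) = c"
      using ev
    proof eventually_elim
      case (elim s)
      then show ?case using 2(1) 2(2)[of "1 / s"] by simp
    qed
    ultimately show ?thesis by (rule not_pole_if_analytic)
  qed
  then show ?thesis unfolding pole_at_infinity_def .
qed

lemma Res_seq_residue_sum:
  assumes "inj z"
  shows "pd_restrict (- set I) (polydiff \<pi> z (act C wt (nested_bracket \<pi> I) v)) X t
    = (\<Sum>\<nu>\<in>UNIV. Res_point (last I) (z \<nu>) (Res_seq I (polydiff \<pi> z v)) X t)"
proof (cases "last I \<in> X")
  case True
  then have "\<not> X \<subseteq> - set I" using I(1) last_in_set by blast
  then show ?thesis using True by (simp add: pd_restrict_def Res_point_def)
next
  case False
  have "Res_point (last I) (z \<nu>) (Res_seq I (polydiff \<pi> z v)) X t = residue_at \<nu> X" for \<nu>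
  proof -
    have "\<forall>\<^sub>F u in at (z \<nu>). u \<notin> t ` X \<union> range z"
      using X by (intro eventually_notin_finite) simp
    then have "\<forall>\<^sub>F u in at (z \<nu>). Res_seq I (polydiff \<pi> z v) (insert (last I) X) (t(last I := u))
        = (\<Sum>\<mu>\<in>UNIV. residue_at \<mu> X / (u - z \<mu>))"
    proof eventually_elim
      case (elim u)
      then show ?case
        by (intro Res_seq_partial_fractions C I top v X False generic_on_generic_points[OF t]) simp_all
    qed
    with has_simple_residue_partial_fractions[OF assms]
    have "has_simple_residue (\<lambda>u. Res_seq I (polydiff \<pi> z v) (insert (last I) X) (t(last I := u)))
        (z \<nu>) (residue_at \<nu> X)"
      by (rule has_simple_residue_cong)
    from has_simple_residue_imp_residue[OF this] show ?thesis
      using False by (simp add: Res_point_def)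
  qed
  then show ?thesis by (simp add: act_nested_bracket pd_restrict_sum[OF X])
qed

end

theorem theorem2p14:
  fixes C :: "'r::finite \<Rightarrow> 'r \<Rightarrow> int"
    and \<pi> :: "'i::countable \<Rightarrow> 'r"
    and wt :: "'n::finite \<Rightarrow> 'r \<Rightarrow> real"
    and I :: "'i list"
  assumes "generalized_cartan_matrix C"
    and "surj \<pi>"
    and "\<And>k. infinite (\<pi> -` {k})"
    and "\<And>\<nu> k. wt \<nu> k \<ge> 0"
    and "I \<noteq> []" and "distinct I"
    and "\<exists>v \<in> V_module C wt. \<exists>z. inj z \<and> \<not> pd_eq z (Res_seq I (polydiff \<pi> z v)) (\<lambda>X t. 0)"
  shows "(\<forall>J. J \<noteq> [] \<and> prefix J I \<longrightarrow> is_root C (alpha_seq \<pi> J)) \<and>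
    (lie_simple (km_relations C) \<and> lie_finite_dim (km_relations C) \<and>
       highest_root C (alpha_seq \<pi> I) \<longrightarrow>
      (\<forall>z v X t p. inj z \<and> v \<in> V_module C wt \<and> finite X \<and> t \<in> generic_points z \<and>
         pole_at (last I) p (Res_seq I (polydiff \<pi> z v)) X t \<longrightarrow> p \<in> range z) \<and>
      (\<forall>z v X t. inj z \<and> v \<in> V_prim C wt \<and> finite X \<and> t \<in> generic_points z \<longrightarrow>
         \<not> pole_at_infinity (last I) (Res_seq I (polydiff \<pi> z v)) X t) \<and>
      (\<exists>x. generates_root_space C (alpha_seq \<pi> I) x \<and>
         (\<forall>z v. inj z \<and> v \<in> V_module C wt \<longrightarrow>
            pd_eq z (pd_restrict (- set I) (polydiff \<pi> z (act C wt x v)))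
              (\<lambda>X t. \<Sum>\<nu>\<in>UNIV.
                 Res_point (last I) (z \<nu>) (Res_seq I (polydiff \<pi> z v)) X t))))"
proof -
  obtain v0 z0 where v0: "v0 \<in> V_module C wt"
    and z0: "\<not> pd_eq z0 (Res_seq I (polydiff \<pi> z0 v0)) (\<lambda>X t. 0)"
    using assms(7) by blast
  let ?x = "nested_bracket \<pi> I"
  have x: "\<not> lie_eq (km_relations C) ?x Zero"
    by (rule nested_bracket_nonzero[OF assms(1,5,6) v0 z0])
  have roots: "is_root C (alpha_seq \<pi> J)" if "J \<noteq> []" "prefix J I" for J
  proof (rule is_root_alpha_seq[OF that(1)])
    show "distinct J" using that(2) assms(6) by (auto simp: prefix_def)
    show "\<not> lie_eq (km_relations C) (nested_bracket \<pi> J) Zero"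
      by (rule nested_bracket_prefix_nonzero[OF that x])
  qed
  show ?thesis
  proof (intro conjI allI impI)
    fix J assume "J \<noteq> [] \<and> prefix J I"
    then show "is_root C (alpha_seq \<pi> J)" using roots by blast
  next
    fix z :: "'n \<Rightarrow> complex" and v and X :: "'i set" and t p
    assume hyp: "lie_simple (km_relations C) \<and> lie_finite_dim (km_relations C) \<and>
        highest_root C (alpha_seq \<pi> I)"
      and *: "inj z \<and> v \<in> V_module C wt \<and> finite X \<and> t \<in> generic_points z \<and>
         pole_at (last I) p (Res_seq I (polydiff \<pi> z v)) X t"
    have top: "\<And>j. lie_eq (km_relations C) (Br (Gen (E j)) ?x) Zero"
      using hyp by (intro Br_E_highest assms) simp
    from * have "v \<in> V_module C wt" "finite X" "t \<in> generic_points z"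
      "pole_at (last I) p (Res_seq I (polydiff \<pi> z v)) X t" by simp_all
    then show "p \<in> range z" by (rule Res_seq_pole[OF assms(1,5,6) top])
  next
    fix z :: "'n \<Rightarrow> complex" and v and X :: "'i set" and t :: "'i \<Rightarrow> complex"
    assume hyp: "lie_simple (km_relations C) \<and> lie_finite_dim (km_relations C) \<and>
        highest_root C (alpha_seq \<pi> I)"
      and *: "inj z \<and> v \<in> V_prim C wt \<and> finite X \<and> t \<in> generic_points z"
    have top: "\<And>j. lie_eq (km_relations C) (Br (Gen (E j)) ?x) Zero"
      using hyp by (intro Br_E_highest assms) simp
    from * have prim: "v \<in> V_prim C wt" and "finite X" "t \<in> generic_points z" by blast+
    moreover from prim have "v \<in> V_module C wt" by (simp add: V_prim_def)
    ultimately show "\<not> pole_at_infinity (last I) (Res_seq I (polydiff \<pi> z v)) X t"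
      by (intro Res_seq_infinity[OF assms(1,5,6) top])
  next
    assume hyp: "lie_simple (km_relations C) \<and> lie_finite_dim (km_relations C) \<and>
        highest_root C (alpha_seq \<pi> I)"
    have top: "\<And>j. lie_eq (km_relations C) (Br (Gen (E j)) ?x) Zero"
      using hyp by (intro Br_E_highest assms) simp
    have "generates_root_space C (alpha_seq \<pi> I) ?x"
      using hyp by (intro simple_highest_generates homogeneous_nested_bracket assms x top) simp
    moreover have "pd_eq z (pd_restrict (- set I) (polydiff \<pi> z (act C wt ?x v)))
        (\<lambda>X t. \<Sum>\<nu>\<in>UNIV. Res_point (last I) (z \<nu>) (Res_seq I (polydiff \<pi> z v)) X t)"
      if "inj z" "v \<in> V_module C wt" for z :: "'n \<Rightarrow> complex" and v
      unfolding pd_eq_def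
      using that by (intro allI impI ballI Res_seq_residue_sum[OF assms(1,5,6) top])
    ultimately show "\<exists>x. generates_root_space C (alpha_seq \<pi> I) x \<and>
         (\<forall>z v. inj z \<and> v \<in> V_module C wt \<longrightarrow>
            pd_eq z (pd_restrict (- set I) (polydiff \<pi> z (act C wt x v)))
              (\<lambda>X t. \<Sum>\<nu>\<in>UNIV.
                 Res_point (last I) (z \<nu>) (Res_seq I (polydiff \<pi> z v)) X t))"
      by blast
  qed
qed

end
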